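(* The system $\mathsf{RCA}_0^{\omega}+\mathsf{IND}$ proves the implication $\mathsf{SUM}\rightarrow\mathsf{cocode}_0$. Here $\mathsf{SUM}$ is the statement: "if $(a_x)_{x\in[0,1]}$ is Cauchy and non-negative, then there is a sequence of reals $(y_i)_{i\in\mathbb N}$ in $[0,1]$ such that for all $y\in[0,1]$, $a_y=_{\mathbb R}0$ in case $(\forall i\in\mathbb N)(y\neq_{\mathbb R}y_i)$"; and $\mathsf{cocode}_0$ is the statement: "for any non-empty countable set $A\subseteq[0,1]$, there is a sequence $(x_n)_{n\in\mathbb N}$ in $A$ such that $(\forall x\in\mathbb R)(x\in A\leftrightarrow(\exists n\in\mathbb N)(x_n=_{\mathbb R}x))$".
   Context: Language and base theory. The finite types are generated by: $0$ is a type, and if $\sigma,\tau$ are types then so is $\sigma\to\tau$. Type $0$ is the type of natural numbers, $1:=0\to0$, $n+1:=n\to0$. The language $\mathsf{L}_\omega$ of higher-order arithmetic has variables of all finite types, the constants $0,1,<_0,+_0,\times_0,=_0$ on type $0$, combinators, and recursor constants $\mathbf{R}_\sigma$ for each type $\sigma$; finite sequences of objects of type $0$ or $1$ are available via types $0^*$, $1^*$ (or coding). Equality at type $\tau=(\tau_1\to\dots\to\tau_k\to0)$ is defined by $x=_\tau y\equiv(\forall z_1^{\tau_1}\dots z_k^{\tau_k})(xz_1\dots z_k=_0yz_1\dots z_k)$. The theory $\mathsf{RCA}_0^\omega$ (Kohlenbach's base theory of higher-order Reverse Mathematics, with classical logic) consists of: (a) axioms that $0,1,<_0,+_0,\times_0$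 form an ordered semi-ring with equality $=_0$; (b) the defining axioms of the $\Pi$ and $\Sigma$ combinators (i.e. $K$ and $S$), giving $\lambda$-abstraction in all types; (c) the axiom for $\mathbf{R}_0$: $\mathbf{R}_0(f,m,0)=m$, $\mathbf{R}_0(f,m,n+1)=f(n,\mathbf{R}_0(f,m,n))$ for $m^0,f^1$ (with pairs of numbers coded); (d) extensionality: $x=_\rho y\to\varphi(x)=_\tau\varphi(y)$ for all $x^\rho,y^\rho,\varphi^{\rho\to\tau}$ and all types $\rho,\tau$; (e) induction for quantifier-free formulas of $\mathsf{L}_\omega$ (with parameters of any type); (f) $\mathsf{QF\text{-}AC}^{1,0}$, where for types $\sigma,\tau$ the schema $\mathsf{QF\text{-}AC}^{\sigma,\tau}$ is $(\forall x^\sigma)(\exists y^\tau)A(x,y)\to(\exists Y^{\sigma\to\tau})(\forall x^\sigma)A(x,Y(x))$ for quantifier-free $A$. $\mathsf{IND}$ is the induction axiom (schema) for all formulas of $\mathsf{L}_\omega$. Reals, functions, sets. Real numbers are coded by sequences of rationals $(q_n)$ with $|q_n-q_{n+i}|<2^{-n}$ for all $n,i$; $x=_{\mathbb R}y$ for reals coded by $(q_n),(r_n)$ means $|q_n-r_n|\le2^{-n+1}$ for all $n$, and $<_{\mathbb R}$ is defined similarly. Functions on $\mathbb{R}$ or $[0,1]$ (with values in $\mathbb R$ or $\mathbb N$) are functionals on codes that map $=_{\mathbb R}$-equal reals to equal values. A set $A\subseteq\mathbb R$ is given by its characteristic function $F_A:\mathbb R\to\{0,1\}$, and $x\in A$ means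 $F_A(x)=1$. A set $A\subseteq\mathbb R$ is countable if there is $Y:\mathbb R\to\mathbb N$ such that $(\forall x,y\in A)(Y(x)=_0Y(y)\to x=_{\mathbb R}y)$. Unordered sums. $(a_x)_{x\in[0,1]}$ denotes a function $a:[0,1]\to\mathbb R$, $a_x:=a(x)$; it is non-negative if $a_x\ge0$ for all $x\in[0,1]$. Let $\mathrm{fin}$ denote the collection of finite sequences of reals in $[0,1]$ without repetitions (viewed as finite sets). $(a_x)_{x\in[0,1]}$ is Cauchy if for every $\varepsilon>0$ there is $I\in\mathrm{fin}$ such that for all $J\in\mathrm{fin}$ with $J\cap I=\emptyset$, $|\sum_{x\in J}a_x|<\varepsilon$. *)

theory Defs
  imports Main
begin

section \<open>The language of higher-order arithmetic\<close>

datatype ty = T0 | Arrow ty ty (infixr "\<^bold>\<Rightarrow>" 65)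

abbreviation T1 :: ty where "T1 \<equiv> T0 \<^bold>\<Rightarrow> T0"
abbreviation T2 :: ty where "T2 \<equiv> T1 \<^bold>\<Rightarrow> T0"

text \<open>\<open>KC\<close> and \<open>SC\<close> are the combinators \<open>\<Pi>\<close> and \<open>\<Sigma>\<close>.  The language has a recursor
  constant for every type, but only \<open>Rec T0\<close> is governed by an axiom below.\<close>

datatype con = Zero | One | Plus | Times | KC ty ty | SC ty ty ty | Rec ty

primrec con_ty :: "con \<Rightarrow> ty" where
  "con_ty Zero = T0"
| "con_ty One = T0"
| "con_ty Plus = T0 \<^bold>\<Rightarrow> T0 \<^bold>\<Rightarrow> T0"
| "con_ty Times = T0 \<^bold>\<Rightarrow> T0 \<^bold>\<Rightarrow> T0"
| "con_ty (KC \<sigma> \<tau>) = \<sigma> \<^bold>\<Rightarrow> \<tau> \<^bold>\<Rightarrow> \<sigma>"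
| "con_ty (SC \<rho> \<sigma> \<tau>) = (\<rho> \<^bold>\<Rightarrow> \<sigma> \<^bold>\<Rightarrow> \<tau>) \<^bold>\<Rightarrow> (\<rho> \<^bold>\<Rightarrow> \<sigma>) \<^bold>\<Rightarrow> \<rho> \<^bold>\<Rightarrow> \<tau>"
| "con_ty (Rec \<sigma>) = (T0 \<^bold>\<Rightarrow> \<sigma> \<^bold>\<Rightarrow> \<sigma>) \<^bold>\<Rightarrow> \<sigma> \<^bold>\<Rightarrow> T0 \<^bold>\<Rightarrow> \<sigma>"

text \<open>Variables are de Bruijn indices.  A typing context is a list of types whose head is the
  type of \<open>V 0\<close>, the variable bound by the innermost quantifier.\<close>

datatype tm = V nat | C con | App tm tm (infixl "\<cdot>" 90)

primrec ty_of :: "ty list \<Rightarrow> tm \<Rightarrow> ty option" where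
  "ty_of \<Gamma> (V i) = (if i < length \<Gamma> then Some (\<Gamma> ! i) else None)"
| "ty_of \<Gamma> (C c) = Some (con_ty c)"
| "ty_of \<Gamma> (s \<cdot> t) =
     (case ty_of \<Gamma> s of
        Some (\<sigma> \<^bold>\<Rightarrow> \<tau>) \<Rightarrow> (if ty_of \<Gamma> t = Some \<sigma> then Some \<tau> else None)
      | _ \<Rightarrow> None)"

datatype fm =
    Eq tm tm (infix "\<^bold>=" 50)
  | Lt tm tm (infix "\<^bold><" 50)
  | Falsum ("\<^bold>\<bottom>")
  | Imp fm fm (infixr "\<^bold>\<longrightarrow>" 25)
  | Forall ty fm

abbreviation Neg :: "fm \<Rightarrow> fm" ("\<^bold>\<not> _" [40] 40) where
  "\<^bold>\<not> \<phi> \<equiv> \<phi> \<^bold>\<longrightarrow> \<^bold>\<bottom>"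
abbreviation Conj :: "fm \<Rightarrow> fm \<Rightarrow> fm" (infixr "\<^bold>\<and>" 35) where
  "\<phi> \<^bold>\<and> \<psi> \<equiv> \<^bold>\<not> (\<phi> \<^bold>\<longrightarrow> \<^bold>\<not> \<psi>)"
abbreviation Disj :: "fm \<Rightarrow> fm \<Rightarrow> fm" (infixr "\<^bold>\<or>" 30) where
  "\<phi> \<^bold>\<or> \<psi> \<equiv> \<^bold>\<not> \<phi> \<^bold>\<longrightarrow> \<psi>"
abbreviation Iff :: "fm \<Rightarrow> fm \<Rightarrow> fm" (infix "\<^bold>\<longleftrightarrow>" 25) where
  "\<phi> \<^bold>\<longleftrightarrow> \<psi> \<equiv> (\<phi> \<^bold>\<longrightarrow> \<psi>) \<^bold>\<and> (\<psi> \<^bold>\<longrightarrow> \<phi>)"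
abbreviation Exists :: "ty \<Rightarrow> fm \<Rightarrow> fm" where
  "Exists \<sigma> \<phi> \<equiv> \<^bold>\<not> Forall \<sigma> (\<^bold>\<not> \<phi>)"

primrec wf_fm :: "ty list \<Rightarrow> fm \<Rightarrow> bool" where
  "wf_fm \<Gamma> (s \<^bold>= t) \<longleftrightarrow> ty_of \<Gamma> s = Some T0 \<and> ty_of \<Gamma> t = Some T0"
| "wf_fm \<Gamma> (s \<^bold>< t) \<longleftrightarrow> ty_of \<Gamma> s = Some T0 \<and> ty_of \<Gamma> t = Some T0"
| "wf_fm \<Gamma> \<^bold>\<bottom> \<longleftrightarrow> True"
| "wf_fm \<Gamma> (\<phi> \<^bold>\<longrightarrow> \<psi>) \<longleftrightarrow> wf_fm \<Gamma> \<phi> \<and> wf_fm \<Gamma> \<psi>"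
| "wf_fm \<Gamma> (Forall \<sigma> \<phi>) \<longleftrightarrow> wf_fm (\<sigma> # \<Gamma>) \<phi>"

primrec quantifier_free :: "fm \<Rightarrow> bool" where
  "quantifier_free (s \<^bold>= t) \<longleftrightarrow> True"
| "quantifier_free (s \<^bold>< t) \<longleftrightarrow> True"
| "quantifier_free \<^bold>\<bottom> \<longleftrightarrow> True"
| "quantifier_free (\<phi> \<^bold>\<longrightarrow> \<psi>) \<longleftrightarrow> quantifier_free \<phi> \<and> quantifier_free \<psi>"
| "quantifier_free (Forall \<sigma> \<phi>) \<longleftrightarrow> False"

subsection \<open>Substitution\<close>

primrec tsub :: "(nat \<Rightarrow> tm) \<Rightarrow> tm \<Rightarrow> tm" where
  "tsub f (V i) = f i"
| "tsub f (C c) = C c"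
| "tsub f (s \<cdot> t) = tsub f s \<cdot> tsub f t"

definition lift :: "tm \<Rightarrow> tm" ("\<up>") where
  "lift = tsub (\<lambda>i. V (Suc i))"

primrec fsub :: "(nat \<Rightarrow> tm) \<Rightarrow> fm \<Rightarrow> fm" where
  "fsub f (s \<^bold>= t) = (tsub f s \<^bold>= tsub f t)"
| "fsub f (s \<^bold>< t) = (tsub f s \<^bold>< tsub f t)"
| "fsub f \<^bold>\<bottom> = \<^bold>\<bottom>"
| "fsub f (\<phi> \<^bold>\<longrightarrow> \<psi>) = (fsub f \<phi> \<^bold>\<longrightarrow> fsub f \<psi>)"
| "fsub f (Forall \<sigma> \<phi>) = Forall \<sigma> (fsub (case_nat (V 0) (\<lambda>i. \<up> (f i))) \<phi>)"

definition flift :: "fm \<Rightarrow> fm" where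
  "flift = fsub (\<lambda>i. V (Suc i))"

definition inst :: "tm \<Rightarrow> fm \<Rightarrow> fm" where
  "inst t = fsub (case_nat t V)"

section \<open>Classical many-sorted predicate logic\<close>

text \<open>\<open>prv T \<Gamma> \<Phi> \<phi>\<close> means that \<open>\<phi>\<close> is derivable in natural deduction from the assumptions
  \<open>\<Phi>\<close> and the axioms \<open>T\<close>, all variables being declared in \<open>\<Gamma>\<close>.  The axioms \<open>T \<Delta>\<close> may
  have free variables from \<open>\<Delta>\<close>; as they can be used in any context and are exempt from lifting
  in the rule \<open>ForallI\<close>, each of them amounts to its universal closure.  There are no equality
  rules, since \<open>=\<close> at type 0 is treated by the non-logical axioms.\<close>

inductive prv :: "(ty list \<Rightarrow> fm \<Rightarrow> bool) \<Rightarrow> ty list \<Rightarrow> fm set \<Rightarrow> fm \<Rightarrow> bool"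
  for T :: "ty list \<Rightarrow> fm \<Rightarrow> bool" where
  Axiom: "T \<Gamma> \<phi> \<Longrightarrow> prv T \<Gamma> \<Phi> \<phi>"
| Assumption: "\<phi> \<in> \<Phi> \<Longrightarrow> prv T \<Gamma> \<Phi> \<phi>"
| ImpI: "wf_fm \<Gamma> \<phi> \<Longrightarrow> prv T \<Gamma> (insert \<phi> \<Phi>) \<psi> \<Longrightarrow> prv T \<Gamma> \<Phi> (\<phi> \<^bold>\<longrightarrow> \<psi>)"
| ImpE: "prv T \<Gamma> \<Phi> (\<phi> \<^bold>\<longrightarrow> \<psi>) \<Longrightarrow> prv T \<Gamma> \<Phi> \<phi> \<Longrightarrow> prv T \<Gamma> \<Phi> \<psi>"
| Classical: "wf_fm \<Gamma> \<phi> \<Longrightarrow> prv T \<Gamma> (insert (\<^bold>\<not> \<phi>) \<Phi>) \<^bold>\<bottom> \<Longrightarrow> prv T \<Gamma> \<Phi> \<phi>"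
| ForallI: "prv T (\<sigma> # \<Gamma>) (flift ` \<Phi>) \<phi> \<Longrightarrow> prv T \<Gamma> \<Phi> (Forall \<sigma> \<phi>)"
| ForallE: "prv T \<Gamma> \<Phi> (Forall \<sigma> \<phi>) \<Longrightarrow> ty_of \<Gamma> t = Some \<sigma> \<Longrightarrow> prv T \<Gamma> \<Phi> (inst t \<phi>)"

definition proves :: "(ty list \<Rightarrow> fm \<Rightarrow> bool) \<Rightarrow> fm \<Rightarrow> bool" (infix "\<^bold>\<turnstile>" 20) where
  "(T \<^bold>\<turnstile> \<phi>) \<longleftrightarrow> prv T [] {} \<phi>"

section \<open>The base theory\<close>

abbreviation zero :: tm ("\<^bold>0") where "\<^bold>0 \<equiv> C Zero"
abbreviation one :: tm ("\<^bold>1") where "\<^bold>1 \<equiv> C One"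
abbreviation plus :: "tm \<Rightarrow> tm \<Rightarrow> tm" (infixl "\<^bold>+" 65) where "s \<^bold>+ t \<equiv> C Plus \<cdot> s \<cdot> t"
abbreviation times :: "tm \<Rightarrow> tm \<Rightarrow> tm" (infixl "\<^bold>*" 70) where "s \<^bold>* t \<equiv> C Times \<cdot> s \<cdot> t"

primrec eq_at :: "ty \<Rightarrow> tm \<Rightarrow> tm \<Rightarrow> fm" where
  "eq_at T0 s t = (s \<^bold>= t)"
| "eq_at (\<sigma> \<^bold>\<Rightarrow> \<tau>) s t = Forall \<sigma> (eq_at \<tau> (\<up> s \<cdot> V 0) (\<up> t \<cdot> V 0))"

text \<open>Ordered semi-ring with equality.  Non-negativity and discreteness of the order follow by
  quantifier-free induction and the recursor axiom; congruence of \<open>+\<close> and \<open>\<times>\<close> is an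
  instance of extensionality.\<close>

definition ordered_semiring_axioms :: "fm set" where
  "ordered_semiring_axioms = {
     Forall T0 (V 0 \<^bold>= V 0),
     Forall T0 (Forall T0 (V 1 \<^bold>= V 0 \<^bold>\<longrightarrow> V 0 \<^bold>= V 1)),
     Forall T0 (Forall T0 (Forall T0 (V 2 \<^bold>= V 1 \<^bold>\<longrightarrow> V 1 \<^bold>= V 0 \<^bold>\<longrightarrow> V 2 \<^bold>= V 0))),
     Forall T0 (Forall T0 (Forall T0 (Forall T0
       (V 3 \<^bold>= V 2 \<^bold>\<longrightarrow> V 1 \<^bold>= V 0 \<^bold>\<longrightarrow> V 3 \<^bold>< V 1 \<^bold>\<longrightarrow> V 2 \<^bold>< V 0)))),
     Forall T0 (Forall T0 (Forall T0 ((V 2 \<^bold>+ V 1) \<^bold>+ V 0 \<^bold>= V 2 \<^bold>+ (V 1 \<^bold>+ V 0)))),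
     Forall T0 (Forall T0 (V 1 \<^bold>+ V 0 \<^bold>= V 0 \<^bold>+ V 1)),
     Forall T0 (V 0 \<^bold>+ \<^bold>0 \<^bold>= V 0),
     Forall T0 (Forall T0 (Forall T0 ((V 2 \<^bold>* V 1) \<^bold>* V 0 \<^bold>= V 2 \<^bold>* (V 1 \<^bold>* V 0)))),
     Forall T0 (Forall T0 (V 1 \<^bold>* V 0 \<^bold>= V 0 \<^bold>* V 1)),
     Forall T0 (V 0 \<^bold>* \<^bold>1 \<^bold>= V 0),
     Forall T0 (V 0 \<^bold>* \<^bold>0 \<^bold>= \<^bold>0),
     Forall T0 (Forall T0 (Forall T0 (V 2 \<^bold>* (V 1 \<^bold>+ V 0) \<^bold>= V 2 \<^bold>* V 1 \<^bold>+ V 2 \<^bold>* V 0))),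
     Forall T0 (\<^bold>\<not> V 0 \<^bold>< V 0),
     Forall T0 (Forall T0 (Forall T0 (V 2 \<^bold>< V 1 \<^bold>\<longrightarrow> V 1 \<^bold>< V 0 \<^bold>\<longrightarrow> V 2 \<^bold>< V 0))),
     Forall T0 (Forall T0 (V 1 \<^bold>< V 0 \<^bold>\<or> V 1 \<^bold>= V 0 \<^bold>\<or> V 0 \<^bold>< V 1)),
     Forall T0 (Forall T0 (Forall T0 (V 2 \<^bold>< V 1 \<^bold>\<longrightarrow> V 2 \<^bold>+ V 0 \<^bold>< V 1 \<^bold>+ V 0))),
     Forall T0 (Forall T0 (Forall T0 (\<^bold>0 \<^bold>< V 0 \<^bold>\<longrightarrow> V 2 \<^bold>< V 1 \<^bold>\<longrightarrow> V 2 \<^bold>* V 0 \<^bold>< V 1 \<^bold>* V 0))),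
     \<^bold>0 \<^bold>< \<^bold>1 }"

definition K_axiom :: "ty \<Rightarrow> ty \<Rightarrow> fm" where
  "K_axiom \<sigma> \<tau> = Forall \<sigma> (Forall \<tau> (eq_at \<sigma> (C (KC \<sigma> \<tau>) \<cdot> V 1 \<cdot> V 0) (V 1)))"

definition S_axiom :: "ty \<Rightarrow> ty \<Rightarrow> ty \<Rightarrow> fm" where
  "S_axiom \<rho> \<sigma> \<tau> = Forall (\<rho> \<^bold>\<Rightarrow> \<sigma> \<^bold>\<Rightarrow> \<tau>) (Forall (\<rho> \<^bold>\<Rightarrow> \<sigma>) (Forall \<rho>
     (eq_at \<tau> (C (SC \<rho> \<sigma> \<tau>) \<cdot> V 2 \<cdot> V 1 \<cdot> V 0) (V 2 \<cdot> V 0 \<cdot> (V 1 \<cdot> V 0)))))"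

text \<open>The binary step function of the recursor is curried.\<close>

definition R0_axiom :: fm where
  "R0_axiom = Forall (T0 \<^bold>\<Rightarrow> T0 \<^bold>\<Rightarrow> T0) (Forall T0
     (C (Rec T0) \<cdot> V 1 \<cdot> V 0 \<cdot> \<^bold>0 \<^bold>= V 0 \<^bold>\<and>
      Forall T0 (C (Rec T0) \<cdot> V 2 \<cdot> V 1 \<cdot> (V 0 \<^bold>+ \<^bold>1) \<^bold>= V 2 \<cdot> V 0 \<cdot> (C (Rec T0) \<cdot> V 2 \<cdot> V 1 \<cdot> V 0))))"

definition ext_axiom :: "ty \<Rightarrow> ty \<Rightarrow> fm" where
  "ext_axiom \<rho> \<tau> = Forall \<rho> (Forall \<rho> (Forall (\<rho> \<^bold>\<Rightarrow> \<tau>)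
     (eq_at \<rho> (V 2) (V 1) \<^bold>\<longrightarrow> eq_at \<tau> (V 0 \<cdot> V 2) (V 0 \<cdot> V 1))))"

text \<open>Induction on \<open>V 0\<close> in \<open>\<phi>\<close>; the other free variables are parameters.\<close>

definition ind_axiom :: "fm \<Rightarrow> fm" where
  "ind_axiom \<phi> =
     (inst \<^bold>0 \<phi> \<^bold>\<longrightarrow>
      Forall T0 (\<phi> \<^bold>\<longrightarrow> fsub (case_nat (V 0 \<^bold>+ \<^bold>1) (\<lambda>i. V (Suc i))) \<phi>) \<^bold>\<longrightarrow>
      Forall T0 \<phi>)"

text \<open>In \<open>\<phi>\<close>, the variables \<open>x\<close> and \<open>y\<close> are \<open>V 1\<close> and \<open>V 0\<close>; in the conclusion,
  \<open>Y\<close> is \<open>V 1\<close> and \<open>x\<close> is \<open>V 0\<close>, so that the parameters \<open>V (k + 2)\<close> keep their indices.\<close>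

definition choice_axiom :: "ty \<Rightarrow> ty \<Rightarrow> fm \<Rightarrow> fm" where
  "choice_axiom \<sigma> \<tau> \<phi> =
     (Forall \<sigma> (Exists \<tau> \<phi>) \<^bold>\<longrightarrow>
      Exists (\<sigma> \<^bold>\<Rightarrow> \<tau>) (Forall \<sigma>
        (fsub (case_nat (V 1 \<cdot> V 0) (case_nat (V 0) (\<lambda>k. V (k + 2)))) \<phi>)))"

inductive QF_AC :: "ty \<Rightarrow> ty \<Rightarrow> ty list \<Rightarrow> fm \<Rightarrow> bool" for \<sigma> \<tau> :: ty where
  "quantifier_free \<phi> \<Longrightarrow> wf_fm (\<tau> # \<sigma> # \<Gamma>) \<phi> \<Longrightarrow> QF_AC \<sigma> \<tau> \<Gamma> (choice_axiom \<sigma> \<tau> \<phi>)"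

inductive RCA0_omega :: "ty list \<Rightarrow> fm \<Rightarrow> bool" where
  semiring: "\<phi> \<in> ordered_semiring_axioms \<Longrightarrow> RCA0_omega \<Gamma> \<phi>"
| K: "RCA0_omega \<Gamma> (K_axiom \<sigma> \<tau>)"
| S: "RCA0_omega \<Gamma> (S_axiom \<rho> \<sigma> \<tau>)"
| R0: "RCA0_omega \<Gamma> R0_axiom"
| ext: "RCA0_omega \<Gamma> (ext_axiom \<rho> \<tau>)"
| QF_IND: "quantifier_free \<phi> \<Longrightarrow> wf_fm (T0 # \<Gamma>) \<phi> \<Longrightarrow> RCA0_omega \<Gamma> (ind_axiom \<phi>)"
| QF_AC_1_0: "QF_AC T1 T0 \<Gamma> \<phi> \<Longrightarrow> RCA0_omega \<Gamma> \<phi>"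

inductive IND :: "ty list \<Rightarrow> fm \<Rightarrow> bool" where
  "wf_fm (T0 # \<Gamma>) \<phi> \<Longrightarrow> IND \<Gamma> (ind_axiom \<phi>)"

definition theory_plus ::
  "(ty list \<Rightarrow> fm \<Rightarrow> bool) \<Rightarrow> (ty list \<Rightarrow> fm \<Rightarrow> bool) \<Rightarrow> ty list \<Rightarrow> fm \<Rightarrow> bool" (infixl "\<^bold>\<union>" 65) where
  "(T \<^bold>\<union> U) \<Gamma> \<phi> \<longleftrightarrow> T \<Gamma> \<phi> \<or> U \<Gamma> \<phi>"

section \<open>Primitive recursive functions as terms\<close>

text \<open>Bracket abstraction: if \<open>t\<close> has type \<open>\<tau>\<close> in context \<open>\<sigma> # \<Gamma>\<close>, then \<open>lam \<Gamma> \<sigma> t\<close> is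
  \<open>\<lambda>x. t\<close> of type \<open>\<sigma> \<^bold>\<Rightarrow> \<tau>\<close> in context \<open>\<Gamma>\<close>, the abstracted variable being \<open>V 0\<close>.\<close>

primrec lam :: "ty list \<Rightarrow> ty \<Rightarrow> tm \<Rightarrow> tm" where
  "lam \<Gamma> \<sigma> (V i) =
     (case i of
        0 \<Rightarrow> C (SC \<sigma> (\<sigma> \<^bold>\<Rightarrow> \<sigma>) \<sigma>) \<cdot> C (KC \<sigma> (\<sigma> \<^bold>\<Rightarrow> \<sigma>)) \<cdot> C (KC \<sigma> \<sigma>)
      | Suc j \<Rightarrow> C (KC (\<Gamma> ! j) \<sigma>) \<cdot> V j)"
| "lam \<Gamma> \<sigma> (C c) = C (KC (con_ty c) \<sigma>) \<cdot> C c"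
| "lam \<Gamma> \<sigma> (s \<cdot> t) =
     C (SC \<sigma> (the (ty_of (\<sigma> # \<Gamma>) t)) (the (ty_of (\<sigma> # \<Gamma>) (s \<cdot> t)))) \<cdot> lam \<Gamma> \<sigma> s \<cdot> lam \<Gamma> \<sigma> t"

text \<open>\<open>lams \<Gamma> t\<close> abstracts all variables of the context \<open>\<Gamma>\<close>; the innermost abstraction is
  the head of \<open>\<Gamma>\<close>, so the last argument of the resulting closed term is \<open>V 0\<close> in \<open>t\<close>.\<close>

primrec lams :: "ty list \<Rightarrow> tm \<Rightarrow> tm" where
  "lams [] t = t"
| "lams (\<sigma> # \<Gamma>) t = lams \<Gamma> (lam \<Gamma> \<sigma> t)"

definition pred_tm :: "tm \<Rightarrow> tm" where
  "pred_tm t = C (Rec T0) \<cdot> lams [T0, T0] (V 1) \<cdot> \<^bold>0 \<cdot> t"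

definition monus :: "tm \<Rightarrow> tm \<Rightarrow> tm" (infixl "\<^bold>-" 65) where
  "s \<^bold>- t = C (Rec T0) \<cdot> lams [T0, T0] (pred_tm (V 0)) \<cdot> s \<cdot> t"

definition two_pow :: "tm \<Rightarrow> tm" where
  "two_pow t = C (Rec T0) \<cdot> lams [T0, T0] (V 0 \<^bold>+ V 0) \<cdot> \<^bold>1 \<cdot> t"

text \<open>Integer square root: \<open>r \<mapsto> r + 1\<close> at stage \<open>i\<close> iff \<open>(r + 1)\<^sup>2 \<le> i + 1\<close>.\<close>

definition sqrt_tm :: "tm \<Rightarrow> tm" where
  "sqrt_tm t = C (Rec T0) \<cdot>
     lams [T0, T0] (V 0 \<^bold>+ (\<^bold>1 \<^bold>- ((V 0 \<^bold>+ \<^bold>1) \<^bold>* (V 0 \<^bold>+ \<^bold>1) \<^bold>- (V 1 \<^bold>+ \<^bold>1)))) \<cdot> \<^bold>0 \<cdot> t"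

text \<open>The pairing \<open>(i, j) \<mapsto> (i + j)\<^sup>2 + i\<close> and its two projections.\<close>

definition pair :: "tm \<Rightarrow> tm \<Rightarrow> tm" where
  "pair s t = (s \<^bold>+ t) \<^bold>* (s \<^bold>+ t) \<^bold>+ s"

definition proj1 :: "tm \<Rightarrow> tm" where
  "proj1 t = t \<^bold>- sqrt_tm t \<^bold>* sqrt_tm t"

definition proj2 :: "tm \<Rightarrow> tm" where
  "proj2 t = sqrt_tm t \<^bold>- proj1 t"

section \<open>Rational and real numbers\<close>

text \<open>A number \<open>q = ((a, b), c)\<close> codes the rational \<open>(a - b) / (c + 1)\<close>, and every number is
  a code.  \<open>rat a b d\<close> is a code of \<open>(a - b) / d\<close> if \<open>d > 0\<close>.\<close>

definition pos_part :: "tm \<Rightarrow> tm" where "pos_part q = proj1 (proj1 q)"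
definition neg_part :: "tm \<Rightarrow> tm" where "neg_part q = proj2 (proj1 q)"
definition denom :: "tm \<Rightarrow> tm" where "denom q = proj2 q \<^bold>+ \<^bold>1"

definition rat :: "tm \<Rightarrow> tm \<Rightarrow> tm \<Rightarrow> tm" where
  "rat a b d = pair (pair a b) (d \<^bold>- \<^bold>1)"

definition q_zero :: tm where "q_zero = rat \<^bold>0 \<^bold>0 \<^bold>1"
definition q_one :: tm where "q_one = rat \<^bold>1 \<^bold>0 \<^bold>1"

definition q_add :: "tm \<Rightarrow> tm \<Rightarrow> tm" where
  "q_add p q = rat (pos_part p \<^bold>* denom q \<^bold>+ pos_part q \<^bold>* denom p)
                   (neg_part p \<^bold>* denom q \<^bold>+ neg_part q \<^bold>* denom p)
                   (denom p \<^bold>* denom q)"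

definition q_minus :: "tm \<Rightarrow> tm" where
  "q_minus q = rat (neg_part q) (pos_part q) (denom q)"

definition q_abs :: "tm \<Rightarrow> tm" where
  "q_abs q = rat ((pos_part q \<^bold>- neg_part q) \<^bold>+ (neg_part q \<^bold>- pos_part q)) \<^bold>0 (denom q)"

definition q_dist :: "tm \<Rightarrow> tm \<Rightarrow> tm" where
  "q_dist p q = q_abs (q_add p (q_minus q))"

text \<open>The rationals \<open>2\<^sup>-\<^sup>n\<close> and \<open>2\<^sup>-\<^sup>n\<^sup>+\<^sup>1\<close>.\<close>

definition q_pow :: "tm \<Rightarrow> tm" where "q_pow n = rat \<^bold>1 \<^bold>0 (two_pow n)"
definition q_pow' :: "tm \<Rightarrow> tm" where "q_pow' n = rat (\<^bold>1 \<^bold>+ \<^bold>1) \<^bold>0 (two_pow n)"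

definition q_lt :: "tm \<Rightarrow> tm \<Rightarrow> fm" where
  "q_lt p q = (pos_part p \<^bold>* denom q \<^bold>+ neg_part q \<^bold>* denom p
               \<^bold>< pos_part q \<^bold>* denom p \<^bold>+ neg_part p \<^bold>* denom q)"

definition q_le :: "tm \<Rightarrow> tm \<Rightarrow> fm" where
  "q_le p q = (\<^bold>\<not> q_lt q p)"

definition is_real :: "tm \<Rightarrow> fm" where
  "is_real x = Forall T0 (Forall T0
     (q_lt (q_dist (\<up> (\<up> x) \<cdot> V 1) (\<up> (\<up> x) \<cdot> (V 1 \<^bold>+ V 0))) (q_pow (V 1))))"

definition r_eq :: "tm \<Rightarrow> tm \<Rightarrow> fm" where
  "r_eq x y = Forall T0 (q_le (q_dist (\<up> x \<cdot> V 0) (\<up> y \<cdot> V 0)) (q_pow' (V 0)))"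

definition r_lt :: "tm \<Rightarrow> tm \<Rightarrow> fm" where
  "r_lt x y = Exists T0 (q_lt (q_add (\<up> x \<cdot> V 0) (q_pow' (V 0))) (\<up> y \<cdot> V 0))"

definition r_le :: "tm \<Rightarrow> tm \<Rightarrow> fm" where
  "r_le x y = (\<^bold>\<not> r_lt y x)"

definition r_zero :: tm where "r_zero = C (KC T0 T0) \<cdot> q_zero"
definition r_one :: tm where "r_one = C (KC T0 T0) \<cdot> q_one"

definition r_abs :: "tm \<Rightarrow> tm" where
  "r_abs x = lams [T0, T1] (q_abs (V 1 \<cdot> V 0)) \<cdot> x"

text \<open>The real \<open>a (w 0) + \<dots> + a (w (n - 1))\<close>.  Its \<open>k\<close>-th approximation is the sum of the
  \<open>(k + n)\<close>-th approximations of the summands, so that the error is at most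
  \<open>n * 2\<^sup>-\<^sup>(\<^sup>k\<^sup>+\<^sup>n\<^sup>) < 2\<^sup>-\<^sup>k\<close>.\<close>

definition r_sum :: "tm \<Rightarrow> tm \<Rightarrow> tm \<Rightarrow> tm" where
  "r_sum a w n =
     lams [T0, T0, T0 \<^bold>\<Rightarrow> T1, T1 \<^bold>\<Rightarrow> T1]
       (C (Rec T0) \<cdot>
         (lams [T0, T0, T0, T0, T0 \<^bold>\<Rightarrow> T1, T1 \<^bold>\<Rightarrow> T1]
            (q_add (V 0) (V 5 \<cdot> (V 4 \<cdot> V 1) \<cdot> (V 2 \<^bold>+ V 3)))
          \<cdot> V 3 \<cdot> V 2 \<cdot> V 1 \<cdot> V 0)
         \<cdot> q_zero \<cdot> V 1)
     \<cdot> a \<cdot> w \<cdot> n"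

definition in_unit :: "tm \<Rightarrow> fm" where
  "in_unit x = (is_real x \<^bold>\<and> r_le r_zero x \<^bold>\<and> r_le x r_one)"

section \<open>The principle \<open>cocode\<^sub>0\<close>\<close>

text \<open>Functions on the reals or on \<open>[0,1]\<close> are total functionals on objects of type 1, but only
  their behaviour on codes of reals in the domain is constrained.\<close>

definition real_to_nat :: "tm \<Rightarrow> fm" where
  "real_to_nat Y = Forall T1 (Forall T1
     (is_real (V 1) \<^bold>\<and> is_real (V 0) \<^bold>\<and> r_eq (V 1) (V 0) \<^bold>\<longrightarrow>
      \<up> (\<up> Y) \<cdot> V 1 \<^bold>= \<up> (\<up> Y) \<cdot> V 0))"

definition is_set :: "tm \<Rightarrow> fm" where
  "is_set F = (real_to_nat F \<^bold>\<and>
     Forall T1 (is_real (V 0) \<^bold>\<longrightarrow> \<up> F \<cdot> V 0 \<^bold>= \<^bold>0 \<^bold>\<or> \<up> F \<cdot> V 0 \<^bold>= \<^bold>1))"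

definition mem :: "tm \<Rightarrow> tm \<Rightarrow> fm" where
  "mem x F = (is_real x \<^bold>\<and> F \<cdot> x \<^bold>= \<^bold>1)"

definition countable_set :: "tm \<Rightarrow> fm" where
  "countable_set F = Exists T2 (real_to_nat (V 0) \<^bold>\<and>
     Forall T1 (Forall T1 (mem (V 1) (\<up> (\<up> (\<up> F))) \<^bold>\<and> mem (V 0) (\<up> (\<up> (\<up> F))) \<^bold>\<longrightarrow>
       V 2 \<cdot> V 1 \<^bold>= V 2 \<cdot> V 0 \<^bold>\<longrightarrow> r_eq (V 1) (V 0))))"

definition cocode0 :: fm where
  "cocode0 = Forall T2
     (is_set (V 0) \<^bold>\<and>
      Forall T1 (mem (V 0) (V 1) \<^bold>\<longrightarrow> in_unit (V 0)) \<^bold>\<and>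
      Exists T1 (mem (V 0) (V 1)) \<^bold>\<and>
      countable_set (V 0) \<^bold>\<longrightarrow>
      Exists (T0 \<^bold>\<Rightarrow> T1)
        (Forall T0 (mem (V 1 \<cdot> V 0) (V 2)) \<^bold>\<and>
         Forall T1 (is_real (V 0) \<^bold>\<longrightarrow>
           (mem (V 0) (V 2) \<^bold>\<longleftrightarrow> Exists T0 (r_eq (V 2 \<cdot> V 0) (V 1))))))"

section \<open>The principle SUM\<close>

definition unit_fun :: "tm \<Rightarrow> fm" where
  "unit_fun a =
     (Forall T1 (in_unit (V 0) \<^bold>\<longrightarrow> is_real (\<up> a \<cdot> V 0)) \<^bold>\<and>
      Forall T1 (Forall T1 (in_unit (V 1) \<^bold>\<and> in_unit (V 0) \<^bold>\<and> r_eq (V 1) (V 0) \<^bold>\<longrightarrow>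
        r_eq (\<up> (\<up> a) \<cdot> V 1) (\<up> (\<up> a) \<cdot> V 0))))"

definition nonneg :: "tm \<Rightarrow> fm" where
  "nonneg a = Forall T1 (in_unit (V 0) \<^bold>\<longrightarrow> r_le r_zero (\<up> a \<cdot> V 0))"

text \<open>A finite sequence of reals is coded by its length \<open>n\<close> (type 0) and a sequence \<open>w\<close> of type
  \<open>T0 \<^bold>\<Rightarrow> T1\<close>, of which only the values \<open>w 0, \<dots>, w (n - 1)\<close> matter.\<close>

definition fin :: "tm \<Rightarrow> tm \<Rightarrow> fm" where
  "fin n w =
     (Forall T0 (V 0 \<^bold>< \<up> n \<^bold>\<longrightarrow> in_unit (\<up> w \<cdot> V 0)) \<^bold>\<and>
      Forall T0 (Forall T0 (V 1 \<^bold>< V 0 \<^bold>\<and> V 0 \<^bold>< \<up> (\<up> n) \<^bold>\<longrightarrow>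
        \<^bold>\<not> r_eq (\<up> (\<up> w) \<cdot> V 1) (\<up> (\<up> w) \<cdot> V 0))))"

definition fin_disjoint :: "tm \<Rightarrow> tm \<Rightarrow> tm \<Rightarrow> tm \<Rightarrow> fm" where
  "fin_disjoint n w m v =
     Forall T0 (Forall T0 (V 1 \<^bold>< \<up> (\<up> n) \<^bold>\<and> V 0 \<^bold>< \<up> (\<up> m) \<^bold>\<longrightarrow>
       \<^bold>\<not> r_eq (\<up> (\<up> w) \<cdot> V 1) (\<up> (\<up> v) \<cdot> V 0)))"

text \<open>In the matrix below, \<open>V 4\<close> is \<open>\<epsilon>\<close>, \<open>(V 3, V 2)\<close> is \<open>I\<close> and \<open>(V 1, V 0)\<close> is \<open>J\<close>.\<close>

definition cauchy :: "tm \<Rightarrow> fm" where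
  "cauchy a = Forall T1 (is_real (V 0) \<^bold>\<and> r_lt r_zero (V 0) \<^bold>\<longrightarrow>
     Exists T0 (Exists (T0 \<^bold>\<Rightarrow> T1) (fin (V 1) (V 0) \<^bold>\<and>
       Forall T0 (Forall (T0 \<^bold>\<Rightarrow> T1)
         (fin (V 1) (V 0) \<^bold>\<and> fin_disjoint (V 1) (V 0) (V 3) (V 2) \<^bold>\<longrightarrow>
          r_lt (r_abs (r_sum (\<up> (\<up> (\<up> (\<up> (\<up> a))))) (V 0) (V 1))) (V 4))))))"

definition Sum_principle :: fm where
  "Sum_principle = Forall (T1 \<^bold>\<Rightarrow> T1)
     (unit_fun (V 0) \<^bold>\<and> cauchy (V 0) \<^bold>\<and> nonneg (V 0) \<^bold>\<longrightarrow>
      Exists (T0 \<^bold>\<Rightarrow> T1)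
        (Forall T0 (in_unit (V 1 \<cdot> V 0)) \<^bold>\<and>
         Forall T1 (in_unit (V 0) \<^bold>\<longrightarrow>
           Forall T0 (\<^bold>\<not> r_eq (V 1) (V 2 \<cdot> V 0)) \<^bold>\<longrightarrow>
           r_eq (V 2 \<cdot> V 0) r_zero)))"

end

theory Submission
  imports Defs "HOL-Library.Countable"
begin

text \<open>By completeness of natural deduction it suffices to verify \<open>SUM \<longrightarrow> cocode\<^sub>0\<close> in every
  extensional model of the base theory; its numbers form a possibly nonstandard discretely ordered
  semiring.  Let \<open>Y\<close> be injective on \<open>A\<close>, and put \<open>a\<^sub>x = 2\<^sup>-\<^sup>Y\<^sup>(\<^sup>x\<^sup>)\<close> for \<open>x \<in> A\<close> and \<open>a\<^sub>x = 0\<close>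
  otherwise.  By induction there is a finite sequence \<open>I\<close> that lists all \<open>x \<in> A\<close> with \<open>Y x \<le> c\<close>.
  If \<open>J\<close> is disjoint from \<open>I\<close>, then the sum over \<open>J\<close> is one of distinct powers \<open>2\<^sup>-\<^sup>i\<close> with \<open>i > c\<close>
  and hence at most \<open>2\<^sup>-\<^sup>c\<close>, so \<open>a\<close> is Cauchy.  The sequence provided by SUM contains every element of
  \<open>A\<close>; replacing its members outside \<open>A\<close> by a fixed element of \<open>A\<close> yields an enumeration.\<close>

section \<open>Substitution and typing\<close>

text \<open>Provability is an inductive predicate on formulas, so a direct proof would have to spell
  out derivations about long combinator terms; in a countermodel the argument runs on elements
  instead. Two obstacles follow. First, no induction of the metalogic reaches all numbers of such a
  model: lengths of finite sequences, sums and cut-offs are elements of the model, and every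
  induction has to name a formula of the language that expresses its claim. For this reason the sum
  over J, whose exponents come in arbitrary order, is not sorted; it is bounded by letting a cut-off
  on the exponents grow by one at a time, so that each stage adds at most one new power. Second, the
  numbers form a subset of a universe of terms, while reasoning in an ordered semiring wants a type.
  That type must exist before any countermodel is assumed, so it is carved out of a choice made in
  advance.\<close>

definition wt_sub :: "ty list \<Rightarrow> ty list \<Rightarrow> (nat \<Rightarrow> tm) \<Rightarrow> bool" where
  "wt_sub \<Gamma> \<Delta> f \<longleftrightarrow> (\<forall>i<length \<Gamma>. ty_of \<Delta> (f i) = Some (\<Gamma> ! i))"

abbreviation up_sub :: "(nat \<Rightarrow> tm) \<Rightarrow> nat \<Rightarrow> tm" where
  "up_sub f \<equiv> case_nat (V 0) (\<lambda>i. \<up> (f i))"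

lemma tsub_tsub: "tsub f (tsub g t) = tsub (\<lambda>i. tsub f (g i)) t"
  by (induction t) auto

lemma tsub_lift: "tsub f (\<up> t) = tsub (\<lambda>i. f (Suc i)) t"
  by (simp add: lift_def tsub_tsub)

lemma lift_tsub: "\<up> (tsub f t) = tsub (\<lambda>i. \<up> (f i)) t"
  by (simp add: lift_def tsub_tsub)

lemma lift_simps [simp]:
  "\<up> (V i) = V (Suc i)" "\<up> (C c) = C c" "\<up> (s \<cdot> t) = \<up> s \<cdot> \<up> t"
  by (simp_all add: lift_def)

lemma tsub_V [simp]: "tsub V t = t"
  by (induction t) auto

lemma up_sub_V: "case_nat (V 0) (\<lambda>i. V (Suc i)) = V"
  by (auto simp: fun_eq_iff split: nat.split)

lemma up_sub_comp: "(\<lambda>i. tsub (up_sub f) (up_sub g i)) = up_sub (\<lambda>i. tsub f (g i))"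
  by (auto simp: fun_eq_iff tsub_lift lift_tsub split: nat.split)

lemma fsub_V [simp]: "fsub V \<phi> = \<phi>"
  by (induction \<phi>) (auto simp: up_sub_V)

lemma fsub_fsub: "fsub f (fsub g \<phi>) = fsub (\<lambda>i. tsub f (g i)) \<phi>"
  by (induction \<phi> arbitrary: f g) (auto simp: tsub_tsub up_sub_comp)

lemma fsub_flift: "fsub (up_sub f) (flift \<phi>) = flift (fsub f \<phi>)"
  by (simp add: flift_def fsub_fsub flip: lift_def)

lemma fsub_inst: "fsub f (inst t \<phi>) = inst (tsub f t) (fsub (up_sub f) \<phi>)"
proof -
  have "(\<lambda>i. tsub f (case_nat t V i)) = (\<lambda>i. tsub (case_nat (tsub f t) V) (up_sub f i))"
    by (auto simp: fun_eq_iff tsub_lift split: nat.split)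
  then show ?thesis by (simp add: inst_def fsub_fsub)
qed

lemma inst_up_sub: "inst t (fsub (up_sub f) \<phi>) = fsub (case_nat t f) \<phi>"
proof -
  have "(\<lambda>i. tsub (case_nat t V) (up_sub f i)) = case_nat t f"
    by (auto simp: fun_eq_iff tsub_lift split: nat.split)
  then show ?thesis by (simp add: inst_def fsub_fsub)
qed

lemma tsub_cong: "ty_of \<Gamma> t = Some \<tau> \<Longrightarrow> (\<And>i. i < length \<Gamma> \<Longrightarrow> f i = g i) \<Longrightarrow> tsub f t = tsub g t"
  by (induction t arbitrary: \<tau>) (auto split: if_splits option.splits ty.splits)

lemma fsub_cong: "wf_fm \<Gamma> \<phi> \<Longrightarrow> (\<And>i. i < length \<Gamma> \<Longrightarrow> f i = g i) \<Longrightarrow> fsub f \<phi> = fsub g \<phi>"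
proof (induction \<phi> arbitrary: \<Gamma> f g)
  case (Forall \<sigma> \<phi>)
  have "fsub (up_sub f) \<phi> = fsub (up_sub g) \<phi>"
    using Forall.prems by (intro Forall.IH[of "\<sigma> # \<Gamma>"]) (auto split: nat.split)
  then show ?case by simp
next
  case (Imp \<phi> \<psi>)
  then show ?case by (metis fsub.simps(4) wf_fm.simps(4))
next
  case (Eq s t)
  then show ?case using tsub_cong[of \<Gamma> _ T0 f g] by simp
next
  case (Lt s t)
  then show ?case using tsub_cong[of \<Gamma> _ T0 f g] by simp
qed simp

lemma fsub_closed: "wf_fm [] \<phi> \<Longrightarrow> fsub f \<phi> = \<phi>"
  using fsub_cong[of "[]" \<phi> f V] by simp

lemma ty_of_tsub: "wt_sub \<Gamma> \<Delta> f \<Longrightarrow> ty_of \<Gamma> t = Some \<tau> \<Longrightarrow> ty_of \<Delta> (tsub f t) = Some \<tau>"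
  by (induction t arbitrary: \<tau>) (auto simp: wt_sub_def split: if_splits option.splits ty.splits)

lemma wt_sub_Suc: "wt_sub \<Gamma> (\<sigma> # \<Gamma>) (\<lambda>i. V (Suc i))"
  by (simp add: wt_sub_def)

lemma ty_of_lift: "ty_of \<Gamma> t = Some \<tau> \<Longrightarrow> ty_of (\<sigma> # \<Gamma>) (\<up> t) = Some \<tau>"
  unfolding lift_def by (rule ty_of_tsub[OF wt_sub_Suc])

lemma wt_sub_up: "wt_sub \<Gamma> \<Delta> f \<Longrightarrow> wt_sub (\<sigma> # \<Gamma>) (\<sigma> # \<Delta>) (up_sub f)"
  by (auto simp: wt_sub_def ty_of_lift nth_Cons split: nat.split)

lemma wt_sub_case: "wt_sub \<Gamma> \<Delta> f \<Longrightarrow> ty_of \<Delta> t = Some \<sigma> \<Longrightarrow> wt_sub (\<sigma> # \<Gamma>) \<Delta> (case_nat t f)"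
  by (auto simp: wt_sub_def nth_Cons split: nat.split)

lemma wt_sub_append: "wt_sub \<Gamma> (\<Gamma> @ \<Delta>) V"
  by (simp add: wt_sub_def nth_append)

lemma wf_fsub: "wt_sub \<Gamma> \<Delta> f \<Longrightarrow> wf_fm \<Gamma> \<phi> \<Longrightarrow> wf_fm \<Delta> (fsub f \<phi>)"
proof (induction \<phi> arbitrary: \<Gamma> \<Delta> f)
  case (Forall \<sigma> \<phi>)
  then show ?case using Forall.IH[OF wt_sub_up[OF Forall.prems(1)]] by simp
qed (auto intro: ty_of_tsub)

lemma wf_inst: "wf_fm (\<sigma> # \<Gamma>) \<phi> \<Longrightarrow> ty_of \<Gamma> t = Some \<sigma> \<Longrightarrow> wf_fm \<Gamma> (inst t \<phi>)"
  unfolding inst_def using wt_sub_append[of \<Gamma> "[]"] by (intro wf_fsub[OF wt_sub_case]) auto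

lemma ty_of_append: "ty_of \<Gamma> t = Some \<tau> \<Longrightarrow> ty_of (\<Gamma> @ \<Delta>) t = Some \<tau>"
  using ty_of_tsub[OF wt_sub_append] by simp

lemma wf_fm_append: "wf_fm \<Gamma> \<phi> \<Longrightarrow> wf_fm (\<Gamma> @ \<Delta>) \<phi>"
  using wf_fsub[OF wt_sub_append] by simp

section \<open>Derivations\<close>

lemma prv_mono: "prv T \<Gamma> \<Phi> \<phi> \<Longrightarrow> \<Phi> \<subseteq> \<Psi> \<Longrightarrow> prv T \<Gamma> \<Psi> \<phi>"
proof (induction arbitrary: \<Psi> rule: prv.induct)
  case (ForallI \<sigma> \<Gamma> \<Phi> \<phi>)
  then show ?case by (intro prv.ForallI) (auto intro: image_mono)
next
  case (ImpI \<Gamma> \<phi> \<Phi> \<psi>)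
  then show ?case by (auto intro!: prv.ImpI simp: insert_mono)
next
  case (Classical \<Gamma> \<phi> \<Phi>)
  then show ?case by (auto intro!: prv.Classical[of _ \<phi>] simp: insert_mono)
next
  case (ImpE \<Gamma> \<Phi> \<phi> \<psi>)
  show ?case by (rule prv.ImpE[OF ImpE.IH(1)[OF ImpE.prems] ImpE.IH(2)[OF ImpE.prems]])
next
  case (ForallE \<Gamma> \<Phi> \<sigma> \<phi> t)
  show ?case using ForallE.IH[OF ForallE.prems] ForallE.hyps(2) by (rule prv.ForallE)
qed (auto intro: prv.Axiom prv.Assumption)

text \<open>Axiom schemes carry parameters from a context, so renaming or extending contexts inside
  a derivation requires that axioms be mapped to axioms.\<close>

definition substitutive :: "(ty list \<Rightarrow> fm \<Rightarrow> bool) \<Rightarrow> bool" where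
  "substitutive T \<longleftrightarrow> (\<forall>\<Gamma> \<Delta> f \<phi>. T \<Gamma> \<phi> \<longrightarrow> wt_sub \<Gamma> \<Delta> f \<longrightarrow> T \<Delta> (fsub f \<phi>))"

lemma prv_fsub:
  assumes "substitutive T"
  shows "prv T \<Gamma> \<Phi> \<phi> \<Longrightarrow> wt_sub \<Gamma> \<Delta> f \<Longrightarrow> prv T \<Delta> (fsub f ` \<Phi>) (fsub f \<phi>)"
proof (induction arbitrary: \<Delta> f rule: prv.induct)
  case (Axiom \<Gamma> \<phi> \<Phi>)
  have "T \<Delta> (fsub f \<phi>)"
    using assms Axiom.hyps Axiom.prems unfolding substitutive_def by (elim allE impE) assumption+
  then show ?case by (rule prv.Axiom)
next
  case (ImpI \<Gamma> \<phi> \<Phi> \<psi>)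
  then show ?case using wf_fsub by (auto intro!: prv.ImpI)
next
  case (Classical \<Gamma> \<phi> \<Phi>)
  then show ?case using wf_fsub by (auto intro!: prv.Classical[of _ "fsub f \<phi>"])
next
  case (ImpE \<Gamma> \<Phi> \<phi> \<psi>)
  show ?case
    using prv.ImpE[OF ImpE.IH(1)[OF ImpE.prems, unfolded fsub.simps] ImpE.IH(2)[OF ImpE.prems]] .
next
  case (ForallI \<sigma> \<Gamma> \<Phi> \<phi>)
  have "fsub (up_sub f) ` flift ` \<Phi> = flift ` fsub f ` \<Phi>"
    by (simp add: image_image fsub_flift)
  then show ?case using ForallI.IH[OF wt_sub_up[OF ForallI.prems]] by (auto intro: prv.ForallI)
next
  case (ForallE \<Gamma> \<Phi> \<sigma> \<phi> t)
  then show ?case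
    using prv.ForallE[of T \<Delta> "fsub f ` \<Phi>" \<sigma> "fsub (up_sub f) \<phi>" "tsub f t"] ty_of_tsub
    by (auto simp: fsub_inst)
qed (auto intro: prv.Assumption)

text \<open>New types at the end of a context move no index, so the identity substitution already
  does the weakening.\<close>

lemma prv_append:
  assumes "substitutive T" "prv T \<Gamma> \<Phi> \<phi>"
  shows "prv T (\<Gamma> @ \<Delta>) \<Phi> \<phi>"
  using prv_fsub[OF assms wt_sub_append, of \<Delta>] by (simp add: image_def)

lemma prv_falsum: "prv T \<Gamma> \<Phi> \<^bold>\<bottom> \<Longrightarrow> wf_fm \<Gamma> \<phi> \<Longrightarrow> prv T \<Gamma> \<Phi> \<phi>"
  by (auto intro: prv.Classical prv_mono)

text \<open>The variable at the end of the context serves as an eigenvariable.\<close>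

lemma prv_Forall_last:
  assumes "substitutive T" and wf: "\<And>\<psi>. \<psi> \<in> \<Phi> \<Longrightarrow> wf_fm \<Gamma> \<psi>" "wf_fm (\<sigma> # \<Gamma>) \<phi>"
    and prv: "prv T (\<Gamma> @ [\<sigma>]) \<Phi> (inst (V (length \<Gamma>)) \<phi>)"
  shows "prv T \<Gamma> \<Phi> (Forall \<sigma> \<phi>)"
proof -
  \<comment> \<open>\<open>r\<close> brings the last variable to the front and shifts the others: on
    formulas over \<Gamma> it acts as \<open>flift\<close>, and it turns the eigenvariable back into
    the bound variable.\<close>
  define r where "r i = (if i = length \<Gamma> then V 0 else V (Suc i))" for i
  have "wt_sub (\<Gamma> @ [\<sigma>]) (\<sigma> # \<Gamma>) r"
    by (auto simp: wt_sub_def r_def nth_append)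
  then have "prv T (\<sigma> # \<Gamma>) (fsub r ` \<Phi>) (fsub r (inst (V (length \<Gamma>)) \<phi>))"
    using prv_fsub[OF assms(1) prv] by simp
  moreover have "fsub r ` \<Phi> = flift ` \<Phi>"
    using wf(1) unfolding flift_def by (intro image_cong fsub_cong[of \<Gamma>]) (auto simp: r_def)
  moreover have "fsub r (inst (V (length \<Gamma>)) \<phi>) = fsub V \<phi>"
    unfolding inst_def fsub_fsub using wf(2)
    by (intro fsub_cong[of "\<sigma> # \<Gamma>"]) (auto simp: r_def split: nat.split)
  ultimately show ?thesis by (auto intro: prv.ForallI)
qed

section \<open>Henkin completion\<close>

instance ty :: countable by countable_datatype
instance con :: countable by countable_datatype
instance tm :: countable by countable_datatype
instance fm :: countable by countable_datatype

definition consistent :: "(ty list \<Rightarrow> fm \<Rightarrow> bool) \<Rightarrow> ty list \<Rightarrow> fm set \<Rightarrow> bool" where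
  "consistent T \<Gamma> \<Phi> \<longleftrightarrow> \<not> prv T \<Gamma> \<Phi> \<^bold>\<bottom>"

text \<open>A negated universal formula receives a counterexample: the variable of index
  \<open>length \<Gamma>\<close> is the one just appended, hence fresh. Existential formulas are
  covered, being negated universal ones.\<close>

fun witness :: "ty list \<Rightarrow> fm \<Rightarrow> ty list \<times> fm set" where
  "witness \<Gamma> (Forall \<sigma> \<psi> \<^bold>\<longrightarrow> \<^bold>\<bottom>) = (\<Gamma> @ [\<sigma>], {\<^bold>\<not> inst (V (length \<Gamma>)) \<psi>})"
| "witness \<Gamma> _ = (\<Gamma>, {})"

definition henkin_step ::
  "(ty list \<Rightarrow> fm \<Rightarrow> bool) \<Rightarrow> ty list \<times> fm set \<Rightarrow> fm \<Rightarrow> ty list \<times> fm set" where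
  "henkin_step T S \<phi> = (case S of (\<Gamma>, \<Phi>) \<Rightarrow>
     if wf_fm \<Gamma> \<phi> \<and> consistent T \<Gamma> (insert \<phi> \<Phi>)
     then (fst (witness \<Gamma> \<phi>), insert \<phi> \<Phi> \<union> snd (witness \<Gamma> \<phi>)) else (\<Gamma>, \<Phi>))"

text \<open>Variables appended to the context serve as Henkin constants.  Every formula is considered
  infinitely often, since it may be well-formed only from some stage on.\<close>

primrec henkin_chain :: "(ty list \<Rightarrow> fm \<Rightarrow> bool) \<Rightarrow> fm \<Rightarrow> nat \<Rightarrow> ty list \<times> fm set" where
  "henkin_chain T \<theta> 0 = ([], {\<theta>})"
| "henkin_chain T \<theta> (Suc n) = henkin_step T (henkin_chain T \<theta> n) (from_nat (fst (prod_decode n)))"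

locale henkin =
  fixes T :: "ty list \<Rightarrow> fm \<Rightarrow> bool" and \<theta> :: fm
  assumes substitutive: "substitutive T"
    and wf_axiom: "T \<Gamma> \<phi> \<Longrightarrow> wf_fm \<Gamma> \<phi>"
    and wf_start: "wf_fm [] \<theta>"
    and consistent_start: "consistent T [] {\<theta>}"
begin

abbreviation ctx :: "nat \<Rightarrow> ty list" where "ctx n \<equiv> fst (henkin_chain T \<theta> n)"
abbreviation asm :: "nat \<Rightarrow> fm set" where "asm n \<equiv> snd (henkin_chain T \<theta> n)"

text \<open>If the new witness caused an inconsistency, \<open>Classical\<close> would derive the
  instance at the fresh variable and \<open>prv_Forall_last\<close> the universal formula, against
  the negation just added.\<close>

lemma step_invariant:
  assumes wf: "\<And>\<psi>. \<psi> \<in> \<Phi> \<Longrightarrow> wf_fm \<Gamma> \<psi>" and "wf_fm \<Gamma> \<phi>" and con: "consistent T \<Gamma> (insert \<phi> \<Phi>)"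
  defines "\<Gamma>' \<equiv> fst (witness \<Gamma> \<phi>)" and "\<Phi>' \<equiv> insert \<phi> \<Phi> \<union> snd (witness \<Gamma> \<phi>)"
  shows "(\<forall>\<psi>\<in>\<Phi>'. wf_fm \<Gamma>' \<psi>) \<and> consistent T \<Gamma>' \<Phi>'"
proof (cases "\<exists>\<sigma> \<psi>. \<phi> = (\<^bold>\<not> Forall \<sigma> \<psi>)")
  case True
  then obtain \<sigma> \<psi> where \<phi>: "\<phi> = (\<^bold>\<not> Forall \<sigma> \<psi>)" by blast
  have wf\<psi>: "wf_fm (\<sigma> # \<Gamma>) \<psi>" using assms(2) \<phi> by simp
  let ?w = "inst (V (length \<Gamma>)) \<psi>"
  have wfw: "wf_fm (\<Gamma> @ [\<sigma>]) ?w"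
    using wf_fm_append[OF wf\<psi>, of "[\<sigma>]"] by (intro wf_inst) auto
  have "consistent T (\<Gamma> @ [\<sigma>]) (insert (\<^bold>\<not> ?w) (insert \<phi> \<Phi>))"
    unfolding consistent_def
  proof
    assume "prv T (\<Gamma> @ [\<sigma>]) (insert (\<^bold>\<not> ?w) (insert \<phi> \<Phi>)) \<^bold>\<bottom>"
    then have "prv T (\<Gamma> @ [\<sigma>]) (insert \<phi> \<Phi>) ?w" by (rule prv.Classical[OF wfw])
    then have "prv T \<Gamma> (insert \<phi> \<Phi>) (Forall \<sigma> \<psi>)"
      using prv_Forall_last[OF substitutive _ wf\<psi>] wf assms(2) by blast
    then have "prv T \<Gamma> (insert \<phi> \<Phi>) \<^bold>\<bottom>"
      by (auto simp: \<phi> intro: prv.ImpE[OF prv.Assumption])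
    with con show False by (simp add: consistent_def)
  qed
  then show ?thesis
    using assms(2) wf wfw wf_fm_append[OF wf\<psi>] by (auto simp: \<Gamma>'_def \<Phi>'_def \<phi> insert_commute intro: wf_fm_append)
next
  case False
  then have "witness \<Gamma> \<phi> = (\<Gamma>, {})"
    by (cases "(\<Gamma>, \<phi>)" rule: witness.cases) auto
  then show ?thesis using assms by auto
qed

lemma chain_invariant: "(\<forall>\<psi>\<in>asm n. wf_fm (ctx n) \<psi>) \<and> consistent T (ctx n) (asm n)"
proof (induction n)
  case 0
  then show ?case using wf_start consistent_start by simp
next
  case (Suc n)
  then show ?case using step_invariant[of "asm n" "ctx n"]
    by (auto simp: henkin_step_def split: prod.split)
qed

lemma chain_Suc: "(\<exists>\<Delta>. ctx (Suc n) = ctx n @ \<Delta>) \<and> asm n \<subseteq> asm (Suc n)"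
proof -
  have "\<exists>\<Delta>. fst (witness \<Gamma> \<phi>) = \<Gamma> @ \<Delta>" for \<Gamma> \<phi>
    by (cases "(\<Gamma>, \<phi>)" rule: witness.cases) auto
  then show ?thesis by (auto simp: henkin_step_def split: prod.split)
qed

lemma chain_mono: "n \<le> m \<Longrightarrow> (\<exists>\<Delta>. ctx m = ctx n @ \<Delta>) \<and> asm n \<subseteq> asm m"
proof (induction m rule: dec_induct)
  case (step m)
  obtain \<Delta> where "ctx m = ctx n @ \<Delta>" using step.IH by blast
  moreover obtain \<Delta>' where "ctx (Suc m) = ctx m @ \<Delta>'" using chain_Suc by blast
  ultimately show ?case using step.IH chain_Suc[of m] by auto
qed auto

section \<open>The limit of the chain as a maximal consistent set\<close>

definition hty :: "tm \<Rightarrow> ty \<Rightarrow> bool" where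
  "hty t \<sigma> \<longleftrightarrow> (\<exists>n. ty_of (ctx n) t = Some \<sigma>)"

definition hwf :: "fm \<Rightarrow> bool" where
  "hwf \<phi> \<longleftrightarrow> (\<exists>n. wf_fm (ctx n) \<phi>)"

definition H :: "fm set" where
  "H = (\<Union>n. asm n)"

lemma ty_of_ctx_mono: "ty_of (ctx n) t = Some \<sigma> \<Longrightarrow> n \<le> m \<Longrightarrow> ty_of (ctx m) t = Some \<sigma>"
  using chain_mono ty_of_append by metis

lemma wf_fm_ctx_mono: "wf_fm (ctx n) \<phi> \<Longrightarrow> n \<le> m \<Longrightarrow> wf_fm (ctx m) \<phi>"
  using chain_mono wf_fm_append by metis

lemma prv_ctx_mono: "prv T (ctx n) (asm n) \<phi> \<Longrightarrow> n \<le> m \<Longrightarrow> prv T (ctx m) (asm m) \<phi>"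
  using chain_mono prv_append[OF substitutive] prv_mono by metis

lemma considered:
  assumes "wf_fm (ctx n) \<phi>"
  obtains m where "n \<le> m" "wf_fm (ctx m) \<phi>" "henkin_chain T \<theta> (Suc m) = henkin_step T (henkin_chain T \<theta> m) \<phi>"
proof
  \<comment> \<open>A stage that decodes to \<phi> and is not below \<open>n\<close>, so that \<phi>
    is examined once it is well-formed.\<close>
  let ?m = "prod_encode (to_nat \<phi>, n)"
  show "n \<le> ?m" by (rule le_prod_encode_2)
  then show "wf_fm (ctx ?m) \<phi>" using wf_fm_ctx_mono assms by blast
  show "henkin_chain T \<theta> (Suc ?m) = henkin_step T (henkin_chain T \<theta> ?m) \<phi>" by simp
qed

lemma consistent_in_H:
  assumes "wf_fm (ctx n) \<phi>" and con: "\<And>m. n \<le> m \<Longrightarrow> consistent T (ctx m) (insert \<phi> (asm m))"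
  obtains m where "n \<le> m" "wf_fm (ctx m) \<phi>" "ctx (Suc m) = fst (witness (ctx m) \<phi>)"
    "asm (Suc m) = insert \<phi> (asm m) \<union> snd (witness (ctx m) \<phi>)"
proof -
  obtain m where m: "n \<le> m" "wf_fm (ctx m) \<phi>"
    "henkin_chain T \<theta> (Suc m) = henkin_step T (henkin_chain T \<theta> m) \<phi>"
    using considered[OF assms(1)] by blast
  have con: "consistent T (ctx m) (insert \<phi> (asm m))" using con m(1) by blast
  then have "ctx (Suc m) = fst (witness (ctx m) \<phi>)"
    "asm (Suc m) = insert \<phi> (asm m) \<union> snd (witness (ctx m) \<phi>)"
    using m unfolding m(3) by (auto simp: henkin_step_def split: prod.split)
  then show ?thesis using that m by blast
qed

text \<open>A derivable formula stays derivable at later stages, so refuting it there would refute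
  the assumptions of that stage; hence it is accepted when examined. This makes \<open>H\<close>
  deductively closed.\<close>

lemma in_H_iff_prv: "\<phi> \<in> H \<longleftrightarrow> (\<exists>n. wf_fm (ctx n) \<phi> \<and> prv T (ctx n) (asm n) \<phi>)"
proof
  assume "\<phi> \<in> H"
  then show "\<exists>n. wf_fm (ctx n) \<phi> \<and> prv T (ctx n) (asm n) \<phi>"
    using chain_invariant by (auto simp: H_def intro: prv.Assumption)
next
  assume "\<exists>n. wf_fm (ctx n) \<phi> \<and> prv T (ctx n) (asm n) \<phi>"
  then obtain n where n: "wf_fm (ctx n) \<phi>" "prv T (ctx n) (asm n) \<phi>" by blast
  have con: "consistent T (ctx m) (insert \<phi> (asm m))" if "n \<le> m" for m
    unfolding consistent_def
  proof
    assume "prv T (ctx m) (insert \<phi> (asm m)) \<^bold>\<bottom>"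
    then have "prv T (ctx m) (asm m) (\<^bold>\<not> \<phi>)"
      using wf_fm_ctx_mono[OF n(1) that] by (rule prv.ImpI[rotated])
    then have "prv T (ctx m) (asm m) \<^bold>\<bottom>"
      using prv.ImpE prv_ctx_mono[OF n(2) that] by blast
    then show False using chain_invariant consistent_def by blast
  qed
  obtain m where "asm (Suc m) = insert \<phi> (asm m) \<union> snd (witness (ctx m) \<phi>)"
    by (rule consistent_in_H[OF n(1) con])
  then show "\<phi> \<in> H" unfolding H_def by blast
qed

lemma H_hwf: "\<phi> \<in> H \<Longrightarrow> hwf \<phi>"
  by (auto simp: in_H_iff_prv hwf_def)

lemma falsum_notin_H: "\<^bold>\<bottom> \<notin> H"
  using chain_invariant by (auto simp: in_H_iff_prv consistent_def)

lemma start_in_H: "\<theta> \<in> H"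
  unfolding H_def by (rule UN_I[of 0]) auto

text \<open>Maximality of \<open>H\<close>. If \<phi> is never derived, then by
  \<open>Classical\<close> its negation stays consistent with every stage that can state it, and is
  accepted.\<close>

lemma neg_in_H:
  assumes "hwf \<phi>"
  shows "(\<^bold>\<not> \<phi>) \<in> H \<longleftrightarrow> \<phi> \<notin> H"
proof
  assume "(\<^bold>\<not> \<phi>) \<in> H"
  then obtain n where n: "prv T (ctx n) (asm n) (\<^bold>\<not> \<phi>)" by (auto simp: in_H_iff_prv)
  show "\<phi> \<notin> H"
  proof
    assume "\<phi> \<in> H"
    then obtain m where m: "prv T (ctx m) (asm m) \<phi>" by (auto simp: in_H_iff_prv)
    have "prv T (ctx (max n m)) (asm (max n m)) \<^bold>\<bottom>"
      using prv.ImpE prv_ctx_mono n m max.cobounded1 max.cobounded2 by metis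
    then show False using chain_invariant consistent_def by blast
  qed
next
  assume nH: "\<phi> \<notin> H"
  obtain n where n: "wf_fm (ctx n) \<phi>" using assms by (auto simp: hwf_def)
  have con: "consistent T (ctx m) (insert (\<^bold>\<not> \<phi>) (asm m))" if "n \<le> m" for m
    unfolding consistent_def
  proof
    assume "prv T (ctx m) (insert (\<^bold>\<not> \<phi>) (asm m)) \<^bold>\<bottom>"
    then have "prv T (ctx m) (asm m) \<phi>" using wf_fm_ctx_mono[OF n that] by (rule prv.Classical[rotated])
    then show False using nH wf_fm_ctx_mono[OF n that] by (auto simp: in_H_iff_prv)
  qed
  then obtain m where "asm (Suc m) = insert (\<^bold>\<not> \<phi>) (asm m) \<union> snd (witness (ctx m) (\<^bold>\<not> \<phi>))"
    using n by (auto intro: consistent_in_H[OF _ con])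
  then show "(\<^bold>\<not> \<phi>) \<in> H" unfolding H_def by blast
qed

lemma imp_in_H:
  assumes "hwf (\<phi> \<^bold>\<longrightarrow> \<psi>)"
  shows "(\<phi> \<^bold>\<longrightarrow> \<psi>) \<in> H \<longleftrightarrow> (\<phi> \<in> H \<longrightarrow> \<psi> \<in> H)"
proof
  assume "(\<phi> \<^bold>\<longrightarrow> \<psi>) \<in> H"
  then obtain n where n: "wf_fm (ctx n) (\<phi> \<^bold>\<longrightarrow> \<psi>)" "prv T (ctx n) (asm n) (\<phi> \<^bold>\<longrightarrow> \<psi>)"
    by (auto simp: in_H_iff_prv)
  show "\<phi> \<in> H \<longrightarrow> \<psi> \<in> H"
  proof
    assume "\<phi> \<in> H"
    then obtain m where m: "prv T (ctx m) (asm m) \<phi>" by (auto simp: in_H_iff_prv)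
    have "prv T (ctx (max n m)) (asm (max n m)) \<psi>"
      using prv.ImpE prv_ctx_mono n(2) m max.cobounded1 max.cobounded2 by metis
    moreover have "wf_fm (ctx (max n m)) \<psi>"
      using wf_fm_ctx_mono[OF n(1) max.cobounded1] by simp
    ultimately show "\<psi> \<in> H" by (auto simp: in_H_iff_prv)
  qed
next
  assume *: "\<phi> \<in> H \<longrightarrow> \<psi> \<in> H"
  obtain n where n: "wf_fm (ctx n) \<phi>" "wf_fm (ctx n) \<psi>" using assms by (auto simp: hwf_def)
  show "(\<phi> \<^bold>\<longrightarrow> \<psi>) \<in> H"
  proof (cases "\<phi> \<in> H")
    case True
    then obtain m where m: "wf_fm (ctx m) \<psi>" "prv T (ctx m) (asm m) \<psi>"
      using * by (auto simp: in_H_iff_prv)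
    let ?k = "max n m"
    have "prv T (ctx ?k) (asm ?k) \<psi>" using prv_ctx_mono[OF m(2)] by simp
    then have "prv T (ctx ?k) (asm ?k) (\<phi> \<^bold>\<longrightarrow> \<psi>)"
      using wf_fm_ctx_mono[OF n(1), of ?k] by (intro prv.ImpI) (auto intro: prv_mono)
    then show ?thesis using wf_fm_ctx_mono[OF n(1), of ?k] wf_fm_ctx_mono[OF n(2), of ?k]
      by (auto simp: in_H_iff_prv)
  next
    case False
    then have "(\<^bold>\<not> \<phi>) \<in> H" using neg_in_H n by (auto simp: hwf_def)
    then obtain m where m: "prv T (ctx m) (asm m) (\<^bold>\<not> \<phi>)" by (auto simp: in_H_iff_prv)
    let ?k = "max n m"
    have wf: "wf_fm (ctx ?k) \<phi>" "wf_fm (ctx ?k) \<psi>"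
      using wf_fm_ctx_mono[OF n(1), of ?k] wf_fm_ctx_mono[OF n(2), of ?k] by auto
    have "prv T (ctx ?k) (insert \<phi> (asm ?k)) (\<^bold>\<not> \<phi>)"
      using prv_ctx_mono[OF m, of ?k] by (auto intro: prv_mono)
    then have "prv T (ctx ?k) (insert \<phi> (asm ?k)) \<^bold>\<bottom>"
      by (rule prv.ImpE) (simp add: prv.Assumption)
    then have "prv T (ctx ?k) (asm ?k) (\<phi> \<^bold>\<longrightarrow> \<psi>)"
      using wf prv_falsum by (auto intro!: prv.ImpI)
    then show ?thesis using wf by (auto simp: in_H_iff_prv)
  qed
qed

text \<open>The Henkin property. A universal formula outside \<open>H\<close> has its negation
  accepted at some stage, and the witness added there refutes one instance.\<close>

lemma forall_in_H:
  assumes "hwf (Forall \<sigma> \<phi>)"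
  shows "Forall \<sigma> \<phi> \<in> H \<longleftrightarrow> (\<forall>t. hty t \<sigma> \<longrightarrow> inst t \<phi> \<in> H)"
proof
  assume "Forall \<sigma> \<phi> \<in> H"
  then obtain n where n: "wf_fm (\<sigma> # ctx n) \<phi>" "prv T (ctx n) (asm n) (Forall \<sigma> \<phi>)"
    by (auto simp: in_H_iff_prv)
  show "\<forall>t. hty t \<sigma> \<longrightarrow> inst t \<phi> \<in> H"
  proof (intro allI impI)
    fix t assume "hty t \<sigma>"
    then obtain m where m: "ty_of (ctx m) t = Some \<sigma>" by (auto simp: hty_def)
    let ?k = "max n m"
    have t: "ty_of (ctx ?k) t = Some \<sigma>" using ty_of_ctx_mono[OF m] by simp
    have "prv T (ctx ?k) (asm ?k) (inst t \<phi>)"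
      using prv_ctx_mono[OF n(2), of ?k] t by (auto intro: prv.ForallE)
    moreover have "wf_fm (ctx ?k) (inst t \<phi>)"
      using wf_fm_ctx_mono[of n "Forall \<sigma> \<phi>" ?k] n(1) t by (auto intro: wf_inst)
    ultimately show "inst t \<phi> \<in> H" by (auto simp: in_H_iff_prv)
  qed
next
  assume *: "\<forall>t. hty t \<sigma> \<longrightarrow> inst t \<phi> \<in> H"
  show "Forall \<sigma> \<phi> \<in> H"
  proof (rule ccontr)
    assume nH: "Forall \<sigma> \<phi> \<notin> H"
    obtain n where n: "wf_fm (ctx n) (Forall \<sigma> \<phi>)" using assms by (auto simp: hwf_def)
    have con: "consistent T (ctx m) (insert (\<^bold>\<not> Forall \<sigma> \<phi>) (asm m))" if "n \<le> m" for m
      unfolding consistent_def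
    proof
      assume "prv T (ctx m) (insert (\<^bold>\<not> Forall \<sigma> \<phi>) (asm m)) \<^bold>\<bottom>"
      then have "prv T (ctx m) (asm m) (Forall \<sigma> \<phi>)"
        using wf_fm_ctx_mono[OF n that] by (rule prv.Classical[rotated])
      then show False using nH wf_fm_ctx_mono[OF n that] by (auto simp: in_H_iff_prv)
    qed
    then obtain m where m: "wf_fm (ctx m) (\<^bold>\<not> Forall \<sigma> \<phi>)" "ctx (Suc m) = ctx m @ [\<sigma>]"
      "(\<^bold>\<not> inst (V (length (ctx m))) \<phi>) \<in> asm (Suc m)"
      using n by (auto intro: consistent_in_H[OF _ con])
    have t: "ty_of (ctx (Suc m)) (V (length (ctx m))) = Some \<sigma>"
      unfolding m(2) by simp
    then have "inst (V (length (ctx m))) \<phi> \<in> H" using * hty_def by blast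
    moreover from m(3) have "(\<^bold>\<not> inst (V (length (ctx m))) \<phi>) \<in> H" unfolding H_def by blast
    ultimately show False using neg_in_H H_hwf by blast
  qed
qed

lemma axiom_in_H: "T (ctx n) \<phi> \<Longrightarrow> \<phi> \<in> H"
  using wf_axiom by (auto simp: in_H_iff_prv intro: prv.Axiom)

end

section \<open>The axioms of the base theory\<close>

lemma fsub_eq_at: "fsub f (eq_at \<tau> s t) = eq_at \<tau> (tsub f s) (tsub f t)"
  by (induction \<tau> arbitrary: f s t) (auto simp: tsub_lift lift_tsub)

lemma wf_eq_at: "ty_of \<Gamma> s = Some \<tau> \<Longrightarrow> ty_of \<Gamma> t = Some \<tau> \<Longrightarrow> wf_fm \<Gamma> (eq_at \<tau> s t)"
  by (induction \<tau> arbitrary: \<Gamma> s t) (auto simp: ty_of_lift)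

lemma wf_ind_axiom: "wf_fm (T0 # \<Gamma>) \<phi> \<Longrightarrow> wf_fm \<Gamma> (ind_axiom \<phi>)"
proof -
  assume wf: "wf_fm (T0 # \<Gamma>) \<phi>"
  have "wt_sub (T0 # \<Gamma>) (T0 # \<Gamma>) (case_nat (V 0 \<^bold>+ \<^bold>1) (\<lambda>i. V (Suc i)))"
    by (intro wt_sub_case wt_sub_Suc) simp
  then show ?thesis using wf by (simp add: ind_axiom_def wf_inst wf_fsub)
qed

lemma wf_choice_axiom: "wf_fm (\<tau> # \<sigma> # \<Gamma>) \<phi> \<Longrightarrow> wf_fm \<Gamma> (choice_axiom \<sigma> \<tau> \<phi>)"
proof -
  assume wf: "wf_fm (\<tau> # \<sigma> # \<Gamma>) \<phi>"
  have "wt_sub (\<tau> # \<sigma> # \<Gamma>) (\<sigma> # (\<sigma> \<^bold>\<Rightarrow> \<tau>) # \<Gamma>) (case_nat (V 1 \<cdot> V 0) (case_nat (V 0) (\<lambda>k. V (k + 2))))"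
    by (intro wt_sub_case) (auto simp: wt_sub_def)
  then show ?thesis using wf by (simp add: choice_axiom_def wf_fsub)
qed

text \<open>Substituting into an induction axiom amounts to substituting into its induction formula,
  so instances of the scheme go to instances; the next lemma does the same for choice.\<close>

lemma fsub_ind_axiom: "fsub f (ind_axiom \<phi>) = ind_axiom (fsub (up_sub f) \<phi>)"
proof -
  have "(\<lambda>i. tsub (up_sub f) (case_nat (V 0 \<^bold>+ \<^bold>1) (\<lambda>i. V (Suc i)) i)) =
    (\<lambda>i. tsub (case_nat (V 0 \<^bold>+ \<^bold>1) (\<lambda>i. V (Suc i))) (up_sub f i))"
    by (auto simp: fun_eq_iff tsub_lift split: nat.split) (simp_all add: lift_def)
  then show ?thesis by (simp add: ind_axiom_def fsub_inst fsub_fsub)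
qed

lemma fsub_choice_axiom:
  "fsub f (choice_axiom \<sigma> \<tau> \<phi>) = choice_axiom \<sigma> \<tau> (fsub (up_sub (up_sub f)) \<phi>)"
proof -
  let ?c = "case_nat (V 1 \<cdot> V 0) (case_nat (V 0) (\<lambda>k. V (k + 2)))"
  \<comment> \<open>A term lifted twice avoids the two variables that \<open>?c\<close> treats
    specially, and \<open>?c\<close> fixes all others.\<close>
  have "tsub ?c (\<up> (\<up> t)) = \<up> (\<up> t)" for t
    unfolding tsub_lift by (simp add: lift_def tsub_tsub)
  then have "(\<lambda>i. tsub (up_sub (up_sub f)) (?c i)) = (\<lambda>i. tsub ?c (up_sub (up_sub f) i))"
    by (auto simp: fun_eq_iff split: nat.split)
  then show ?thesis by (simp only: choice_axiom_def fsub_fsub fsub.simps)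
qed

lemma quantifier_free_fsub: "quantifier_free \<phi> \<Longrightarrow> quantifier_free (fsub f \<phi>)"
  by (induction \<phi> arbitrary: f) auto

abbreviation base_theory :: "ty list \<Rightarrow> fm \<Rightarrow> bool" where
  "base_theory \<equiv> RCA0_omega \<^bold>\<union> IND"

lemma wf_closed_axioms:
  "\<phi> \<in> ordered_semiring_axioms \<Longrightarrow> wf_fm \<Gamma> \<phi>"
  "wf_fm \<Gamma> (K_axiom \<sigma> \<tau>)"
  "wf_fm \<Gamma> (S_axiom \<rho> \<sigma> \<tau>)"
  "wf_fm \<Gamma> R0_axiom"
  "wf_fm \<Gamma> (ext_axiom \<rho> \<tau>)"
  by (auto simp: ordered_semiring_axioms_def K_axiom_def S_axiom_def R0_axiom_def ext_axiom_def
      intro!: wf_eq_at)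

lemma wf_base_theory: "base_theory \<Gamma> \<phi> \<Longrightarrow> wf_fm \<Gamma> \<phi>"
  by (auto simp: theory_plus_def wf_closed_axioms wf_ind_axiom wf_choice_axiom
      elim!: RCA0_omega.cases IND.cases QF_AC.cases)

lemma base_theory_fsub:
  assumes "base_theory \<Gamma> \<phi>" and f: "wt_sub \<Gamma> \<Delta> f"
  shows "base_theory \<Delta> (fsub f \<phi>)"
proof -
  have "RCA0_omega \<Delta> (fsub f \<phi>)" if "RCA0_omega \<Gamma> \<phi>"
    using that
  proof cases
    case (QF_IND \<psi>)
    then show ?thesis using f
      by (auto simp: fsub_ind_axiom intro!: RCA0_omega.QF_IND quantifier_free_fsub wf_fsub wt_sub_up)
  next
    case QF_AC_1_0
    then show ?thesis using wf_fsub[OF wt_sub_up[OF wt_sub_up[OF f]]]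
      by (auto simp: fsub_choice_axiom elim!: QF_AC.cases
          intro!: RCA0_omega.QF_AC_1_0 QF_AC.intros quantifier_free_fsub)
  qed (auto simp: fsub_closed wf_closed_axioms intro: RCA0_omega.intros)
  moreover have "IND \<Delta> (fsub f \<phi>)" if "IND \<Gamma> \<phi>"
    using that f by (auto simp: fsub_ind_axiom elim!: IND.cases intro!: IND.intros wf_fsub wt_sub_up)
  ultimately show ?thesis using assms(1) by (auto simp: theory_plus_def)
qed

lemma substitutive_base_theory: "substitutive base_theory"
  using base_theory_fsub by (auto simp: substitutive_def)

section \<open>Extensional structures\<close>

text \<open>One universe serves all types, with \<open>D\<close> cutting out the objects of each
  type. Equality at type 0 is interpreted below by identity, which forces the term model to be a
  quotient.\<close>

locale typed_structure =
  fixes D :: "ty \<Rightarrow> 'u set" and app :: "'u \<Rightarrow> 'u \<Rightarrow> 'u" (infixl "\<bullet>" 90)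
    and cn :: "con \<Rightarrow> 'u" and lt :: "'u \<Rightarrow> 'u \<Rightarrow> bool"
begin

primrec tval :: "(nat \<Rightarrow> 'u) \<Rightarrow> tm \<Rightarrow> 'u" where
  "tval e (V i) = e i"
| "tval e (C c) = cn c"
| "tval e (s \<cdot> t) = tval e s \<bullet> tval e t"

primrec sat :: "(nat \<Rightarrow> 'u) \<Rightarrow> fm \<Rightarrow> bool" where
  "sat e (s \<^bold>= t) \<longleftrightarrow> tval e s = tval e t"
| "sat e (s \<^bold>< t) \<longleftrightarrow> lt (tval e s) (tval e t)"
| "sat e \<^bold>\<bottom> \<longleftrightarrow> False"
| "sat e (\<phi> \<^bold>\<longrightarrow> \<psi>) \<longleftrightarrow> (sat e \<phi> \<longrightarrow> sat e \<psi>)"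
| "sat e (Forall \<sigma> \<phi>) \<longleftrightarrow> (\<forall>d\<in>D \<sigma>. sat (case_nat d e) \<phi>)"

definition env :: "(nat \<Rightarrow> 'u) \<Rightarrow> ty list \<Rightarrow> bool" where
  "env e \<Gamma> \<longleftrightarrow> (\<forall>i<length \<Gamma>. e i \<in> D (\<Gamma> ! i))"

lemma tval_cong: "ty_of \<Gamma> t = Some \<tau> \<Longrightarrow> (\<And>i. i < length \<Gamma> \<Longrightarrow> e i = e' i) \<Longrightarrow> tval e t = tval e' t"
  by (induction t arbitrary: \<tau>) (auto split: if_splits option.splits ty.splits)

lemma sat_cong: "wf_fm \<Gamma> \<phi> \<Longrightarrow> (\<And>i. i < length \<Gamma> \<Longrightarrow> e i = e' i) \<Longrightarrow> sat e \<phi> \<longleftrightarrow> sat e' \<phi>"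
proof (induction \<phi> arbitrary: \<Gamma> e e')
  case (Forall \<sigma> \<phi>)
  have "sat (case_nat d e) \<phi> \<longleftrightarrow> sat (case_nat d e') \<phi>" for d
    using Forall.prems by (intro Forall.IH[of "\<sigma> # \<Gamma>"]) (auto split: nat.split)
  then show ?case by simp
next
  case (Imp \<phi> \<psi>)
  then show ?case by (metis sat.simps(4) wf_fm.simps(4))
next
  case (Eq s t)
  then show ?case using tval_cong[of \<Gamma> _ T0 e e'] by simp
next
  case (Lt s t)
  then show ?case using tval_cong[of \<Gamma> _ T0 e e'] by simp
qed simp

end

locale extensional_structure = typed_structure +
  assumes cn_in: "cn c \<in> D (con_ty c)"
    and app_in: "f \<in> D (\<sigma> \<^bold>\<Rightarrow> \<tau>) \<Longrightarrow> x \<in> D \<sigma> \<Longrightarrow> f \<bullet> x \<in> D \<tau>"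
    and ext: "f \<in> D (\<sigma> \<^bold>\<Rightarrow> \<tau>) \<Longrightarrow> g \<in> D (\<sigma> \<^bold>\<Rightarrow> \<tau>) \<Longrightarrow> (\<And>x. x \<in> D \<sigma> \<Longrightarrow> f \<bullet> x = g \<bullet> x) \<Longrightarrow> f = g"

locale base_model = extensional_structure +
  assumes sat_axiom: "base_theory \<Gamma> \<phi> \<Longrightarrow> env e \<Gamma> \<Longrightarrow> sat e \<phi>"

section \<open>The term model\<close>

locale henkin_base = henkin base_theory \<theta> for \<theta>
begin

lemma hty_unique: "hty t \<sigma> \<Longrightarrow> hty t \<tau> \<Longrightarrow> \<sigma> = \<tau>"
proof -
  assume "hty t \<sigma>" "hty t \<tau>"
  then obtain n m where "ty_of (ctx n) t = Some \<sigma>" "ty_of (ctx m) t = Some \<tau>"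
    by (auto simp: hty_def)
  then have "ty_of (ctx (max n m)) t = Some \<sigma>" "ty_of (ctx (max n m)) t = Some \<tau>"
    by (auto elim: ty_of_ctx_mono)
  then show ?thesis by simp
qed

definition henv :: "(nat \<Rightarrow> tm) \<Rightarrow> ty list \<Rightarrow> bool" where
  "henv f \<Gamma> \<longleftrightarrow> (\<forall>i<length \<Gamma>. hty (f i) (\<Gamma> ! i))"

text \<open>Only finitely many terms are involved, so the maximum of their stages types them all.
  The induction adds types at the end of \<Gamma>, where indices do not shift.\<close>

lemma henv_wt_sub: "henv f \<Gamma> \<Longrightarrow> \<exists>n. wt_sub \<Gamma> (ctx n) f"
proof (induction \<Gamma> rule: rev_induct)
  case (snoc \<sigma> \<Gamma>)
  have "hty (f i) (\<Gamma> ! i)" if "i < length \<Gamma>" for i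
    using snoc.prems[unfolded henv_def, rule_format, of i] that by (simp add: nth_append)
  then have "henv f \<Gamma>" by (simp add: henv_def)
  then obtain n where n: "wt_sub \<Gamma> (ctx n) f" using snoc.IH by blast
  have "hty (f (length \<Gamma>)) \<sigma>" using snoc.prems by (auto simp: henv_def)
  then obtain m where m: "ty_of (ctx m) (f (length \<Gamma>)) = Some \<sigma>" by (auto simp: hty_def)
  have "wt_sub (\<Gamma> @ [\<sigma>]) (ctx (max n m)) f"
    unfolding wt_sub_def
  proof (intro allI impI)
    fix i assume "i < length (\<Gamma> @ [\<sigma>])"
    then consider "i < length \<Gamma>" | "i = length \<Gamma>" by fastforce
    then show "ty_of (ctx (max n m)) (f i) = Some ((\<Gamma> @ [\<sigma>]) ! i)"
    proof cases
      case 1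
      then have "ty_of (ctx n) (f i) = Some ((\<Gamma> @ [\<sigma>]) ! i)" using n by (simp add: wt_sub_def nth_append)
      then show ?thesis by (rule ty_of_ctx_mono) simp
    next
      case 2
      then show ?thesis using ty_of_ctx_mono[OF m, of "max n m"] by simp
    qed
  qed
  then show ?case by blast
qed (simp add: wt_sub_def)

lemma hty_tsub: "henv f \<Gamma> \<Longrightarrow> ty_of \<Gamma> t = Some \<tau> \<Longrightarrow> hty (tsub f t) \<tau>"
  using henv_wt_sub ty_of_tsub unfolding hty_def by blast

lemma hwf_fsub: "henv f \<Gamma> \<Longrightarrow> wf_fm \<Gamma> \<phi> \<Longrightarrow> hwf (fsub f \<phi>)"
  using henv_wt_sub wf_fsub unfolding hwf_def by blast

lemma henv_Nil: "henv f []"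
  by (simp add: henv_def)

lemma henv_case: "henv f \<Gamma> \<Longrightarrow> hty t \<sigma> \<Longrightarrow> henv (case_nat t f) (\<sigma> # \<Gamma>)"
  by (auto simp: henv_def nth_Cons split: nat.split)

lemma hty_app: "hty s (\<sigma> \<^bold>\<Rightarrow> \<tau>) \<Longrightarrow> hty t \<sigma> \<Longrightarrow> hty (s \<cdot> t) \<tau>"
  using hty_tsub[OF henv_case[OF henv_case[OF henv_Nil]], where t = "V 0 \<cdot> V 1"] by simp

lemma hty_con: "hty (C c) (con_ty c)"
  by (simp add: hty_def)

lemma forall_fsub_in_H:
  assumes "hwf (fsub f (Forall \<sigma> \<phi>))"
  shows "fsub f (Forall \<sigma> \<phi>) \<in> H \<longleftrightarrow> (\<forall>t. hty t \<sigma> \<longrightarrow> fsub (case_nat t f) \<phi> \<in> H)"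
  using forall_in_H[of \<sigma> "fsub (up_sub f) \<phi>"] assms by (simp add: inst_up_sub)

lemma forall_fsub_in_HD: "fsub f (Forall \<sigma> \<phi>) \<in> H \<Longrightarrow> hty t \<sigma> \<Longrightarrow> fsub (case_nat t f) \<phi> \<in> H"
  using forall_fsub_in_H H_hwf by blast

lemma imp_in_HD: "(\<phi> \<^bold>\<longrightarrow> \<psi>) \<in> H \<Longrightarrow> \<phi> \<in> H \<Longrightarrow> \<psi> \<in> H"
  using imp_in_H H_hwf by blast

lemma base_axiom_in_H: "base_theory [] \<phi> \<Longrightarrow> fsub V \<phi> \<in> H"
  using axiom_in_H[of 0] by simp

section \<open>Provable equality and the quotient of the terms by it\<close>

definition eqv :: "ty \<Rightarrow> tm \<Rightarrow> tm \<Rightarrow> bool" where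
  "eqv \<sigma> s t \<longleftrightarrow> hty s \<sigma> \<and> hty t \<sigma> \<and> eq_at \<sigma> s t \<in> H"

text \<open>\<open>eq_at\<close> at an arrow type is a universal formula, and \<open>H\<close>
  decides those by their instances. This reduces equality at higher types to type 0, where the
  equality axioms live.\<close>

lemma eqv_arrow:
  "eqv (\<sigma> \<^bold>\<Rightarrow> \<tau>) s t \<longleftrightarrow>
   hty s (\<sigma> \<^bold>\<Rightarrow> \<tau>) \<and> hty t (\<sigma> \<^bold>\<Rightarrow> \<tau>) \<and> (\<forall>u. hty u \<sigma> \<longrightarrow> eqv \<tau> (s \<cdot> u) (t \<cdot> u))"
proof (cases "hty s (\<sigma> \<^bold>\<Rightarrow> \<tau>) \<and> hty t (\<sigma> \<^bold>\<Rightarrow> \<tau>)")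
  case True
  let ?f = "case_nat s (case_nat t V)"
  let ?\<phi> = "Forall \<sigma> (eq_at \<tau> (V 1 \<cdot> V 0) (V 2 \<cdot> V 0))"
  have "henv ?f [\<sigma> \<^bold>\<Rightarrow> \<tau>, \<sigma> \<^bold>\<Rightarrow> \<tau>]" using True by (intro henv_case henv_Nil) auto
  moreover have "wf_fm [\<sigma> \<^bold>\<Rightarrow> \<tau>, \<sigma> \<^bold>\<Rightarrow> \<tau>] ?\<phi>" by (auto intro!: wf_eq_at)
  ultimately have "hwf (fsub ?f ?\<phi>)" by (rule hwf_fsub)
  from forall_fsub_in_H[OF this] show ?thesis
    using True hty_app by (auto simp: eqv_def fsub_eq_at numeral_2_eq_2 simp flip: lift_def)
qed (auto simp: eqv_def)

lemma eqv_refl: "hty t \<sigma> \<Longrightarrow> eqv \<sigma> t t"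
proof (induction \<sigma> arbitrary: t)
  case T0
  have "fsub V (Forall T0 (V 0 \<^bold>= V 0)) \<in> H"
    by (intro base_axiom_in_H) (simp add: theory_plus_def RCA0_omega.semiring ordered_semiring_axioms_def)
  from forall_fsub_in_HD[OF this T0] show ?case using T0 by (simp add: eqv_def)
qed (auto simp: eqv_arrow hty_app)

lemma eqv_sym: "eqv \<sigma> s t \<Longrightarrow> eqv \<sigma> t s"
proof (induction \<sigma> arbitrary: s t)
  case T0
  then have ty: "hty s T0" "hty t T0" by (auto simp: eqv_def)
  have "fsub V (Forall T0 (Forall T0 (V 1 \<^bold>= V 0 \<^bold>\<longrightarrow> V 0 \<^bold>= V 1))) \<in> H"
    by (intro base_axiom_in_H) (simp add: theory_plus_def RCA0_omega.semiring ordered_semiring_axioms_def)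
  from forall_fsub_in_HD[OF forall_fsub_in_HD[OF this ty(1)] ty(2)]
  show ?case using T0 imp_in_HD by (auto simp: eqv_def)
qed (auto simp: eqv_arrow hty_app)

lemma eqv_trans: "eqv \<sigma> s t \<Longrightarrow> eqv \<sigma> t u \<Longrightarrow> eqv \<sigma> s u"
proof (induction \<sigma> arbitrary: s t u)
  case T0
  then have ty: "hty s T0" "hty t T0" "hty u T0" by (auto simp: eqv_def)
  have "fsub V (Forall T0 (Forall T0 (Forall T0 (V 2 \<^bold>= V 1 \<^bold>\<longrightarrow> V 1 \<^bold>= V 0 \<^bold>\<longrightarrow> V 2 \<^bold>= V 0)))) \<in> H"
    by (intro base_axiom_in_H) (simp add: theory_plus_def RCA0_omega.semiring ordered_semiring_axioms_def)
  from forall_fsub_in_HD[OF forall_fsub_in_HD[OF forall_fsub_in_HD[OF this ty(1)] ty(2)] ty(3)]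
  have "(s \<^bold>= t \<^bold>\<longrightarrow> t \<^bold>= u \<^bold>\<longrightarrow> s \<^bold>= u) \<in> H" by (simp add: numeral_2_eq_2)
  then show ?case using T0 imp_in_HD by (metis eqv_def eq_at.simps(1))
next
  case (Arrow \<sigma> \<tau>)
  then show ?case unfolding eqv_arrow by blast
qed

text \<open>The extensionality axiom replaces the argument and pointwise equality the function, so
  application descends to the quotient.\<close>

lemma eqv_app:
  assumes "eqv (\<sigma> \<^bold>\<Rightarrow> \<tau>) f g" "eqv \<sigma> x y"
  shows "eqv \<tau> (f \<cdot> x) (g \<cdot> y)"
proof -
  have ty: "hty x \<sigma>" "hty y \<sigma>" "hty f (\<sigma> \<^bold>\<Rightarrow> \<tau>)" using assms by (auto simp: eqv_def)
  have "fsub V (ext_axiom \<sigma> \<tau>) \<in> H"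
    by (intro base_axiom_in_H) (simp add: theory_plus_def RCA0_omega.ext)
  from forall_fsub_in_HD[OF forall_fsub_in_HD[OF forall_fsub_in_HD[OF this[unfolded ext_axiom_def]
    ty(1)] ty(2)] ty(3)]
  have "eq_at \<tau> (f \<cdot> x) (f \<cdot> y) \<in> H"
    using assms(2) imp_in_HD by (fastforce simp: eqv_def fsub_eq_at numeral_2_eq_2)
  then have "eqv \<tau> (f \<cdot> x) (f \<cdot> y)" using ty hty_app by (auto simp: eqv_def)
  moreover have "eqv \<tau> (f \<cdot> y) (g \<cdot> y)" using assms(1) ty(2) unfolding eqv_arrow by blast
  ultimately show ?thesis by (rule eqv_trans)
qed

lemma lt_in_H_cong:
  assumes "eqv T0 s s'" "eqv T0 t t'" "(s \<^bold>< t) \<in> H"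
  shows "(s' \<^bold>< t') \<in> H"
proof -
  have ty: "hty s T0" "hty s' T0" "hty t T0" "hty t' T0" using assms by (auto simp: eqv_def)
  have "fsub V (Forall T0 (Forall T0 (Forall T0 (Forall T0
       (V 3 \<^bold>= V 2 \<^bold>\<longrightarrow> V 1 \<^bold>= V 0 \<^bold>\<longrightarrow> V 3 \<^bold>< V 1 \<^bold>\<longrightarrow> V 2 \<^bold>< V 0))))) \<in> H"
    by (intro base_axiom_in_H) (simp add: theory_plus_def RCA0_omega.semiring ordered_semiring_axioms_def)
  from forall_fsub_in_HD[OF forall_fsub_in_HD[OF forall_fsub_in_HD[OF forall_fsub_in_HD[OF this
    ty(1)] ty(2)] ty(3)] ty(4)]
  have "(s \<^bold>= s' \<^bold>\<longrightarrow> t \<^bold>= t' \<^bold>\<longrightarrow> s \<^bold>< t \<^bold>\<longrightarrow> s' \<^bold>< t') \<in> H"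
    by (simp add: numeral_2_eq_2 numeral_3_eq_3)
  then show ?thesis using assms imp_in_HD by (metis eqv_def eq_at.simps(1))
qed

text \<open>A representative of each class in place of the class keeps the universe of the model at
  type \<open>tm\<close>. The type \<sigma> can stay existential because a term has at most
  one.\<close>

definition rep :: "tm \<Rightarrow> tm" where
  "rep t = (SOME s. \<exists>\<sigma>. eqv \<sigma> t s)"

lemma eqv_rep: assumes "hty t \<sigma>" shows "eqv \<sigma> t (rep t)"
proof -
  have "\<exists>\<sigma>. eqv \<sigma> t (rep t)"
    unfolding rep_def by (rule someI[of _ t]) (use assms eqv_refl in blast)
  then show ?thesis using hty_unique assms by (auto simp: eqv_def)
qed

lemma rep_eq_iff: assumes "hty s \<sigma>" "hty t \<sigma>" shows "rep s = rep t \<longleftrightarrow> eqv \<sigma> s t"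
proof
  assume "rep s = rep t"
  then show "eqv \<sigma> s t" using eqv_rep assms eqv_trans eqv_sym by metis
next
  assume st: "eqv \<sigma> s t"
  have "(\<exists>\<tau>. eqv \<tau> s u) \<longleftrightarrow> (\<exists>\<tau>. eqv \<tau> t u)" for u
    using st assms hty_unique eqv_trans eqv_sym unfolding eqv_def by metis
  then show "rep s = rep t" unfolding rep_def by simp
qed

lemma hty_rep: "hty t \<sigma> \<Longrightarrow> hty (rep t) \<sigma>"
  using eqv_rep eqv_def by blast

sublocale typed_structure "\<lambda>\<sigma>. rep ` {t. hty t \<sigma>}" "\<lambda>s t. rep (s \<cdot> t)" "\<lambda>c. rep (C c)" "\<lambda>s t. (s \<^bold>< t) \<in> H" .

lemma rep_app: "hty s (\<sigma> \<^bold>\<Rightarrow> \<tau>) \<Longrightarrow> hty t \<sigma> \<Longrightarrow> rep (rep s \<cdot> rep t) = rep (s \<cdot> t)"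
  by (subst rep_eq_iff[of _ \<tau>]) (auto intro: hty_app hty_rep eqv_app[OF eqv_sym[OF eqv_rep] eqv_sym[OF eqv_rep]])

lemma tval_rep: "henv f \<Gamma> \<Longrightarrow> ty_of \<Gamma> t = Some \<tau> \<Longrightarrow> tval (\<lambda>i. rep (f i)) t = rep (tsub f t)"
  by (induction t arbitrary: \<tau>)
    (auto split: option.splits ty.splits if_splits intro!: rep_app hty_tsub)

text \<open>The truth lemma: each connective matches a closure property of \<open>H\<close>, an
  atomic equation becomes equality of representatives, and quantifiers over representatives reach
  every typed term.\<close>

lemma sat_rep: "henv f \<Gamma> \<Longrightarrow> wf_fm \<Gamma> \<phi> \<Longrightarrow> sat (\<lambda>i. rep (f i)) \<phi> \<longleftrightarrow> fsub f \<phi> \<in> H"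
proof (induction \<phi> arbitrary: f \<Gamma>)
  case (Eq s t)
  then have "hty (tsub f s) T0" "hty (tsub f t) T0" using hty_tsub by auto
  then show ?case using Eq tval_rep[OF Eq.prems(1)] by (simp add: rep_eq_iff eqv_def)
next
  case (Lt s t)
  then have ty: "hty (tsub f s) T0" "hty (tsub f t) T0" using hty_tsub by auto
  have "(rep (tsub f s) \<^bold>< rep (tsub f t)) \<in> H \<longleftrightarrow> (tsub f s \<^bold>< tsub f t) \<in> H"
    using lt_in_H_cong eqv_rep[OF ty(1)] eqv_rep[OF ty(2)] eqv_sym by meson
  then show ?case using Lt tval_rep[OF Lt.prems(1)] by simp
next
  case Falsum
  then show ?case by (simp add: falsum_notin_H)
next
  case (Imp \<phi> \<psi>)
  have "hwf (fsub f (\<phi> \<^bold>\<longrightarrow> \<psi>))" using Imp.prems by (rule hwf_fsub)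
  then show ?case using Imp imp_in_H by simp
next
  case (Forall \<sigma> \<phi>)
  have "sat (\<lambda>i. rep (f i)) (Forall \<sigma> \<phi>) \<longleftrightarrow>
    (\<forall>t. hty t \<sigma> \<longrightarrow> sat (case_nat (rep t) (\<lambda>i. rep (f i))) \<phi>)"
    by auto
  also have "\<dots> \<longleftrightarrow> (\<forall>t. hty t \<sigma> \<longrightarrow> fsub (case_nat t f) \<phi> \<in> H)"
  proof -
    have "case_nat (rep t) (\<lambda>i. rep (f i)) = (\<lambda>i. rep (case_nat t f i))" for t
      by (auto simp: fun_eq_iff split: nat.split)
    then show ?thesis using Forall.IH[OF henv_case[OF Forall.prems(1)]] Forall.prems(2) by simp
  qed
  also have "\<dots> \<longleftrightarrow> fsub f (Forall \<sigma> \<phi>) \<in> H"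
    using forall_fsub_in_H[OF hwf_fsub[OF Forall.prems]] by simp
  finally show ?case .
qed

text \<open>The parameters are named by terms, all typed at one stage; the axiom with these terms
  substituted is again an axiom there and so lies in \<open>H\<close>.\<close>

lemma sat_axiom_term_model:
  assumes "base_theory \<Gamma> \<phi>" "env e \<Gamma>"
  shows "sat e \<phi>"
proof -
  have "\<exists>t. i < length \<Gamma> \<longrightarrow> e i = rep t \<and> hty t (\<Gamma> ! i)" for i
    using assms(2) by (auto simp: env_def)
  then obtain f where f: "i < length \<Gamma> \<Longrightarrow> e i = rep (f i) \<and> hty (f i) (\<Gamma> ! i)" for i
    by metis
  then have henv: "henv f \<Gamma>" by (simp add: henv_def)
  then obtain n where "wt_sub \<Gamma> (ctx n) f" using henv_wt_sub by blast
  then have "fsub f \<phi> \<in> H" using axiom_in_H base_theory_fsub[OF assms(1)] by blast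
  then have "sat (\<lambda>i. rep (f i)) \<phi>" using sat_rep[OF henv wf_base_theory[OF assms(1)]] by simp
  then show ?thesis using sat_cong[OF wf_base_theory[OF assms(1)], of e "\<lambda>i. rep (f i)"] f by blast
qed

lemma base_model:
  "base_model (\<lambda>\<sigma>. rep ` {t. hty t \<sigma>}) (\<lambda>s t. rep (s \<cdot> t)) (\<lambda>c. rep (C c)) (\<lambda>s t. (s \<^bold>< t) \<in> H)"
proof
  fix f g \<sigma> \<tau>
  assume "f \<in> rep ` {t. hty t (\<sigma> \<^bold>\<Rightarrow> \<tau>)}" "g \<in> rep ` {t. hty t (\<sigma> \<^bold>\<Rightarrow> \<tau>)}"
    and eq: "\<And>x. x \<in> rep ` {t. hty t \<sigma>} \<Longrightarrow> rep (f \<cdot> x) = rep (g \<cdot> x)"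
  then obtain s t where st: "f = rep s" "g = rep t" "hty s (\<sigma> \<^bold>\<Rightarrow> \<tau>)" "hty t (\<sigma> \<^bold>\<Rightarrow> \<tau>)" by auto
  have "eqv \<tau> (s \<cdot> u) (t \<cdot> u)" if u: "hty u \<sigma>" for u
    using eq[of "rep u"] u st rep_app[OF _ u] rep_eq_iff[of "s \<cdot> u" \<tau> "t \<cdot> u"] by (auto intro: hty_app)
  then show "f = g" using st rep_eq_iff[OF st(3,4)] by (simp add: eqv_arrow)
next
  fix f x \<sigma> \<tau>
  assume "f \<in> rep ` {t. hty t (\<sigma> \<^bold>\<Rightarrow> \<tau>)}" "x \<in> rep ` {t. hty t \<sigma>}"
  then show "rep (f \<cdot> x) \<in> rep ` {t. hty t \<tau>}" using hty_app hty_rep by blast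
qed (use hty_con sat_axiom_term_model in blast)+

lemma sat_start: "sat e \<theta>"
proof -
  have "sat (\<lambda>i. rep (V i)) \<theta>" using sat_rep[OF henv_Nil wf_start, of V] start_in_H by simp
  then show ?thesis using sat_cong[OF wf_start, of e "\<lambda>i. rep (V i)"] by simp
qed

end

text \<open>An underivable \<phi> leaves its negation consistent by \<open>Classical\<close>, and
  the term model of the negation refutes \<phi>. That the universe is the fixed type
  \<open>tm\<close> matters later for the type of numbers.\<close>

theorem base_theory_completeness:
  assumes "wf_fm [] \<phi>" and "\<not> (base_theory \<^bold>\<turnstile> \<phi>)"
  obtains D :: "ty \<Rightarrow> tm set" and app cn lt
  where "base_model D app cn lt" "\<And>e. \<not> typed_structure.sat D app cn lt e \<phi>"
proof -
  have "consistent base_theory [] {\<^bold>\<not> \<phi>}"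
    using assms prv.Classical[OF assms(1), of base_theory "{}"] by (auto simp: consistent_def proves_def)
  then interpret henkin_base "\<^bold>\<not> \<phi>"
    using assms(1) by unfold_locales (auto simp: substitutive_base_theory wf_base_theory)
  from sat_start have "\<not> sat e \<phi>" for e by simp
  with base_model show thesis by (rule that)
qed

section \<open>Semantics of the base theory\<close>

lemma ty_of_lam: "ty_of (\<sigma> # \<Gamma>) t = Some \<tau> \<Longrightarrow> ty_of \<Gamma> (lam \<Gamma> \<sigma> t) = Some (\<sigma> \<^bold>\<Rightarrow> \<tau>)"
  by (induction t arbitrary: \<tau>) (auto split: nat.splits option.splits ty.splits if_splits)

context typed_structure
begin

lemma env_Nil [simp]: "env e []"
  by (simp add: env_def)

lemma env_Cons [simp]: "env (case_nat d e) (\<sigma> # \<Gamma>) \<longleftrightarrow> d \<in> D \<sigma> \<and> env e \<Gamma>"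
  by (auto simp: env_def nth_Cons split: nat.split)

lemma tval_tsub: "tval e (tsub f t) = tval (\<lambda>i. tval e (f i)) t"
  by (induction t) auto

lemma tval_lift [simp]: "tval (case_nat d e) (\<up> t) = tval e t"
  by (simp add: lift_def tval_tsub)

lemma sat_fsub: "sat e (fsub f \<phi>) \<longleftrightarrow> sat (\<lambda>i. tval e (f i)) \<phi>"
proof (induction \<phi> arbitrary: e f)
  case (Forall \<sigma> \<phi>)
  have "(\<lambda>i. tval (case_nat d e) (up_sub f i)) = case_nat d (\<lambda>i. tval e (f i))" for d
    by (auto simp: fun_eq_iff split: nat.split)
  then show ?case using Forall by simp
qed (auto simp: tval_tsub)

end

context extensional_structure
begin

lemma tval_in: "env e \<Gamma> \<Longrightarrow> ty_of \<Gamma> t = Some \<tau> \<Longrightarrow> tval e t \<in> D \<tau>"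
  by (induction t arbitrary: \<tau>)
    (auto simp: env_def cn_in split: option.splits ty.splits if_splits intro: app_in)

lemma sat_eq_at:
  "tval e s \<in> D \<tau> \<Longrightarrow> tval e t \<in> D \<tau> \<Longrightarrow> sat e (eq_at \<tau> s t) \<longleftrightarrow> tval e s = tval e t"
proof (induction \<tau> arbitrary: e s t)
  case (Arrow \<sigma> \<tau>)
  have "sat e (eq_at (\<sigma> \<^bold>\<Rightarrow> \<tau>) s t) \<longleftrightarrow> (\<forall>d\<in>D \<sigma>. tval e s \<bullet> d = tval e t \<bullet> d)"
    using Arrow app_in by simp
  then show ?case using Arrow.prems ext by auto
qed simp

end

context base_model
begin

abbreviation add (infixl "\<oplus>" 65) where "x \<oplus> y \<equiv> cn Plus \<bullet> x \<bullet> y"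
abbreviation mul (infixl "\<otimes>" 70) where "x \<otimes> y \<equiv> cn Times \<bullet> x \<bullet> y"
abbreviation zero_elt ("\<zero>") where "\<zero> \<equiv> cn Zero"
abbreviation one_elt ("\<one>") where "\<one> \<equiv> cn One"

lemma con_in:
  "\<zero> \<in> D T0" "\<one> \<in> D T0" "cn Plus \<in> D (T0 \<^bold>\<Rightarrow> T0 \<^bold>\<Rightarrow> T0)" "cn Times \<in> D (T0 \<^bold>\<Rightarrow> T0 \<^bold>\<Rightarrow> T0)"
  "cn (KC \<sigma> \<tau>) \<in> D (\<sigma> \<^bold>\<Rightarrow> \<tau> \<^bold>\<Rightarrow> \<sigma>)"
  "cn (SC \<rho> \<sigma> \<tau>) \<in> D ((\<rho> \<^bold>\<Rightarrow> \<sigma> \<^bold>\<Rightarrow> \<tau>) \<^bold>\<Rightarrow> (\<rho> \<^bold>\<Rightarrow> \<sigma>) \<^bold>\<Rightarrow> \<rho> \<^bold>\<Rightarrow> \<tau>)"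
  "cn (Rec T0) \<in> D ((T0 \<^bold>\<Rightarrow> T0 \<^bold>\<Rightarrow> T0) \<^bold>\<Rightarrow> T0 \<^bold>\<Rightarrow> T0 \<^bold>\<Rightarrow> T0)"
  using cn_in[of Zero] cn_in[of One] cn_in[of Plus] cn_in[of Times] cn_in[of "KC \<sigma> \<tau>"]
    cn_in[of "SC \<rho> \<sigma> \<tau>"] cn_in[of "Rec T0"] by simp_all

lemma add_in: "x \<in> D T0 \<Longrightarrow> y \<in> D T0 \<Longrightarrow> x \<oplus> y \<in> D T0"
  and mul_in: "x \<in> D T0 \<Longrightarrow> y \<in> D T0 \<Longrightarrow> x \<otimes> y \<in> D T0"
  by (auto intro!: app_in[of _ T0] con_in)

lemma K_app:
  assumes "x \<in> D \<sigma>" "y \<in> D \<tau>"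
  shows "cn (KC \<sigma> \<tau>) \<bullet> x \<bullet> y = x"
proof -
  have "sat e (K_axiom \<sigma> \<tau>)" for e
    by (rule sat_axiom[of "[]"]) (simp_all add: theory_plus_def RCA0_omega.K)
  then have "sat (case_nat y (case_nat x e)) (eq_at \<sigma> (C (KC \<sigma> \<tau>) \<cdot> V 1 \<cdot> V 0) (V 1))" for e
    using assms by (simp add: K_axiom_def)
  then show ?thesis
    using assms app_in con_in(5) by (subst (asm) sat_eq_at) (simp, blast, auto)
qed

lemma S_app:
  assumes "f \<in> D (\<rho> \<^bold>\<Rightarrow> \<sigma> \<^bold>\<Rightarrow> \<tau>)" "g \<in> D (\<rho> \<^bold>\<Rightarrow> \<sigma>)" "x \<in> D \<rho>"
  shows "cn (SC \<rho> \<sigma> \<tau>) \<bullet> f \<bullet> g \<bullet> x = f \<bullet> x \<bullet> (g \<bullet> x)"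
proof -
  let ?e = "case_nat x (case_nat g (case_nat f (\<lambda>_. x)))"
  have "sat e (S_axiom \<rho> \<sigma> \<tau>)" for e
    by (rule sat_axiom[of "[]"]) (simp_all add: theory_plus_def RCA0_omega.S)
  then have "sat ?e (eq_at \<tau> (C (SC \<rho> \<sigma> \<tau>) \<cdot> V 2 \<cdot> V 1 \<cdot> V 0) (V 2 \<cdot> V 0 \<cdot> (V 1 \<cdot> V 0)))"
    using assms by (simp add: S_axiom_def)
  moreover have "tval ?e (C (SC \<rho> \<sigma> \<tau>) \<cdot> V 2 \<cdot> V 1 \<cdot> V 0) \<in> D \<tau>" "tval ?e (V 2 \<cdot> V 0 \<cdot> (V 1 \<cdot> V 0)) \<in> D \<tau>"
    using app_in[OF app_in[OF app_in[OF con_in(6) assms(1)] assms(2)] assms(3)]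
      app_in[OF app_in[OF assms(1,3)] app_in[OF assms(2,3)]] by simp_all
  ultimately show ?thesis by (simp add: sat_eq_at)
qed

lemma
  assumes "f \<in> D (T0 \<^bold>\<Rightarrow> T0 \<^bold>\<Rightarrow> T0)" "x \<in> D T0"
  shows Rec_zero: "cn (Rec T0) \<bullet> f \<bullet> x \<bullet> \<zero> = x"
    and Rec_Suc: "n \<in> D T0 \<Longrightarrow>
      cn (Rec T0) \<bullet> f \<bullet> x \<bullet> (n \<oplus> \<one>) = f \<bullet> n \<bullet> (cn (Rec T0) \<bullet> f \<bullet> x \<bullet> n)"
proof -
  have "sat e R0_axiom" for e
    by (rule sat_axiom[of "[]"]) (simp_all add: theory_plus_def RCA0_omega.R0)
  with assms show "cn (Rec T0) \<bullet> f \<bullet> x \<bullet> \<zero> = x"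
    "n \<in> D T0 \<Longrightarrow> cn (Rec T0) \<bullet> f \<bullet> x \<bullet> (n \<oplus> \<one>) = f \<bullet> n \<bullet> (cn (Rec T0) \<bullet> f \<bullet> x \<bullet> n)"
    by (auto simp: R0_axiom_def)
qed

lemma lam_app:
  assumes "env e \<Gamma>" "x \<in> D \<sigma>"
  shows "ty_of (\<sigma> # \<Gamma>) t = Some \<tau> \<Longrightarrow> tval e (lam \<Gamma> \<sigma> t) \<bullet> x = tval (case_nat x e) t"
proof (induction t arbitrary: \<tau>)
  case (V i)
  show ?case
  proof (cases i)
    case 0
    have "cn (KC \<sigma> (\<sigma> \<^bold>\<Rightarrow> \<sigma>)) \<bullet> x \<bullet> (cn (KC \<sigma> \<sigma>) \<bullet> x) = x"
      using assms(2) app_in[OF con_in(5) assms(2)] by (rule K_app)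
    then show ?thesis using 0 S_app[OF con_in(5,5) assms(2)] by simp
  next
    case (Suc j)
    then have "e j \<in> D (\<Gamma> ! j)" using V assms(1) by (auto simp: env_def split: if_splits)
    then show ?thesis using Suc K_app assms(2) by simp
  qed
next
  case (C c)
  show ?case using K_app[OF cn_in assms(2)] by simp
next
  case (App s t)
  then obtain \<rho> where ty: "ty_of (\<sigma> # \<Gamma>) s = Some (\<rho> \<^bold>\<Rightarrow> \<tau>)" "ty_of (\<sigma> # \<Gamma>) t = Some \<rho>"
    by (auto split: option.splits ty.splits if_splits)
  have "tval e (lam \<Gamma> \<sigma> s) \<in> D (\<sigma> \<^bold>\<Rightarrow> \<rho> \<^bold>\<Rightarrow> \<tau>)" "tval e (lam \<Gamma> \<sigma> t) \<in> D (\<sigma> \<^bold>\<Rightarrow> \<rho>)"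
    using ty ty_of_lam tval_in[OF assms(1)] by blast+
  then show ?case using App.IH ty assms(2) S_app by simp
qed

text \<open>\<open>D T0\<close> may contain nonstandard numbers, so induction is available for
  properties given by a formula with parameters from the model. This is where \<open>IND\<close>
  enters, with arbitrary quantifiers in \<phi>.\<close>

lemma induct_D0:
  assumes "wf_fm (T0 # \<Gamma>) \<phi>" "env e \<Gamma>" "n \<in> D T0"
    and "sat (case_nat \<zero> e) \<phi>"
    and "\<And>n. n \<in> D T0 \<Longrightarrow> sat (case_nat n e) \<phi> \<Longrightarrow> sat (case_nat (n \<oplus> \<one>) e) \<phi>"
  shows "sat (case_nat n e) \<phi>"
proof -
  have *: "sat e (ind_axiom \<phi>)"
    using assms(1,2) by (intro sat_axiom) (auto simp: theory_plus_def intro: IND.intros)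
  have "(\<lambda>i. tval e (case_nat \<^bold>0 V i)) = case_nat \<zero> e"
    "(\<lambda>i. tval (case_nat d e) (case_nat (V 0 \<^bold>+ \<^bold>1) (\<lambda>i. V (Suc i)) i)) = case_nat (d \<oplus> \<one>) e" for d
    by (auto simp: fun_eq_iff split: nat.split)
  with * show ?thesis using assms(3-5) by (simp add: ind_axiom_def inst_def sat_fsub)
qed

end

section \<open>The ordered semiring of numbers\<close>

text \<open>What the type of numbers needs to know of a model, detached from the model. The last
  three conditions are not axioms of the theory but consequences of induction; they yield
  discreteness and subtraction.\<close>

locale natural_structure =
  fixes N :: "'u set" and add mul :: "'u \<Rightarrow> 'u \<Rightarrow> 'u" and zero one :: 'u and less :: "'u \<Rightarrow> 'u \<Rightarrow> bool"
  assumes zero_in: "zero \<in> N" and one_in: "one \<in> N"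
    and add_in: "x \<in> N \<Longrightarrow> y \<in> N \<Longrightarrow> add x y \<in> N"
    and mul_in: "x \<in> N \<Longrightarrow> y \<in> N \<Longrightarrow> mul x y \<in> N"
    and add_assoc: "x \<in> N \<Longrightarrow> y \<in> N \<Longrightarrow> w \<in> N \<Longrightarrow> add (add x y) w = add x (add y w)"
    and add_comm: "x \<in> N \<Longrightarrow> y \<in> N \<Longrightarrow> add x y = add y x"
    and add_zero: "x \<in> N \<Longrightarrow> add x zero = x"
    and mul_assoc: "x \<in> N \<Longrightarrow> y \<in> N \<Longrightarrow> w \<in> N \<Longrightarrow> mul (mul x y) w = mul x (mul y w)"
    and mul_comm: "x \<in> N \<Longrightarrow> y \<in> N \<Longrightarrow> mul x y = mul y x"
    and mul_one: "x \<in> N \<Longrightarrow> mul x one = x"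
    and mul_zero: "x \<in> N \<Longrightarrow> mul x zero = zero"
    and distrib: "x \<in> N \<Longrightarrow> y \<in> N \<Longrightarrow> w \<in> N \<Longrightarrow> mul x (add y w) = add (mul x y) (mul x w)"
    and less_irrefl: "x \<in> N \<Longrightarrow> \<not> less x x"
    and less_trans: "x \<in> N \<Longrightarrow> y \<in> N \<Longrightarrow> w \<in> N \<Longrightarrow> less x y \<Longrightarrow> less y w \<Longrightarrow> less x w"
    and less_linear: "x \<in> N \<Longrightarrow> y \<in> N \<Longrightarrow> less x y \<or> x = y \<or> less y x"
    and add_less: "x \<in> N \<Longrightarrow> y \<in> N \<Longrightarrow> w \<in> N \<Longrightarrow> less x y \<Longrightarrow> less (add x w) (add y w)"
    and mul_less: "x \<in> N \<Longrightarrow> y \<in> N \<Longrightarrow> w \<in> N \<Longrightarrow> less zero w \<Longrightarrow> less x y \<Longrightarrow> less (mul x w) (mul y w)"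
    and zero_less_one: "less zero one"
    and nonneg: "x \<in> N \<Longrightarrow> \<not> less x zero"
    and subtract: "x \<in> N \<Longrightarrow> y \<in> N \<Longrightarrow> \<not> less x y \<Longrightarrow> \<exists>w\<in>N. add y w = x"
    and zero_or_succ: "x \<in> N \<Longrightarrow> x = zero \<or> (\<exists>y\<in>N. x = add y one)"

context base_model
begin

lemma semiring_axioms: "\<forall>\<phi>\<in>ordered_semiring_axioms. sat e \<phi>"
  using sat_axiom[of "[]"] by (auto simp: theory_plus_def intro: RCA0_omega.semiring)

lemma zero_or_Suc: assumes "n \<in> D T0" shows "n = \<zero> \<or> (\<exists>m\<in>D T0. n = m \<oplus> \<one>)"
proof -
  have "sat (case_nat n (\<lambda>_. \<zero>)) (V 0 \<^bold>= \<^bold>0 \<^bold>\<or> Exists T0 (V 1 \<^bold>= V 0 \<^bold>+ \<^bold>1))"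
    by (rule induct_D0[of "[]"]) (use assms in auto)
  then show ?thesis by auto
qed

lemma natural_structure: "natural_structure (D T0) (\<oplus>) (\<otimes>) \<zero> \<one> lt"
proof -
  have "sat (\<lambda>_. \<zero>) \<phi>" if "\<phi> \<in> ordered_semiring_axioms" for \<phi>
    using semiring_axioms that by blast
  note sat_ax = this
  have sat_ax:
    "sat (\<lambda>_. \<zero>) (Forall T0 (Forall T0 (Forall T0 ((V 2 \<^bold>+ V 1) \<^bold>+ V 0 \<^bold>= V 2 \<^bold>+ (V 1 \<^bold>+ V 0)))))"
    "sat (\<lambda>_. \<zero>) (Forall T0 (Forall T0 (V 1 \<^bold>+ V 0 \<^bold>= V 0 \<^bold>+ V 1)))"
    "sat (\<lambda>_. \<zero>) (Forall T0 (V 0 \<^bold>+ \<^bold>0 \<^bold>= V 0))"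
    "sat (\<lambda>_. \<zero>) (Forall T0 (Forall T0 (Forall T0 ((V 2 \<^bold>* V 1) \<^bold>* V 0 \<^bold>= V 2 \<^bold>* (V 1 \<^bold>* V 0)))))"
    "sat (\<lambda>_. \<zero>) (Forall T0 (Forall T0 (V 1 \<^bold>* V 0 \<^bold>= V 0 \<^bold>* V 1)))"
    "sat (\<lambda>_. \<zero>) (Forall T0 (V 0 \<^bold>* \<^bold>1 \<^bold>= V 0))"
    "sat (\<lambda>_. \<zero>) (Forall T0 (V 0 \<^bold>* \<^bold>0 \<^bold>= \<^bold>0))"
    "sat (\<lambda>_. \<zero>) (Forall T0 (Forall T0 (Forall T0 (V 2 \<^bold>* (V 1 \<^bold>+ V 0) \<^bold>= V 2 \<^bold>* V 1 \<^bold>+ V 2 \<^bold>* V 0))))"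
    "sat (\<lambda>_. \<zero>) (Forall T0 (\<^bold>\<not> V 0 \<^bold>< V 0))"
    "sat (\<lambda>_. \<zero>) (Forall T0 (Forall T0 (Forall T0 (V 2 \<^bold>< V 1 \<^bold>\<longrightarrow> V 1 \<^bold>< V 0 \<^bold>\<longrightarrow> V 2 \<^bold>< V 0))))"
    "sat (\<lambda>_. \<zero>) (Forall T0 (Forall T0 (V 1 \<^bold>< V 0 \<^bold>\<or> V 1 \<^bold>= V 0 \<^bold>\<or> V 0 \<^bold>< V 1)))"
    "sat (\<lambda>_. \<zero>) (Forall T0 (Forall T0 (Forall T0 (V 2 \<^bold>< V 1 \<^bold>\<longrightarrow> V 2 \<^bold>+ V 0 \<^bold>< V 1 \<^bold>+ V 0))))"
    "sat (\<lambda>_. \<zero>) (Forall T0 (Forall T0 (Forall T0 (\<^bold>0 \<^bold>< V 0 \<^bold>\<longrightarrow> V 2 \<^bold>< V 1 \<^bold>\<longrightarrow> V 2 \<^bold>* V 0 \<^bold>< V 1 \<^bold>* V 0))))"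
    "sat (\<lambda>_. \<zero>) (\<^bold>0 \<^bold>< \<^bold>1)"
    by (rule sat_ax, unfold ordered_semiring_axioms_def, simp)+
  note ax = sat_ax[simplified]
  note assoc = ax(1)[rule_format] and comm = ax(2)[rule_format] and irrefl = ax(9)[rule_format]
    and trans = ax(10)[rule_format] and linear = ax(11)[rule_format]
    and add_lt = ax(12)[rule_format] and pos = ax(14)
  have add0: "x \<oplus> \<zero> = x" "\<zero> \<oplus> x = x" if "x \<in> D T0" for x
    using ax(3) that comm[of \<zero> x] con_in by simp_all
  have lt_Suc: "lt n (n \<oplus> \<one>)" if "n \<in> D T0" for n
    using add_lt[OF con_in(1,2) pos that] that con_in comm add0 by simp
  have nonneg: "\<not> lt n \<zero>" if "n \<in> D T0" for n
  proof -
    have "sat (case_nat n (\<lambda>_. \<zero>)) (\<^bold>\<not> V 0 \<^bold>< \<^bold>0)"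
    proof (rule induct_D0[of "[]"])
      show "sat (case_nat (n \<oplus> \<one>) (\<lambda>_. \<zero>)) (\<^bold>\<not> V 0 \<^bold>< \<^bold>0)"
        if "n \<in> D T0" "sat (case_nat n (\<lambda>_. \<zero>)) (\<^bold>\<not> V 0 \<^bold>< \<^bold>0)" for n
        using that trans[of n "n \<oplus> \<one>" \<zero>] lt_Suc con_in add_in by auto
    qed (use that con_in irrefl in auto)
    then show ?thesis by simp
  qed
  have subtract: "\<forall>y\<in>D T0. lt x y \<or> (\<exists>w\<in>D T0. y \<oplus> w = x)" if "x \<in> D T0" for x
  proof -
    \<comment> \<open>The second number is quantified inside the formula because the induction step
      applies the hypothesis to its predecessor.\<close>
    let ?\<phi> = "Forall T0 (V 1 \<^bold>< V 0 \<^bold>\<or> Exists T0 (V 1 \<^bold>+ V 0 \<^bold>= V 2))"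
    have "sat (case_nat x (\<lambda>_. \<zero>)) ?\<phi>"
    proof (rule induct_D0[of "[]"])
      have "lt \<zero> y \<or> y \<oplus> \<zero> = \<zero>" if "y \<in> D T0" for y
        using linear[OF con_in(1) that] nonneg[OF that] add0 that by auto
      then have "\<forall>y\<in>D T0. lt \<zero> y \<or> (\<exists>w\<in>D T0. y \<oplus> w = \<zero>)" using con_in(1) by blast
      then show "sat (case_nat \<zero> (\<lambda>_. \<zero>)) ?\<phi>" by auto
      show "sat (case_nat (n \<oplus> \<one>) (\<lambda>_. \<zero>)) ?\<phi>"
        if n: "n \<in> D T0" and IH: "sat (case_nat n (\<lambda>_. \<zero>)) ?\<phi>" for n
      proof -
        have "lt (n \<oplus> \<one>) y \<or> (\<exists>w\<in>D T0. y \<oplus> w = n \<oplus> \<one>)" if y: "y \<in> D T0" for y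
          using zero_or_Suc[OF y]
        proof
          assume "y = \<zero>"
          then show ?thesis using add0 add_in con_in n by blast
        next
          assume "\<exists>m\<in>D T0. y = m \<oplus> \<one>"
          then obtain m where m: "m \<in> D T0" "y = m \<oplus> \<one>" by blast
          then consider "lt n m" | w where "w \<in> D T0" "m \<oplus> w = n" using IH by auto
          then show ?thesis
          proof cases
            case 1
            then show ?thesis using add_lt m n con_in by blast
          next
            case 2
            have "m \<oplus> \<one> \<oplus> w = m \<oplus> w \<oplus> \<one>"
              using m(1) 2(1) con_in by (simp add: assoc comm[of \<one>])
            then show ?thesis using 2 m by blast
          qed
        qed
        then show ?thesis by auto
      qed
    qed (use that in auto)
    then show ?thesis by auto
  qed
  show ?thesis
  proof
    show "\<exists>w\<in>D T0. y \<oplus> w = x" if "x \<in> D T0" "y \<in> D T0" "\<not> lt x y" for x y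
      using subtract that by blast
    show "x = \<zero> \<or> (\<exists>y\<in>D T0. x = y \<oplus> \<one>)" if "x \<in> D T0" for x
      using zero_or_Suc that by blast
    show "lt x w" if "x \<in> D T0" "y \<in> D T0" "w \<in> D T0" "lt x y" "lt y w" for x y w
      using trans that by blast
    show "lt x y \<or> x = y \<or> lt y x" if "x \<in> D T0" "y \<in> D T0" for x y
      using linear that by blast
  qed (use ax(1-9,12-14) con_in add_in mul_in nonneg in \<open>blast | simp\<close>)+
qed

end

section \<open>Typing of the defined terms and formulas\<close>

lemma ty_of_Cons_lift [simp]: "ty_of (\<sigma> # \<Gamma>) (\<up> t) = ty_of \<Gamma> t"
  by (induction t) (auto split: option.split ty.split)

lemma ty_of_lams: "ty_of \<Gamma> t = Some \<tau> \<Longrightarrow> ty_of \<Delta> (lams \<Gamma> t) = Some (foldl (\<lambda>\<tau> \<sigma>. \<sigma> \<^bold>\<Rightarrow> \<tau>) \<tau> \<Gamma>)"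
proof (induction \<Gamma> arbitrary: t \<tau>)
  case Nil
  then show ?case using ty_of_append[of "[]" t \<tau> \<Delta>] by simp
next
  case (Cons \<sigma> \<Gamma>)
  then show ?case using ty_of_lam by simp
qed

lemma ty_of_arith [simp]:
  assumes "ty_of \<Gamma> s = Some T0"
  shows "ty_of \<Gamma> (pred_tm s) = Some T0" "ty_of \<Gamma> (two_pow s) = Some T0"
  using assms by (simp_all add: pred_tm_def two_pow_def ty_of_lams del: lams.simps)

lemma ty_of_monus [simp]:
  "ty_of \<Gamma> s = Some T0 \<Longrightarrow> ty_of \<Gamma> t = Some T0 \<Longrightarrow> ty_of \<Gamma> (s \<^bold>- t) = Some T0"
  by (simp add: monus_def ty_of_lams del: lams.simps)

lemma ty_of_sqrt_tm [simp]: "ty_of \<Gamma> s = Some T0 \<Longrightarrow> ty_of \<Gamma> (sqrt_tm s) = Some T0"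
  by (simp add: sqrt_tm_def ty_of_lams del: lams.simps)

lemma ty_of_unary [simp]:
  assumes "ty_of \<Gamma> s = Some T0"
  shows "ty_of \<Gamma> (proj1 s) = Some T0" "ty_of \<Gamma> (proj2 s) = Some T0"
    "ty_of \<Gamma> (pos_part s) = Some T0" "ty_of \<Gamma> (neg_part s) = Some T0" "ty_of \<Gamma> (denom s) = Some T0"
  using assms by (simp_all add: proj1_def proj2_def pos_part_def neg_part_def denom_def)

lemma ty_of_rat [simp]:
  "ty_of \<Gamma> s = Some T0 \<Longrightarrow> ty_of \<Gamma> t = Some T0 \<Longrightarrow> ty_of \<Gamma> r = Some T0 \<Longrightarrow>
   ty_of \<Gamma> (rat s t r) = Some T0"
  by (simp add: rat_def pair_def)

lemma ty_of_q_unary [simp]: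
  assumes "ty_of \<Gamma> s = Some T0"
  shows "ty_of \<Gamma> (q_minus s) = Some T0" "ty_of \<Gamma> (q_abs s) = Some T0"
    "ty_of \<Gamma> (q_pow s) = Some T0" "ty_of \<Gamma> (q_pow' s) = Some T0"
  using assms by (simp_all add: q_minus_def q_abs_def q_pow_def q_pow'_def)

lemma ty_of_q_binary [simp]:
  assumes "ty_of \<Gamma> s = Some T0" "ty_of \<Gamma> t = Some T0"
  shows "ty_of \<Gamma> (q_add s t) = Some T0" "ty_of \<Gamma> (q_dist s t) = Some T0"
  using assms by (simp_all add: q_add_def q_dist_def)

lemma ty_of_q_const [simp]: "ty_of \<Gamma> q_zero = Some T0" "ty_of \<Gamma> q_one = Some T0"
  by (simp_all add: q_zero_def q_one_def)

lemma ty_of_r_const [simp]: "ty_of \<Gamma> r_zero = Some T1" "ty_of \<Gamma> r_one = Some T1"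
  by (simp_all add: r_zero_def r_one_def)

lemma wf_q [simp]:
  assumes "ty_of \<Gamma> s = Some T0" "ty_of \<Gamma> t = Some T0"
  shows "wf_fm \<Gamma> (q_lt s t)" "wf_fm \<Gamma> (q_le s t)"
  using assms by (simp_all add: q_lt_def q_le_def)

lemma wf_r [simp]:
  assumes "ty_of \<Gamma> s = Some T1" "ty_of \<Gamma> t = Some T1"
  shows "wf_fm \<Gamma> (r_eq s t)" "wf_fm \<Gamma> (r_lt s t)" "wf_fm \<Gamma> (r_le s t)"
  using assms by (simp_all add: r_eq_def r_lt_def r_le_def)

lemma wf_r_unary [simp]:
  assumes "ty_of \<Gamma> s = Some T1"
  shows "wf_fm \<Gamma> (is_real s)" "wf_fm \<Gamma> (in_unit s)"
  using assms by (simp_all add: is_real_def in_unit_def)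

lemma wf_mem [simp]: "ty_of \<Gamma> s = Some T1 \<Longrightarrow> ty_of \<Gamma> t = Some T2 \<Longrightarrow> wf_fm \<Gamma> (mem s t)"
  by (simp add: mem_def)

lemma wf_fin [simp]: "ty_of \<Gamma> s = Some T0 \<Longrightarrow> ty_of \<Gamma> t = Some (T0 \<^bold>\<Rightarrow> T1) \<Longrightarrow> wf_fm \<Gamma> (fin s t)"
  by (simp add: fin_def)

section \<open>Arithmetic in a model\<close>

text \<open>\<open>code\<close> identifies the numbers of the model with a type in two algebraic
  classes, so that semiring reasoning and truncated subtraction become those of the library. Nothing
  forces \<open>'n\<close> to be standard.\<close>

locale arithmetic_model = base_model D app cn lt
  for D :: "ty \<Rightarrow> 'u set" and app (infixl "\<bullet>" 90) and cn lt +
  fixes code :: "'n::{discrete_linordered_semidom, ordered_cancel_comm_monoid_diff} \<Rightarrow> 'u"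
  assumes inj_code: "inj code" and range_code: "range code = D T0"
    and code_zero: "cn Zero = code 0" and code_one: "cn One = code 1"
    and code_add: "cn Plus \<bullet> code a \<bullet> code b = code (a + b)"
    and code_mul: "cn Times \<bullet> code a \<bullet> code b = code (a * b)"
    and lt_code: "lt (code a) (code b) \<longleftrightarrow> a < b"
begin

lemmas code_simps [simp] = code_zero code_one code_add code_mul lt_code

lemma code_eq [simp]: "code a = code b \<longleftrightarrow> a = b"
  using inj_code by (simp add: inj_eq)

lemma code_in [simp]: "code a \<in> D T0"
  using range_code by blast

lemma ball_D0 [simp]: "(\<forall>x\<in>D T0. P x) \<longleftrightarrow> (\<forall>a. P (code a))"
  by (simp flip: range_code)

definition num :: "'u \<Rightarrow> 'n" where "num = inv code"

lemma num_code [simp]: "num (code a) = a"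
  by (simp add: num_def inj_code)

lemma code_num [simp]: "x \<in> D T0 \<Longrightarrow> code (num x) = x"
  by (auto simp flip: range_code)

lemma D0_cases: "x \<in> D T0 \<Longrightarrow> (\<And>a. x = code a \<Longrightarrow> P) \<Longrightarrow> P"
  by (auto simp flip: range_code)

lemma D_app [simp]:
  "f \<in> D T1 \<Longrightarrow> x \<in> D T0 \<Longrightarrow> f \<bullet> x \<in> D T0"
  "g \<in> D T2 \<Longrightarrow> f \<in> D T1 \<Longrightarrow> g \<bullet> f \<in> D T0"
  "w \<in> D (T0 \<^bold>\<Rightarrow> T1) \<Longrightarrow> x \<in> D T0 \<Longrightarrow> w \<bullet> x \<in> D T1"
  "h \<in> D (T1 \<^bold>\<Rightarrow> T1) \<Longrightarrow> f \<in> D T1 \<Longrightarrow> h \<bullet> f \<in> D T1"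
  using app_in by blast+

definition val :: "'u \<Rightarrow> 'n \<Rightarrow> 'n" where "val f a = num (f \<bullet> code a)"

lemma app_code: "f \<in> D T1 \<Longrightarrow> f \<bullet> code a = code (val f a)"
  by (simp add: val_def)

lemma zero_or_succ: "a = 0 \<or> (\<exists>b. a = b + (1::'n))"
proof -
  consider "code a = code 0" | x where "x \<in> D T0" "code a = x \<oplus> \<one>"
    using zero_or_Suc[of "code a"] by auto
  then show ?thesis by cases (auto elim: D0_cases)
qed

text \<open>The premise on \<open>sat\<close> certifies that \<open>P\<close> is definable. Each use
  exhibits a formula in which \<open>V 0\<close> is the induction variable and the parameters follow
  in the order of \<Gamma>.\<close>

lemma code_induct:
  assumes "wf_fm (T0 # \<Gamma>) \<phi>" "env e \<Gamma>"
    and sat: "\<And>a. sat (case_nat (code a) e) \<phi> \<longleftrightarrow> P a"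
    and "P 0" and "\<And>a. P a \<Longrightarrow> P (a + 1)"
  shows "P a"
proof -
  have "sat (case_nat (code a) e) \<phi>"
  proof (rule induct_D0[OF assms(1,2) code_in])
    show "sat (case_nat \<zero> e) \<phi>" using sat assms(4) by simp
    show "sat (case_nat (n \<oplus> \<one>) e) \<phi>" if "n \<in> D T0" "sat (case_nat n e) \<phi>" for n
      using that sat assms(5) by (auto elim!: D0_cases)
  qed
  then show ?thesis using sat by simp
qed

section \<open>Recursion in the model: truncated subtraction, powers of two, square roots\<close>

definition cval :: "tm \<Rightarrow> 'u" where "cval t = tval (\<lambda>_. \<zero>) t"

lemma tval_lams: "ty_of \<Gamma> t = Some \<tau> \<Longrightarrow> tval e (lams \<Gamma> t) = cval (lams \<Gamma> t)"
  unfolding cval_def by (rule tval_cong[of "[]"]) (auto intro: ty_of_lams)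

lemma cval_lams2:
  assumes "ty_of [\<sigma>, \<rho>] t = Some \<tau>" "x \<in> D \<rho>" "y \<in> D \<sigma>"
  shows "cval (lams [\<sigma>, \<rho>] t) \<bullet> x \<bullet> y = tval (case_nat y (case_nat x (\<lambda>_. \<zero>))) t"
  using assms lam_app[of _ "[]" x \<rho> "lam [\<rho>] \<sigma> t"] lam_app[of _ "[\<rho>]" y \<sigma> t] ty_of_lam[of \<sigma> "[\<rho>]" t]
  by (simp add: cval_def)

lemma cval_lams_in: "ty_of \<Gamma> t = Some \<tau> \<Longrightarrow> cval (lams \<Gamma> t) \<in> D (foldl (\<lambda>\<tau> \<sigma>. \<sigma> \<^bold>\<Rightarrow> \<tau>) \<tau> \<Gamma>)"
  unfolding cval_def by (rule tval_in[of _ "[]"]) (auto intro: ty_of_lams)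

definition iter :: "'u \<Rightarrow> 'n \<Rightarrow> 'n \<Rightarrow> 'n" where
  "iter F a n = num (cn (Rec T0) \<bullet> F \<bullet> code a \<bullet> code n)"

lemma Rec_in: "F \<in> D (T0 \<^bold>\<Rightarrow> T0 \<^bold>\<Rightarrow> T0) \<Longrightarrow> x \<in> D T0 \<Longrightarrow> y \<in> D T0 \<Longrightarrow> cn (Rec T0) \<bullet> F \<bullet> x \<bullet> y \<in> D T0"
  using con_in(7) app_in by blast

lemma Rec_code: "F \<in> D (T0 \<^bold>\<Rightarrow> T0 \<^bold>\<Rightarrow> T0) \<Longrightarrow> cn (Rec T0) \<bullet> F \<bullet> code a \<bullet> code n = code (iter F a n)"
  by (simp add: iter_def Rec_in)

lemma iter_0: "F \<in> D (T0 \<^bold>\<Rightarrow> T0 \<^bold>\<Rightarrow> T0) \<Longrightarrow> iter F a 0 = a"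
  using Rec_zero[of F "code a"] by (simp add: iter_def)

lemma iter_Suc:
  assumes "F \<in> D (T0 \<^bold>\<Rightarrow> T0 \<^bold>\<Rightarrow> T0)" "F \<bullet> code n \<bullet> code (iter F a n) = code b"
  shows "iter F a (n + 1) = b"
proof -
  have "cn (Rec T0) \<bullet> F \<bullet> code a \<bullet> code (n + 1) = F \<bullet> code n \<bullet> (cn (Rec T0) \<bullet> F \<bullet> code a \<bullet> code n)"
    using Rec_Suc[OF assms(1), of "code a" "code n"] by simp
  also have "\<dots> = code b" using assms by (simp add: Rec_code)
  finally show ?thesis by (simp add: iter_def)
qed

abbreviation fun2 :: "tm \<Rightarrow> 'u" where "fun2 t \<equiv> cval (lams [T0, T0] t)"

lemma fun2_in: "ty_of [T0, T0] t = Some T0 \<Longrightarrow> fun2 t \<in> D (T0 \<^bold>\<Rightarrow> T0 \<^bold>\<Rightarrow> T0)"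
  using cval_lams_in by fastforce

lemma fun2_app: "ty_of [T0, T0] t = Some T0 \<Longrightarrow>
    fun2 t \<bullet> code a \<bullet> code b = tval (case_nat (code b) (case_nat (code a) (\<lambda>_. \<zero>))) t"
  by (rule cval_lams2) auto

lemma tval_fun2: "ty_of [T0, T0] t = Some T0 \<Longrightarrow> tval e (lams [T0, T0] t) = fun2 t"
  by (rule tval_lams)

lemma Rec_fun2: "ty_of [T0, T0] t = Some T0 \<Longrightarrow> x \<in> D T0 \<Longrightarrow> y \<in> D T0 \<Longrightarrow>
    cn (Rec T0) \<bullet> fun2 t \<bullet> x \<bullet> y = code (iter (fun2 t) (num x) (num y))"
  using Rec_in[OF fun2_in] by (simp add: iter_def del: lams.simps)

lemma tval_pred [simp]: "tval e s \<in> D T0 \<Longrightarrow> tval e (pred_tm s) = code (num (tval e s) - 1)"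
proof -
  let ?F = "fun2 (V 1)"
  have "iter ?F 0 (n + 1) = n" for n
    by (rule iter_Suc) (simp_all add: fun2_in fun2_app del: lams.simps)
  moreover have "iter ?F 0 0 = 0" by (simp add: iter_0 fun2_in del: lams.simps)
  ultimately have "iter ?F 0 n = n - 1" for n using zero_or_succ[of n] by auto
  then show "tval e s \<in> D T0 \<Longrightarrow> tval e (pred_tm s) = code (num (tval e s) - 1)"
    by (simp add: pred_tm_def tval_fun2 Rec_fun2 del: lams.simps)
qed

lemma tval_monus [simp]:
  "tval e s \<in> D T0 \<Longrightarrow> tval e t \<in> D T0 \<Longrightarrow> tval e (s \<^bold>- t) = code (num (tval e s) - num (tval e t))"
proof -
  let ?F = "fun2 (pred_tm (V 0))"
  have F: "?F \<in> D (T0 \<^bold>\<Rightarrow> T0 \<^bold>\<Rightarrow> T0)" by (simp add: fun2_in del: lams.simps)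
  have raw: "tval e s \<in> D T0 \<Longrightarrow> tval e t \<in> D T0 \<Longrightarrow>
    tval e (s \<^bold>- t) = code (iter ?F (num (tval e s)) (num (tval e t)))" for e s t
    by (simp add: monus_def tval_fun2 Rec_fun2 del: lams.simps)
  \<comment> \<open>The truncated difference is characterised by addition and order: the induction
    formula can speak of the iteration, by \<open>raw\<close>, but not of the subtraction of
    \<open>'n\<close>.\<close>
  have "iter ?F a b + b = a \<or> a < b \<and> iter ?F a b = 0" for a b
  proof (rule code_induct[where P = "\<lambda>b. iter ?F a b + b = a \<or> a < b \<and> iter ?F a b = 0"])
    let ?\<phi> = "(V 1 \<^bold>- V 0) \<^bold>+ V 0 \<^bold>= V 1 \<^bold>\<or> V 1 \<^bold>< V 0 \<^bold>\<and> V 1 \<^bold>- V 0 \<^bold>= \<^bold>0"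
    show "wf_fm (T0 # [T0]) ?\<phi>" by simp
    show "env (case_nat (code a) (\<lambda>_. \<zero>)) [T0]" by simp
    show "sat (case_nat (code b) (case_nat (code a) (\<lambda>_. \<zero>))) ?\<phi> \<longleftrightarrow>
      iter ?F a b + b = a \<or> a < b \<and> iter ?F a b = 0" for b
      by (auto simp: raw)
    show "iter ?F a 0 + 0 = a \<or> a < 0 \<and> iter ?F a 0 = 0" by (simp add: iter_0 F del: lams.simps)
    fix b assume IH: "iter ?F a b + b = a \<or> a < b \<and> iter ?F a b = 0"
    have "iter ?F a (b + 1) = iter ?F a b - 1"
      by (rule iter_Suc[OF F]) (simp add: fun2_app del: lams.simps)
    moreover have "a < 1 + b" if "a < b"
      using less_trans[OF that less_add_one] by (simp add: add.commute)
    ultimately show "iter ?F a (b + 1) + (b + 1) = a \<or> a < b + 1 \<and> iter ?F a (b + 1) = 0"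
      using IH zero_or_succ[of "iter ?F a b"]
      by (auto simp: algebra_simps)
  qed
  then have "iter ?F a b = a - b" for a b
    by (metis add_diff_cancel_right' diff_add_zero le_iff_add less_imp_le)
  with raw show "tval e s \<in> D T0 \<Longrightarrow> tval e t \<in> D T0 \<Longrightarrow>
    tval e (s \<^bold>- t) = code (num (tval e s) - num (tval e t))" by simp
qed

definition pow :: "'n \<Rightarrow> 'n" where "pow = iter (fun2 (V 0 \<^bold>+ V 0)) 1"

lemma tval_two_pow [simp]: "tval e s \<in> D T0 \<Longrightarrow> tval e (two_pow s) = code (pow (num (tval e s)))"
  by (simp add: two_pow_def pow_def tval_fun2 Rec_fun2 del: lams.simps)

lemma pow_0 [simp]: "pow 0 = 1"
  by (simp add: pow_def iter_0 fun2_in del: lams.simps)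

lemma pow_Suc [simp]: "pow (a + 1) = pow a + pow a"
  unfolding pow_def by (rule iter_Suc) (simp_all add: fun2_in fun2_app del: lams.simps)

lemma pow_pos [simp]: "0 < pow a"
proof (rule code_induct[where P = "\<lambda>a. 0 < pow a"])
  show "wf_fm (T0 # []) (\<^bold>0 \<^bold>< two_pow (V 0))" by simp
qed (auto simp: add_pos_pos)

lemma pow_add: "pow (a + b) = pow a * pow b"
proof (rule code_induct[where P = "\<lambda>b. pow (a + b) = pow a * pow b"])
  let ?\<phi> = "two_pow (V 1 \<^bold>+ V 0) \<^bold>= two_pow (V 1) \<^bold>* two_pow (V 0)"
  show "wf_fm (T0 # [T0]) ?\<phi>" by simp
  show "env (case_nat (code a) (\<lambda>_. \<zero>)) [T0]" by simp
  show "pow (a + (b + 1)) = pow a * pow (b + 1)" if "pow (a + b) = pow a * pow b" for b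
    using that by (simp only: pow_Suc distrib_left flip: add.assoc)
qed auto

definition sq :: "'n \<Rightarrow> 'n" where
  "sq = iter (fun2 (V 0 \<^bold>+ (\<^bold>1 \<^bold>- ((V 0 \<^bold>+ \<^bold>1) \<^bold>* (V 0 \<^bold>+ \<^bold>1) \<^bold>- (V 1 \<^bold>+ \<^bold>1))))) 0"

lemma tval_sqrt [simp]: "tval e s \<in> D T0 \<Longrightarrow> tval e (sqrt_tm s) = code (sq (num (tval e s)))"
  by (simp add: sqrt_tm_def sq_def tval_fun2 Rec_fun2 del: lams.simps)

lemma sq_Suc: "sq (a + 1) = sq a + (1 - ((sq a + 1) * (sq a + 1) - (a + 1)))"
  unfolding sq_def by (rule iter_Suc) (simp_all add: fun2_in fun2_app del: lams.simps)

text \<open>Passing from \<open>a\<close> to \<open>a + 1\<close> reaches at most one new square, so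
  raising the root by at most one keeps both bounds.\<close>

lemma sq_bounds: "sq a * sq a \<le> a \<and> a < (sq a + 1) * (sq a + 1)"
proof (rule code_induct[where P = "\<lambda>a. sq a * sq a \<le> a \<and> a < (sq a + 1) * (sq a + 1)"])
  let ?\<phi> = "\<^bold>\<not> (V 0 \<^bold>< sqrt_tm (V 0) \<^bold>* sqrt_tm (V 0)) \<^bold>\<and>
    V 0 \<^bold>< (sqrt_tm (V 0) \<^bold>+ \<^bold>1) \<^bold>* (sqrt_tm (V 0) \<^bold>+ \<^bold>1)"
  show "wf_fm (T0 # []) ?\<phi>" by simp
  show "sat (case_nat (code a) (\<lambda>_. \<zero>)) ?\<phi> \<longleftrightarrow> sq a * sq a \<le> a \<and> a < (sq a + 1) * (sq a + 1)" for a
    by (auto simp: not_less not_le)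
  have "sq 0 = 0" by (simp add: sq_def iter_0 fun2_in del: lams.simps)
  then show "sq 0 * sq 0 \<le> 0 \<and> 0 < (sq 0 + 1) * (sq 0 + 1)" by simp
  fix a assume IH: "sq a * sq a \<le> a \<and> a < (sq a + 1) * (sq a + 1)"
  show "sq (a + 1) * sq (a + 1) \<le> a + 1 \<and> a + 1 < (sq (a + 1) + 1) * (sq (a + 1) + 1)"
  proof (cases "(sq a + 1) * (sq a + 1) \<le> a + 1")
    case True
    then have "sq (a + 1) = sq a + 1"
      unfolding sq_Suc by (metis diff_add_zero diff_zero le_iff_add)
    moreover have "a + 1 \<le> (sq a + 1) * (sq a + 1)" using IH by (simp add: less_iff_succ_less_eq)
    moreover have "(sq a + 1) * (sq a + 1) < (sq a + 1 + 1) * (sq a + 1 + 1)"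
      by (intro mult_strict_mono) (simp_all add: add_nonneg_pos)
    ultimately show ?thesis using True by simp
  next
    case False
    \<comment> \<open>The inner difference is at least one here, so the outer truncated difference
      vanishes and the root stays.\<close>
    then have "a + 1 + 1 \<le> (sq a + 1) * (sq a + 1)" by (simp add: not_le less_iff_succ_less_eq)
    then obtain c where "(sq a + 1) * (sq a + 1) = a + 1 + 1 + c"
      unfolding le_iff_add by blast
    then have c: "(sq a + 1) * (sq a + 1) = a + 1 + (1 + c)" by (simp only: add.assoc)
    have "sq (a + 1) = sq a" unfolding sq_Suc c by simp
    then show ?thesis using IH False by (auto simp: not_le intro: order_trans)
  qed
qed auto

lemma sq_unique: assumes "r * r \<le> a" "a < (r + 1) * (r + 1)" shows "sq a = r"
proof -
  have le: "x \<le> y" if "x * x \<le> a" "a < (y + 1) * (y + 1)" for x y :: 'n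
  proof -
    have "x * x < (y + 1) * (y + 1)" using that by (rule le_less_trans)
    then have "x < y + 1" by (metis linorder_not_less mult_mono zero_le)
    then show ?thesis by (simp add: less_eq_iff_succ_less)
  qed
  show ?thesis using le assms sq_bounds by (blast intro: order_antisym)
qed

subsection \<open>Pairs and rational numbers\<close>

definition pr :: "'n \<Rightarrow> 'n \<Rightarrow> 'n" where "pr a b = (a + b) * (a + b) + a"
definition p1 :: "'n \<Rightarrow> 'n" where "p1 a = a - sq a * sq a"
definition p2 :: "'n \<Rightarrow> 'n" where "p2 a = sq a - p1 a"

text \<open>\<open>pr a b\<close> lies between the squares of \<open>a + b\<close> and
  \<open>a + b + 1\<close>, so the integer square root recovers the sum, and the remainder is
  \<open>a\<close>.\<close>

lemma sq_pr: "sq (pr a b) = a + b"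
proof (rule sq_unique)
  have "(a + b + 1) * (a + b + 1) = pr a b + (a + b + b + 1)" by (simp add: pr_def algebra_simps)
  moreover have "0 < a + b + b + 1" by (simp add: add_nonneg_pos)
  ultimately show "pr a b < (a + b + 1) * (a + b + 1)" by simp
qed (simp add: pr_def)

lemma p1_pr [simp]: "p1 (pr a b) = a"
  by (simp add: p1_def sq_pr) (simp add: pr_def)

lemma p2_pr [simp]: "p2 (pr a b) = b"
  by (simp add: p2_def sq_pr)

lemma tval_pair [simp]:
  "tval e s \<in> D T0 \<Longrightarrow> tval e t \<in> D T0 \<Longrightarrow> tval e (pair s t) = code (pr (num (tval e s)) (num (tval e t)))"
  by (auto simp: pair_def pr_def elim!: D0_cases)

lemma tval_proj1 [simp]: "tval e s \<in> D T0 \<Longrightarrow> tval e (proj1 s) = code (p1 (num (tval e s)))"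
  by (auto simp: proj1_def p1_def elim!: D0_cases)

lemma tval_proj2 [simp]: "tval e s \<in> D T0 \<Longrightarrow> tval e (proj2 s) = code (p2 (num (tval e s)))"
  by (auto simp: proj2_def p2_def elim!: D0_cases)

definition ps :: "'n \<Rightarrow> 'n" where "ps q = p1 (p1 q)"
definition ng :: "'n \<Rightarrow> 'n" where "ng q = p2 (p1 q)"
definition dn :: "'n \<Rightarrow> 'n" where "dn q = p2 q + 1"
definition rt :: "'n \<Rightarrow> 'n \<Rightarrow> 'n \<Rightarrow> 'n" where "rt a b d = pr (pr a b) (d - 1)"

lemma dn_pos [simp]: "0 < dn q"
  by (simp add: dn_def add_nonneg_pos)

lemma rt_simps [simp]: "ps (rt a b d) = a" "ng (rt a b d) = b" "0 < d \<Longrightarrow> dn (rt a b d) = d"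
  using zero_or_succ[of d] by (auto simp: ps_def ng_def dn_def rt_def)

lemma tval_rt_simps [simp]:
  assumes "tval e s \<in> D T0"
  shows "tval e (pos_part s) = code (ps (num (tval e s)))" "tval e (neg_part s) = code (ng (num (tval e s)))"
    "tval e (denom s) = code (dn (num (tval e s)))"
  using assms by (simp_all add: pos_part_def ps_def neg_part_def ng_def denom_def dn_def)

lemma tval_rat [simp]:
  assumes "tval e s \<in> D T0" "tval e t \<in> D T0" "tval e r \<in> D T0"
  shows "tval e (rat s t r) = code (rt (num (tval e s)) (num (tval e t)) (num (tval e r)))"
  using assms by (simp add: rat_def rt_def)

definition qadd :: "'n \<Rightarrow> 'n \<Rightarrow> 'n" where
  "qadd p q = rt (ps p * dn q + ps q * dn p) (ng p * dn q + ng q * dn p) (dn p * dn q)"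
definition qabs :: "'n \<Rightarrow> 'n" where
  "qabs q = rt ((ps q - ng q) + (ng q - ps q)) 0 (dn q)"
definition qdist :: "'n \<Rightarrow> 'n \<Rightarrow> 'n" where
  "qdist p q = qabs (qadd p (rt (ng q) (ps q) (dn q)))"
definition qlt :: "'n \<Rightarrow> 'n \<Rightarrow> bool" where
  "qlt p q \<longleftrightarrow> ps p * dn q + ng q * dn p < ps q * dn p + ng p * dn q"

abbreviation qzero :: 'n where "qzero \<equiv> rt 0 0 1"
abbreviation qpow :: "'n \<Rightarrow> 'n" where "qpow a \<equiv> rt 1 0 (pow a)"
abbreviation qpow' :: "'n \<Rightarrow> 'n" where "qpow' a \<equiv> rt (1 + 1) 0 (pow a)"

lemma tval_q_unary [simp]:
  assumes "tval e s \<in> D T0"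
  shows "tval e (q_abs s) = code (qabs (num (tval e s)))"
    "tval e (q_pow s) = code (qpow (num (tval e s)))" "tval e (q_pow' s) = code (qpow' (num (tval e s)))"
  using assms by (simp_all add: q_abs_def qabs_def q_pow_def q_pow'_def)

lemma tval_q_const [simp]: "tval e q_zero = code qzero" "tval e q_one = code (rt 1 0 1)"
  by (simp_all add: q_zero_def q_one_def)

lemma tval_q_binary [simp]:
  assumes "tval e s \<in> D T0" "tval e t \<in> D T0"
  shows "tval e (q_add s t) = code (qadd (num (tval e s)) (num (tval e t)))"
    "tval e (q_dist s t) = code (qdist (num (tval e s)) (num (tval e t)))"
  using assms by (simp_all add: q_add_def qadd_def q_dist_def qdist_def q_minus_def)

lemma sat_q_lt [simp]:
  assumes "tval e s \<in> D T0" "tval e t \<in> D T0"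
  shows "sat e (q_lt s t) \<longleftrightarrow> qlt (num (tval e s)) (num (tval e t))"
    "sat e (q_le s t) \<longleftrightarrow> \<not> qlt (num (tval e t)) (num (tval e s))"
  using assms by (simp_all add: q_le_def q_lt_def qlt_def)

lemma qadd_simps [simp]:
  "ps (qadd p q) = ps p * dn q + ps q * dn p" "ng (qadd p q) = ng p * dn q + ng q * dn p"
  "dn (qadd p q) = dn p * dn q"
  by (simp_all add: qadd_def)

lemma qabs_simps [simp]:
  "ps (qabs q) = (ps q - ng q) + (ng q - ps q)" "ng (qabs q) = 0" "dn (qabs q) = dn q"
  by (simp_all add: qabs_def)

lemma qdist_simps [simp]:
  "ps (qdist p q) = (ps p * dn q + ng q * dn p - (ng p * dn q + ps q * dn p))
     + (ng p * dn q + ps q * dn p - (ps p * dn q + ng q * dn p))"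
  "ng (qdist p q) = 0" "dn (qdist p q) = dn p * dn q"
  by (simp_all add: qdist_def)

lemma qdist_commute: "qdist p q = qdist q p"
  unfolding qdist_def qabs_def by (simp add: algebra_simps)

subsection \<open>Real numbers\<close>

definition Real :: "'u \<Rightarrow> bool" where
  "Real x \<longleftrightarrow> (\<forall>a b. qlt (qdist (val x a) (val x (a + b))) (qpow a))"
definition Req :: "'u \<Rightarrow> 'u \<Rightarrow> bool" where
  "Req x y \<longleftrightarrow> (\<forall>a. \<not> qlt (qpow' a) (qdist (val x a) (val y a)))"
definition Rlt :: "'u \<Rightarrow> 'u \<Rightarrow> bool" where
  "Rlt x y \<longleftrightarrow> (\<exists>a. qlt (qadd (val x a) (qpow' a)) (val y a))"

lemma sat_is_real [simp]: "tval e s \<in> D T1 \<Longrightarrow> sat e (is_real s) \<longleftrightarrow> Real (tval e s)"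
  by (simp add: is_real_def Real_def app_code)

lemma sat_r [simp]:
  assumes "tval e s \<in> D T1" "tval e t \<in> D T1"
  shows "sat e (r_eq s t) \<longleftrightarrow> Req (tval e s) (tval e t)"
    "sat e (r_lt s t) \<longleftrightarrow> Rlt (tval e s) (tval e t)"
    "sat e (r_le s t) \<longleftrightarrow> \<not> Rlt (tval e t) (tval e s)"
  using assms by (simp_all add: r_eq_def r_lt_def r_le_def Req_def Rlt_def app_code)

lemma Req_sym: "Req x y \<Longrightarrow> Req y x"
  by (simp add: Req_def qdist_commute)

end

section \<open>Sums of distinct powers of two\<close>

text \<open>Definition by cases: truncated \<open>1 - c\<close> is the indicator of
  \<open>c = 0\<close>, so the value is \<open>t\<close> if \<open>c\<close> vanishes and
  \<open>s\<close> otherwise.\<close>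

definition cond_tm :: "tm \<Rightarrow> tm \<Rightarrow> tm \<Rightarrow> tm" where
  "cond_tm c s t = s \<^bold>* (\<^bold>1 \<^bold>- (\<^bold>1 \<^bold>- c)) \<^bold>+ t \<^bold>* (\<^bold>1 \<^bold>- c)"

lemma ty_of_cond_tm [simp]:
  "ty_of \<Gamma> c = Some T0 \<Longrightarrow> ty_of \<Gamma> s = Some T0 \<Longrightarrow> ty_of \<Gamma> t = Some T0 \<Longrightarrow>
   ty_of \<Gamma> (cond_tm c s t) = Some T0"
  by (simp add: cond_tm_def)

text \<open>The arguments are the sequence, the index and the partial sum so far. Being a closed
  term, it lets sums of arbitrary sequences occur in induction formulas.\<close>

definition sum_step :: tm where "sum_step = lams [T0, T0, T1] (q_add (V 0) (V 2 \<cdot> V 1))"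

context arithmetic_model
begin

lemma tval_cond [simp]:
  assumes "tval e c \<in> D T0" "tval e s \<in> D T0" "tval e t \<in> D T0"
  shows "tval e (cond_tm c s t) = (if num (tval e c) = 0 then tval e t else tval e s)"
proof -
  from assms obtain a b k where abk: "tval e c = code k" "tval e s = code a" "tval e t = code b"
    by (auto elim!: D0_cases)
  have "1 - (l + 1) = 0" for l :: 'n using diff_add_zero[of 1 l] by (simp add: add.commute)
  then show ?thesis using zero_or_succ[of k] by (auto simp: cond_tm_def abk)
qed

lemma diff_eq_0_iff: "a - b = 0 \<longleftrightarrow> a \<le> (b::'n)"
proof
  show "a \<le> b" if "a - b = 0"
    using that le_add_diff_inverse2[of b a] by (cases "b \<le> a") auto
qed (auto simp: le_iff_add)

text \<open>Comprehension by \<lambda>-abstraction: a term with parameters in the model defines a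
  functional of the model. Sequences and functionals needed below are mostly built this way.\<close>

lemma ex_fun:
  assumes "ty_of (\<sigma> # \<Gamma>) t = Some \<tau>" "env e \<Gamma>"
  shows "\<exists>f\<in>D (\<sigma> \<^bold>\<Rightarrow> \<tau>). \<forall>x\<in>D \<sigma>. f \<bullet> x = tval (case_nat x e) t"
  using tval_in[OF assms(2) ty_of_lam] lam_app[OF assms(2)] assms(1) by blast

lemma ex_fun2:
  assumes "ty_of (\<rho> # \<sigma> # \<Gamma>) t = Some \<tau>" "env e \<Gamma>"
  shows "\<exists>f\<in>D (\<sigma> \<^bold>\<Rightarrow> \<rho> \<^bold>\<Rightarrow> \<tau>). \<forall>x\<in>D \<sigma>. \<forall>y\<in>D \<rho>. f \<bullet> x \<bullet> y = tval (case_nat y (case_nat x e)) t"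
proof -
  obtain f where f: "f \<in> D (\<sigma> \<^bold>\<Rightarrow> \<rho> \<^bold>\<Rightarrow> \<tau>)"
    "\<forall>x\<in>D \<sigma>. f \<bullet> x = tval (case_nat x e) (lam (\<sigma> # \<Gamma>) \<rho> t)"
    using ex_fun[OF ty_of_lam[OF assms(1)] assms(2)] by blast
  have "tval (case_nat x e) (lam (\<sigma> # \<Gamma>) \<rho> t) \<bullet> y = tval (case_nat y (case_nat x e)) t"
    if "x \<in> D \<sigma>" "y \<in> D \<rho>" for x y
    using that assms by (intro lam_app) auto
  then show ?thesis using f by (intro bexI[of _ f] ballI) simp_all
qed

text \<open>\<open>rev\<close> appears since the head of \<Gamma> is abstracted innermost and is
  therefore the last argument.\<close>

lemma cval_lams_app:
  "ty_of \<Gamma> t = Some \<tau> \<Longrightarrow> env e \<Gamma> \<Longrightarrow> foldl (\<bullet>) (cval (lams \<Gamma> t)) (rev (map e [0..<length \<Gamma>])) = tval e t"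
proof (induction \<Gamma> arbitrary: t \<tau> e)
  case Nil
  then show ?case by (auto simp: cval_def intro!: tval_cong[of "[]"])
next
  case (Cons \<sigma> \<Gamma>)
  have e: "env (\<lambda>i. e (Suc i)) \<Gamma>" "e 0 \<in> D \<sigma>" using Cons.prems(2) by (auto simp: env_def)
  have "map e [0..<length (\<sigma> # \<Gamma>)] = e 0 # map (\<lambda>i. e (Suc i)) [0..<length \<Gamma>]"
    by (simp only: length_Cons map_upt_Suc)
  moreover have "case_nat (e 0) (\<lambda>i. e (Suc i)) = e" by (auto simp: fun_eq_iff split: nat.split)
  ultimately show ?case
    using Cons.IH[OF ty_of_lam[OF Cons.prems(1)] e(1)] lam_app[OF e Cons.prems(1)] by simp
qed

lemma T1_ext: "f \<in> D T1 \<Longrightarrow> g \<in> D T1 \<Longrightarrow> (\<And>a. val f a = val g a) \<Longrightarrow> f = g"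
  by (rule ext) (auto simp: app_code elim!: D0_cases)

lemma step_ext:
  assumes "F \<in> D (T0 \<^bold>\<Rightarrow> T0 \<^bold>\<Rightarrow> T0)" "G \<in> D (T0 \<^bold>\<Rightarrow> T0 \<^bold>\<Rightarrow> T0)"
    and "\<And>a b. F \<bullet> code a \<bullet> code b = G \<bullet> code a \<bullet> code b"
  shows "F = G"
  using assms by (intro ext[of F _ _ G] ext[of "F \<bullet> _" T0 T0 "G \<bullet> _"]) (auto intro: app_in elim!: D0_cases)

section \<open>Sums of a sequence of rationals up to a possibly nonstandard length\<close>

definition qsum :: "'u \<Rightarrow> 'n \<Rightarrow> 'n" where
  "qsum g = iter (cval sum_step \<bullet> g) qzero"

lemma ty_of_sum_step: "ty_of \<Gamma> sum_step = Some (T1 \<^bold>\<Rightarrow> T0 \<^bold>\<Rightarrow> T0 \<^bold>\<Rightarrow> T0)"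
  by (simp add: sum_step_def ty_of_lams del: lams.simps)

lemma tval_sum_step: "tval e sum_step = cval sum_step"
  by (simp add: sum_step_def tval_lams[where \<tau> = T0] del: lams.simps)

lemma sum_step_in: "g \<in> D T1 \<Longrightarrow> cval sum_step \<bullet> g \<in> D (T0 \<^bold>\<Rightarrow> T0 \<^bold>\<Rightarrow> T0)"
  by (rule app_in[of _ T1]) (use cval_lams_in[of "[T0, T0, T1]"] in \<open>simp_all add: sum_step_def del: lams.simps\<close>)

lemma sum_step_app:
  "g \<in> D T1 \<Longrightarrow> cval sum_step \<bullet> g \<bullet> code j \<bullet> code a = code (qadd a (val g j))"
  using cval_lams_app[of "[T0, T0, T1]" "q_add (V 0) (V 2 \<cdot> V 1)" T0
      "case_nat (code a) (case_nat (code j) (case_nat g (\<lambda>_. g)))"]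
  by (simp add: app_code numeral_2_eq_2 sum_step_def del: lams.simps)

lemma qsum_0 [simp]: "g \<in> D T1 \<Longrightarrow> qsum g 0 = qzero"
  by (simp add: qsum_def iter_0 sum_step_in)

lemma qsum_Suc [simp]: "g \<in> D T1 \<Longrightarrow> qsum g (n + 1) = qadd (qsum g n) (val g n)"
  unfolding qsum_def by (rule iter_Suc) (simp_all add: sum_step_in sum_step_app)

definition qsum_tm :: "tm \<Rightarrow> tm \<Rightarrow> tm" where
  "qsum_tm s t = C (Rec T0) \<cdot> (sum_step \<cdot> s) \<cdot> q_zero \<cdot> t"

lemma ty_of_qsum_tm [simp]:
  "ty_of \<Gamma> s = Some T1 \<Longrightarrow> ty_of \<Gamma> t = Some T0 \<Longrightarrow> ty_of \<Gamma> (qsum_tm s t) = Some T0"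
  by (simp add: qsum_tm_def ty_of_sum_step)

lemma tval_qsum_tm [simp]:
  "tval e s \<in> D T1 \<Longrightarrow> tval e t \<in> D T0 \<Longrightarrow> tval e (qsum_tm s t) = code (qsum (tval e s) (num (tval e t)))"
  by (auto simp: qsum_tm_def qsum_def tval_sum_step sum_step_in Rec_code elim!: D0_cases)

lemma less_succ_iff: "a < b + 1 \<longleftrightarrow> a < b \<or> a = (b::'n)"
  by (auto simp: order.order_iff_strict simp flip: less_eq_iff_succ_less)

lemma le_succ_iff: "a \<le> b + 1 \<longleftrightarrow> a \<le> b \<or> a = b + (1::'n)"
  by (metis le_less less_eq_iff_succ_less)

text \<open>Even this needs an induction inside the model, as the number \<open>m\<close> of
  summands may be nonstandard.\<close>

lemma qsum_cong:
  assumes "g \<in> D T1" "h \<in> D T1"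
  shows "(\<forall>j<m. val g j = val h j) \<longrightarrow> qsum g m = qsum h m"
proof (rule code_induct[where P = "\<lambda>m. (\<forall>j<m. val g j = val h j) \<longrightarrow> qsum g m = qsum h m"])
  let ?\<phi> = "Forall T0 (V 0 \<^bold>< V 1 \<^bold>\<longrightarrow> V 2 \<cdot> V 0 \<^bold>= V 3 \<cdot> V 0) \<^bold>\<longrightarrow> qsum_tm (V 1) (V 0) \<^bold>= qsum_tm (V 2) (V 0)"
  let ?e = "case_nat g (case_nat h (\<lambda>_. g))"
  show "wf_fm (T0 # [T1, T1]) ?\<phi>" by simp
  show "env ?e [T1, T1]" using assms by simp
  show "sat (case_nat (code m) ?e) ?\<phi> \<longleftrightarrow> ((\<forall>j<m. val g j = val h j) \<longrightarrow> qsum g m = qsum h m)" for m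
    using assms by (simp add: app_code numeral_2_eq_2 numeral_3_eq_3)
qed (use assms in \<open>auto simp: less_succ_iff\<close>)

lemma ng_qsum:
  assumes "g \<in> D T1" "\<And>j. ng (val g j) = 0"
  shows "ng (qsum g m) = 0"
proof (rule code_induct[where P = "\<lambda>m. ng (qsum g m) = 0"])
  show "wf_fm (T0 # [T1]) (neg_part (qsum_tm (V 1) (V 0)) \<^bold>= \<^bold>0)" by simp
  show "env (case_nat g (\<lambda>_. g)) [T1]" using assms by simp
qed (use assms in auto)

lemma ps_qsum_zero:
  assumes "g \<in> D T1"
  shows "(\<forall>j<m. val g j = qzero) \<longrightarrow> ps (qsum g m) = 0"
proof (rule code_induct[where P = "\<lambda>m. (\<forall>j<m. val g j = qzero) \<longrightarrow> ps (qsum g m) = 0"])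
  let ?\<phi> = "Forall T0 (V 0 \<^bold>< V 1 \<^bold>\<longrightarrow> V 2 \<cdot> V 0 \<^bold>= q_zero) \<^bold>\<longrightarrow> pos_part (qsum_tm (V 1) (V 0)) \<^bold>= \<^bold>0"
  show "wf_fm (T0 # [T1]) ?\<phi>" by simp
  show "env (case_nat g (\<lambda>_. g)) [T1]" using assms by simp
  show "sat (case_nat (code m) (case_nat g (\<lambda>_. g))) ?\<phi> \<longleftrightarrow>
    ((\<forall>j<m. val g j = qzero) \<longrightarrow> ps (qsum g m) = 0)" for m
    using assms by (simp add: app_code numeral_2_eq_2)
qed (use assms in \<open>auto simp: less_succ_iff\<close>)

text \<open>For the positive parts this is sum h <= sum g + 2^-a with denominators cleared. At most
  one summand differs, rising from 0 to 2^-a; read from the left, the partial sums are identical up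
  to it and differ by exactly 2^-a after it.\<close>

lemma qsum_single_change:
  assumes g: "g \<in> D T1" and h: "h \<in> D T1"
    and change: "\<And>j. j < m \<Longrightarrow> val h j \<noteq> val g j \<Longrightarrow> val g j = qzero \<and> val h j = qpow a"
    and single: "\<And>i j. i < j \<Longrightarrow> j < m \<Longrightarrow> val h i \<noteq> val g i \<Longrightarrow> val h j = val g j"
  shows "ps (qsum h m) * dn (qsum g m) * pow a
    \<le> ps (qsum g m) * dn (qsum h m) * pow a + dn (qsum g m) * dn (qsum h m)"
proof -
  define EQ where "EQ k \<longleftrightarrow> ps (qsum h k) * dn (qsum g k) * pow a
    = ps (qsum g k) * dn (qsum h k) * pow a + dn (qsum g k) * dn (qsum h k)" for k
  \<comment> \<open>The first alternative demands equal codes, not just equal rationals, so that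
    \<open>EQ\<close> can start at the position of the change.\<close>
  define P where "P k \<longleftrightarrow> k \<le> m \<longrightarrow> (\<forall>j<k. val h j = val g j) \<and> qsum h k = qsum g k \<or>
    (\<exists>j<k. val h j \<noteq> val g j) \<and> EQ k" for k
  have "P m"
  proof (rule code_induct[where P = P])
    let ?eq = "pos_part (qsum_tm (V 2) (V 0)) \<^bold>* denom (qsum_tm (V 1) (V 0)) \<^bold>* two_pow (V 3) \<^bold>=
      pos_part (qsum_tm (V 1) (V 0)) \<^bold>* denom (qsum_tm (V 2) (V 0)) \<^bold>* two_pow (V 3)
      \<^bold>+ denom (qsum_tm (V 1) (V 0)) \<^bold>* denom (qsum_tm (V 2) (V 0))"
    let ?\<phi> = "\<^bold>\<not> (V 4 \<^bold>< V 0) \<^bold>\<longrightarrow>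
      Forall T0 (V 0 \<^bold>< V 1 \<^bold>\<longrightarrow> V 3 \<cdot> V 0 \<^bold>= V 2 \<cdot> V 0) \<^bold>\<and> qsum_tm (V 2) (V 0) \<^bold>= qsum_tm (V 1) (V 0) \<^bold>\<or>
      Exists T0 (V 0 \<^bold>< V 1 \<^bold>\<and> \<^bold>\<not> V 3 \<cdot> V 0 \<^bold>= V 2 \<cdot> V 0) \<^bold>\<and> ?eq"
    let ?e = "case_nat g (case_nat h (case_nat (code a) (case_nat (code m) (\<lambda>_. g))))"
    show "wf_fm (T0 # [T1, T1, T0, T0]) ?\<phi>" by simp
    show "env ?e [T1, T1, T0, T0]" using g h by simp
    show "sat (case_nat (code k) ?e) ?\<phi> \<longleftrightarrow> P k" for k
      using g h unfolding P_def EQ_def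
      by (simp add: app_code numeral_2_eq_2 numeral_3_eq_3 not_less) blast
    show "P 0" using g h by (simp add: P_def)
    fix k assume IH: "P k"
    show "P (k + 1)"
      unfolding P_def
    proof
      assume "k + 1 \<le> m"
      then have km: "k < m" by (simp add: less_iff_succ_less_eq)
      then consider "\<forall>j<k. val h j = val g j" "qsum h k = qsum g k"
        | j where "j < k" "val h j \<noteq> val g j" "EQ k"
        using IH unfolding P_def by auto
      then show "(\<forall>j<k + 1. val h j = val g j) \<and> qsum h (k + 1) = qsum g (k + 1) \<or>
        (\<exists>j<k + 1. val h j \<noteq> val g j) \<and> EQ (k + 1)"
      proof cases
        case 1
        show ?thesis
        proof (cases "val h k = val g k")
          case True
          then show ?thesis using 1 g h by (auto simp: less_succ_iff)
        next
          case False
          then have "EQ (k + 1)"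
            using change[OF km False] unfolding EQ_def qsum_Suc[OF g] qsum_Suc[OF h] 1(2)
            by (simp add: algebra_simps)
          then show ?thesis using False by (auto simp: less_succ_iff)
        qed
      next
        case 2
        then have same: "val h k = val g k" using single km by blast
        define p p' d d' q r where vars: "p = ps (qsum h k)" "p' = ps (qsum g k)"
          "d = dn (qsum h k)" "d' = dn (qsum g k)" "q = ps (val g k)" "r = dn (val g k)"
        have "p * d' * pow a = p' * d * pow a + d' * d" using 2(3) by (simp add: EQ_def vars)
        \<comment> \<open>Both sums gain the same fraction \<open>q / r\<close>; the old identity is
          scaled by \<open>r * r\<close> and the common contribution added on both sides.\<close>
        then have "(p * d' * pow a) * (r * r) + q * d * d' * r * pow a
          = (p' * d * pow a + d' * d) * (r * r) + q * d * d' * r * pow a" by simp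
        then have "(p * r + q * d) * (d' * r) * pow a
          = (p' * r + q * d') * (d * r) * pow a + (d' * r) * (d * r)" by (simp add: algebra_simps)
        then have "EQ (k + 1)" using g h same by (simp add: EQ_def vars)
        then show ?thesis using 2 by (auto simp: less_succ_iff)
      qed
    qed
  qed
  then consider "qsum h m = qsum g m" | "EQ m" by (auto simp: P_def)
  then show ?thesis by cases (auto simp: EQ_def)
qed

text \<open>If the \<open>j\<close>-th row of \<open>G\<close> keeps the terms \<open>2\<^sup>-\<^sup>i\<close> with \<open>i \<le> j\<close>, then passing from one
  row to the next increases a sum of distinct powers by at most one new power.\<close>

lemma qsum_distinct_powers:
  assumes G: "G \<in> D (T0 \<^bold>\<Rightarrow> T1)"
    and val: "\<And>b j. val (G \<bullet> code b) j = (if s j \<and> y j \<le> b then qpow (y j) else qzero)"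
    and distinct: "\<And>i j. i < j \<Longrightarrow> j < m \<Longrightarrow> s i \<Longrightarrow> s j \<Longrightarrow> y i \<noteq> y j"
    and large: "\<And>j. j < m \<Longrightarrow> s j \<Longrightarrow> c < y j"
  shows "ps (qsum (G \<bullet> code (c + i)) m) * pow c \<le> dn (qsum (G \<bullet> code (c + i)) m)"
proof -
  define S where "S i = qsum (G \<bullet> code (c + i)) m" for i
  \<comment> \<open>Division by \<open>dn (S i) * pow c * pow i\<close> gives S i <= 2^-c -
    2^-(c+i), a partial sum of the geometric series; the bound 2^-c alone would not be
    inductive.\<close>
  define P where "P i \<longleftrightarrow> ps (S i) * pow c * pow i + dn (S i) \<le> dn (S i) * pow i" for i
  have "P i"
  proof (rule code_induct[where P = P])
    let ?S = "qsum_tm (V 1 \<cdot> (V 2 \<^bold>+ V 0)) (V 3)"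
    let ?\<phi> = "\<^bold>\<not> (denom ?S \<^bold>* two_pow (V 0) \<^bold>< pos_part ?S \<^bold>* two_pow (V 2) \<^bold>* two_pow (V 0) \<^bold>+ denom ?S)"
    let ?e = "case_nat G (case_nat (code c) (case_nat (code m) (\<lambda>_. G)))"
    show "wf_fm (T0 # [T0 \<^bold>\<Rightarrow> T1, T0, T0]) ?\<phi>" by simp
    show "env ?e [T0 \<^bold>\<Rightarrow> T1, T0, T0]" using G by simp
    show "sat (case_nat (code i) ?e) ?\<phi> \<longleftrightarrow> P i" for i
      using G by (simp add: P_def S_def numeral_2_eq_2 numeral_3_eq_3 not_less)
    have "\<forall>j<m. val (G \<bullet> code c) j = qzero" using large by (auto simp: val simp flip: not_less)
    then have "ps (S 0) = 0" using ps_qsum_zero[of "G \<bullet> code c" m] G by (simp add: S_def)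
    then show "P 0" by (simp add: P_def)
    fix i assume IH: "P i"
    define p p' d d' where vars: "p = ps (S i)" "p' = ps (S (i + 1))" "d = dn (S i)" "d' = dn (S (i + 1))"
    have powS: "pow (c + i + 1) = pow c * (pow i + pow i)" by (simp add: pow_add[of c i] distrib_left)
    have d: "0 < d" by (simp add: vars)
    \<comment> \<open>Raising the cut-off to \<open>c + i + 1\<close> changes only entries with
      exactly this exponent, and \<open>distinct\<close> leaves at most one of them.\<close>
    have new: "s j \<and> y j = c + i + 1" if "val (G \<bullet> code (c + i + 1)) j \<noteq> val (G \<bullet> code (c + i)) j" for j
      using that le_succ_iff[of "y j" "c + i"] by (auto simp: val split: if_splits)
    have "p' * d * pow (c + i + 1) \<le> p * d' * pow (c + i + 1) + d * d'"
      unfolding vars S_def add.assoc[symmetric]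
    proof (rule qsum_single_change)
      show "val (G \<bullet> code (c + i)) j = qzero \<and> val (G \<bullet> code (c + i + 1)) j = qpow (c + i + 1)"
        if "val (G \<bullet> code (c + i + 1)) j \<noteq> val (G \<bullet> code (c + i)) j" for j
        using new[OF that] by (simp add: val not_le less_succ_iff)
      show "val (G \<bullet> code (c + i + 1)) l = val (G \<bullet> code (c + i)) l"
        if "k < l" "l < m" "val (G \<bullet> code (c + i + 1)) k \<noteq> val (G \<bullet> code (c + i)) k" for k l
        using new[of k] new[of l] distinct[of k l] that by metis
    qed (use G in simp_all)
    then have 1: "p' * d * pow c * (pow i + pow i) \<le> p * d' * pow c * (pow i + pow i) + d * d'"
      by (simp only: powS) (simp add: algebra_simps)
    have "p * pow c * pow i + d \<le> d * pow i" using IH by (simp add: P_def vars)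
    \<comment> \<open>The hypothesis is doubled and scaled to the new denominator: the gain
      2^-(c+i+1) uses up half of the gap 2^-(c+i) that it leaves below 2^-c.\<close>
    then have 2: "(p * pow c * pow i + d) * (d' + d') \<le> d * pow i * (d' + d')"
      by (rule mult_right_mono) simp
    have "d * (p' * pow c * (pow i + pow i) + d') \<le> p * d' * pow c * (pow i + pow i) + d * d' + d * d'"
      using add_right_mono[OF 1, of "d * d'"] by (simp add: algebra_simps)
    also have "\<dots> = (p * pow c * pow i + d) * (d' + d')" by (simp add: algebra_simps)
    also have "\<dots> \<le> d * pow i * (d' + d')" by (rule 2)
    also have "\<dots> = d * (d' * (pow i + pow i))" by (simp add: algebra_simps)
    finally have "p' * pow c * (pow i + pow i) + d' \<le> d' * (pow i + pow i)"
      using d by (rule mult_left_le_imp_le)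
    then show "P (i + 1)" by (simp add: P_def vars)
  qed
  then have "ps (S i) * pow c * pow i \<le> dn (S i) * pow i"
    unfolding P_def using add_increasing2[of "dn (S i)"] by (metis dual_order.trans le_iff_add)
  then have "ps (S i) * pow c \<le> dn (S i)" by (rule mult_right_le_imp_le) simp
  then show ?thesis by (simp add: S_def)
qed

end

section \<open>From SUM to cocode\<close>

context arithmetic_model
begin

section \<open>Semantics of the formulas on reals, sets and finite sequences\<close>

definition rconst :: "'n \<Rightarrow> 'u" where "rconst q = cn (KC T0 T0) \<bullet> code q"

lemma rconst_in [simp]: "rconst q \<in> D T1"
  unfolding rconst_def by (rule app_in[OF con_in(5)]) simp

lemma val_rconst [simp]: "val (rconst q) a = q"
  using K_app[of "code q" T0 "code a" T0] by (simp add: val_def rconst_def)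

lemma tval_r_const [simp]: "tval e r_zero = rconst qzero" "tval e r_one = rconst (rt 1 0 1)"
  by (simp_all add: r_zero_def r_one_def rconst_def)

definition Unit :: "'u \<Rightarrow> bool" where
  "Unit x \<longleftrightarrow> Real x \<and> \<not> Rlt x (rconst qzero) \<and> \<not> Rlt (rconst (rt 1 0 1)) x"

lemma sat_in_unit [simp]: "tval e s \<in> D T1 \<Longrightarrow> sat e (in_unit s) \<longleftrightarrow> Unit (tval e s)"
  by (simp add: in_unit_def Unit_def)

definition val2 :: "'u \<Rightarrow> 'u \<Rightarrow> 'n" where "val2 F x = num (F \<bullet> x)"

lemma app_code2: "F \<in> D T2 \<Longrightarrow> x \<in> D T1 \<Longrightarrow> F \<bullet> x = code (val2 F x)"
  by (simp add: val2_def)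

definition Mem :: "'u \<Rightarrow> 'u \<Rightarrow> bool" where "Mem x F \<longleftrightarrow> Real x \<and> val2 F x = 1"

lemma sat_mem [simp]:
  "tval e s \<in> D T1 \<Longrightarrow> tval e t \<in> D T2 \<Longrightarrow> sat e (mem s t) \<longleftrightarrow> Mem (tval e s) (tval e t)"
  by (simp add: mem_def Mem_def app_code2)

definition Fun :: "'u \<Rightarrow> bool" where
  "Fun Y \<longleftrightarrow> (\<forall>x\<in>D T1. \<forall>y\<in>D T1. Real x \<and> Real y \<and> Req x y \<longrightarrow> val2 Y x = val2 Y y)"

lemma sat_real_to_nat [simp]: "tval e s \<in> D T2 \<Longrightarrow> sat e (real_to_nat s) \<longleftrightarrow> Fun (tval e s)"
  by (simp add: real_to_nat_def Fun_def app_code2)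

definition Fin :: "'n \<Rightarrow> 'u \<Rightarrow> bool" where
  "Fin n w \<longleftrightarrow> (\<forall>i<n. Unit (w \<bullet> code i)) \<and> (\<forall>i j. i < j \<and> j < n \<longrightarrow> \<not> Req (w \<bullet> code i) (w \<bullet> code j))"

lemma sat_fin [simp]:
  "tval e s \<in> D T0 \<Longrightarrow> tval e t \<in> D (T0 \<^bold>\<Rightarrow> T1) \<Longrightarrow> sat e (fin s t) \<longleftrightarrow> Fin (num (tval e s)) (tval e t)"
  by (auto simp: fin_def Fin_def elim!: D0_cases)

lemma r_abs_val:
  assumes "tval e s \<in> D T1"
  shows "tval e (r_abs s) \<in> D T1" "val (tval e (r_abs s)) k = qabs (val (tval e s) k)"
proof -
  let ?t = "q_abs (V 1 \<cdot> V 0)"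
  have r: "tval e (r_abs s) = cval (lams [T0, T1] ?t) \<bullet> tval e s"
    by (simp add: r_abs_def tval_lams[where \<tau> = T0] del: lams.simps)
  show in1: "tval e (r_abs s) \<in> D T1"
    unfolding r using assms cval_lams_in[of "[T0, T1]" ?t T0] app_in by simp
  have "cval (lams [T0, T1] ?t) \<bullet> tval e s \<bullet> code k = code (qabs (val (tval e s) k))"
    using assms cval_lams2[of T0 T1 ?t T0 "tval e s" "code k"] by (simp add: app_code del: lams.simps)
  then show "val (tval e (r_abs s)) k = qabs (val (tval e s) k)" by (simp add: val_def r)
qed

text \<open>By the hypotheses on \<open>g\<close> every summand is a constant sequence, so the shift
  of precision inside \<open>r_sum\<close> has no effect and each approximation of the sum is the
  same rational.\<close>

lemma r_sum_val:
  assumes e: "tval e a \<in> D (T1 \<^bold>\<Rightarrow> T1)" "tval e w \<in> D (T0 \<^bold>\<Rightarrow> T1)" "tval e n \<in> D T0"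
    and g: "g \<in> D T1" "\<And>j k. val (tval e a \<bullet> (tval e w \<bullet> code j)) k = val g j"
  shows "tval e (r_sum a w n) \<in> D T1" "val (tval e (r_sum a w n)) k = qsum g (num (tval e n))"
proof -
  define st where "st = q_add (V 0) (V 5 \<cdot> (V 4 \<cdot> V 1) \<cdot> (V 2 \<^bold>+ V 3))"
  let ?\<Gamma> = "[T0, T0, T0, T0, T0 \<^bold>\<Rightarrow> T1, T1 \<^bold>\<Rightarrow> T1]"
  define it where "it = C (Rec T0) \<cdot> (lams ?\<Gamma> st \<cdot> V 3 \<cdot> V 2 \<cdot> V 1 \<cdot> V 0) \<cdot> q_zero \<cdot> V 1"
  let ?\<Delta> = "[T0, T0, T0 \<^bold>\<Rightarrow> T1, T1 \<^bold>\<Rightarrow> T1]"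
  obtain m where m: "tval e n = code m" using e(3) by (rule D0_cases)
  let ?A = "tval e a" and ?W = "tval e w"
  have st: "ty_of ?\<Gamma> st = Some T0" by (simp add: st_def)
  have tyl: "ty_of \<Gamma> (lams ?\<Gamma> st)
    = Some ((T1 \<^bold>\<Rightarrow> T1) \<^bold>\<Rightarrow> (T0 \<^bold>\<Rightarrow> T1) \<^bold>\<Rightarrow> T0 \<^bold>\<Rightarrow> T0 \<^bold>\<Rightarrow> T0 \<^bold>\<Rightarrow> T0 \<^bold>\<Rightarrow> T0)" for \<Gamma>
    using ty_of_lams[OF st] by simp
  have it: "ty_of ?\<Delta> it = Some T0" by (simp add: it_def tyl del: lams.simps)
  let ?S = "\<lambda>k. cval (lams ?\<Gamma> st) \<bullet> ?A \<bullet> ?W \<bullet> code m \<bullet> code k"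
  \<comment> \<open>The step functional inside \<open>r_sum\<close> equals that of
    \<open>qsum\<close> by extensionality, so the two iterations agree without another
    induction.\<close>
  have S: "?S k = cval sum_step \<bullet> g" for k
  proof (rule step_ext)
    have "cval (lams ?\<Gamma> st) \<in> D ((T1 \<^bold>\<Rightarrow> T1) \<^bold>\<Rightarrow> (T0 \<^bold>\<Rightarrow> T1) \<^bold>\<Rightarrow> T0 \<^bold>\<Rightarrow> T0 \<^bold>\<Rightarrow> T0 \<^bold>\<Rightarrow> T0 \<^bold>\<Rightarrow> T0)"
      using cval_lams_in[OF st] by simp
    then show "?S k \<in> D (T0 \<^bold>\<Rightarrow> T0 \<^bold>\<Rightarrow> T0)"
      using e app_in code_in by metis
    fix j b
    let ?e = "case_nat (code b) (case_nat (code j) (case_nat (code k) (case_nat (code m)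
      (case_nat ?W (case_nat ?A (\<lambda>_. ?A))))))"
    have "?S k \<bullet> code j \<bullet> code b = tval ?e st"
      using cval_lams_app[OF st, of ?e] e by (simp add: eval_nat_numeral del: lams.simps)
    also have "\<dots> = code (qadd b (val g j))"
      using e by (simp add: st_def eval_nat_numeral app_code g)
    finally show "?S k \<bullet> code j \<bullet> code b = cval sum_step \<bullet> g \<bullet> code j \<bullet> code b"
      using g by (simp add: sum_step_app)
  qed (use g sum_step_in in simp)
  have r: "tval e (r_sum a w n) = cval (lams ?\<Delta> it) \<bullet> ?A \<bullet> ?W \<bullet> code m"
    using m it tval_lams[of ?\<Delta> it T0 e] by (simp add: r_sum_def it_def st_def del: lams.simps)
  have "cval (lams ?\<Delta> it) \<in> D ((T1 \<^bold>\<Rightarrow> T1) \<^bold>\<Rightarrow> (T0 \<^bold>\<Rightarrow> T1) \<^bold>\<Rightarrow> T0 \<^bold>\<Rightarrow> T0 \<^bold>\<Rightarrow> T0)"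
    using cval_lams_in[OF it] by simp
  then show "tval e (r_sum a w n) \<in> D T1"
    unfolding r using e app_in code_in by metis
  let ?e = "case_nat (code k) (case_nat (code m) (case_nat ?W (case_nat ?A (\<lambda>_. ?A))))"
  have "cval (lams ?\<Delta> it) \<bullet> ?A \<bullet> ?W \<bullet> code m \<bullet> code k = tval ?e it"
    using cval_lams_app[OF it, of ?e] e by (simp add: eval_nat_numeral del: lams.simps)
  also have "\<dots> = cn (Rec T0) \<bullet> ?S k \<bullet> code qzero \<bullet> code m"
    using tval_lams[OF st] by (simp add: it_def eval_nat_numeral del: lams.simps)
  also have "\<dots> = code (qsum g m)"
    unfolding S qsum_def using g by (intro Rec_code sum_step_in)
  finally show "val (tval e (r_sum a w n)) k = qsum g (num (tval e n))"
    by (simp add: val_def r m)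
qed

text \<open>Meant for \<open>x\<close> and \<open>y\<close> the approximations of index n and n + 3
  to \<epsilon>: from x > 2 * 2^-n and |x - y| < 2^-n follows y > 2^-n, whereas S is at most
  2^-(n+1) and the tolerance is 2^-(n+2), together three quarters of 2^-n.\<close>

lemma small_sum_less:
  assumes S: "ng S = 0" "ps S * (pow n + pow n) \<le> dn S"
    and pos: "qlt (qadd qzero (qpow' n)) x"
    and dist: "qlt (qdist x y) (qpow n)"
  shows "qlt (qadd (qabs S) (qpow' (n + 1 + 1 + 1))) y"
proof -
  define P a b d a' b' d' p s where vars: "P = pow n" "a = ps x" "b = ng x" "d = dn x"
    "a' = ps y" "b' = ng y" "d' = dn y" "p = ps S" "s = dn S"
  have gt0: "0 < P" "0 < d" "0 < d'" "0 < s" by (simp_all add: vars)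
  \<comment> \<open>Over the common denominator \<open>d * d' * P * s\<close> the two parts of
    \<open>x\<close> become \<alpha> and \<beta>, those of \<open>y\<close> become \<gamma> and
    \<delta>, and 2^-n has numerator \<open>v\<close>.\<close>
  define \<alpha> \<beta> \<gamma> \<delta> v where cross: "\<alpha> = a * d' * P * s" "\<beta> = b * d' * P * s"
    "\<gamma> = a' * d * P * s" "\<delta> = b' * d * P * s" "v = s * d * d'"
  have "(1 + 1) * d + b * P < a * P" using pos by (simp add: qlt_def vars)
  then have "((1 + 1) * d + b * P) * (d' * s) < a * P * (d' * s)"
    using gt0 by (intro mult_strict_right_mono) simp_all
  then have 1: "v + v + \<beta> < \<alpha>" by (simp add: cross algebra_simps mult_2_right)
  \<comment> \<open>With truncated subtraction one of the two summands is 0, so \<open>t\<close> is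
    the absolute difference of the cross products, the numerator of |x - y|.\<close>
  define t where "t = (a * d' + b' * d - (b * d' + a' * d)) + (b * d' + a' * d - (a * d' + b' * d))"
  have t: "t * P < d * d'" using dist by (simp add: qlt_def vars t_def mult.commute)
  have "a * d' + b' * d \<le> b * d' + a' * d + t"
  proof (cases "b * d' + a' * d \<le> a * d' + b' * d")
    case True
    then have "a * d' + b' * d = (a * d' + b' * d - (b * d' + a' * d)) + (b * d' + a' * d)" by simp
    also have "\<dots> \<le> t + (b * d' + a' * d)" by (simp add: t_def)
    finally show ?thesis by (simp add: add.commute)
  next
    case False
    then show ?thesis by (simp add: add_increasing2)
  qed
  then have "(a * d' + b' * d) * P \<le> (b * d' + a' * d + t) * P" by (rule mult_right_mono) simp
  also have "\<dots> < (b * d' + a' * d) * P + d * d'" using t by (simp add: algebra_simps)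
  finally have "(a * d' + b' * d) * P * s < ((b * d' + a' * d) * P + d * d') * s"
    using gt0 by (intro mult_strict_right_mono)
  then have 2: "\<alpha> + \<delta> < \<beta> + \<gamma> + v" by (simp add: cross algebra_simps)
  have "(\<delta> + v) + (\<alpha> + \<beta> + v) < \<gamma> + (\<alpha> + \<beta> + v)"
    using add_strict_mono[OF 1 2] by (simp add: algebra_simps)
  then have 3: "\<delta> + v < \<gamma>" by simp
  define T :: 'n where "T = 1 + 1"
  have TT: "T * x = x + x" for x by (simp add: T_def mult_2)
  have "p * (T * P) * (d * d') \<le> s * (d * d')"
    using S(2) by (intro mult_right_mono) (simp_all add: vars T_def mult_2)
  then have 4: "p * (T * P) * (d * d') \<le> v" by (simp add: cross algebra_simps)
  \<comment> \<open>8 times \<open>pow n\<close>, the denominator at index n + 3.\<close>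
  define E where "E = T * (T * (T * P))"
  have "d * ((p * E + T * s) * d' + b' * (s * E)) = T * (T * (p * (T * P) * (d * d'))) + T * v + T * (T * (T * \<delta>))"
    by (simp add: cross E_def algebra_simps)
  also have "\<dots> \<le> T * (T * v) + T * v + T * (T * (T * \<delta>))"
    using 4 by (intro add_right_mono mult_left_mono) simp_all
  \<comment> \<open>Here 6 times \<open>v\<close> is compared with 8 times \<open>v\<close>; the
    slack is \<open>v + v\<close>.\<close>
  also have "\<dots> \<le> T * (T * (T * (\<delta> + v)))"
  proof -
    from TT have "T * (T * v) + T * v + T * (T * (T * \<delta>)) + (v + v) = T * (T * (T * (\<delta> + v)))"
      by (simp only: add_ac)
    then show ?thesis by (metis le_iff_add)
  qed
  also have "\<dots> < T * (T * (T * \<gamma>))"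
    using 3 by (intro mult_strict_left_mono) (simp_all add: T_def add_pos_pos)
  also have "\<dots> = d * (a' * (s * E))" by (simp add: cross E_def algebra_simps)
  finally have "(p * E + T * s) * d' + b' * (s * E) < a' * (s * E)"
    by (rule mult_left_less_imp_less) simp
  moreover have E: "pow (n + 1 + 1 + 1) = E" by (simp add: E_def TT vars)
  moreover have "0 < E" unfolding E[symmetric] by (rule pow_pos)
  ultimately show ?thesis using S(1) gt0 by (simp add: qlt_def T_def flip: vars)
qed

lemma one_le_iff: "1 \<le> a \<longleftrightarrow> a \<noteq> (0::'n)"
  using less_iff_succ_less_eq[of 0 a] zero_less_iff_neq_zero[of a] by simp

text \<open>The number of values may be nonstandard, so the bound comes by induction on it. It will
  provide a cut-off above all exponents that occur in a finite sum.\<close>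

lemma bounded_values:
  assumes "v \<in> D (T0 \<^bold>\<Rightarrow> T1)" "Y \<in> D T2"
  shows "\<exists>b. \<forall>j<m. val2 Y (v \<bullet> code j) \<le> b"
proof (rule code_induct[where P = "\<lambda>m. \<exists>b. \<forall>j<m. val2 Y (v \<bullet> code j) \<le> b"])
  let ?\<phi> = "Exists T0 (Forall T0 (V 0 \<^bold>< V 2 \<^bold>\<longrightarrow> \<^bold>\<not> (V 1 \<^bold>< V 4 \<cdot> (V 3 \<cdot> V 0))))"
  let ?e = "case_nat v (case_nat Y (\<lambda>_. Y))"
  show "wf_fm (T0 # [T0 \<^bold>\<Rightarrow> T1, T2]) ?\<phi>" by simp
  show "env ?e [T0 \<^bold>\<Rightarrow> T1, T2]" using assms by simp
  show "sat (case_nat (code m) ?e) ?\<phi> \<longleftrightarrow> (\<exists>b. \<forall>j<m. val2 Y (v \<bullet> code j) \<le> b)" for m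
    using assms by (simp add: eval_nat_numeral app_code2 flip: not_less)
  show "\<exists>b. \<forall>j<m + 1. val2 Y (v \<bullet> code j) \<le> b" if "\<exists>b. \<forall>j<m. val2 Y (v \<bullet> code j) \<le> b" for m
  proof -
    from that obtain b where "\<forall>j<m. val2 Y (v \<bullet> code j) \<le> b" by blast
    then have "\<forall>j<m + 1. val2 Y (v \<bullet> code j) \<le> max b (val2 Y (v \<bullet> code m))"
      by (auto simp: less_succ_iff le_max_iff_disj)
    then show ?thesis by blast
  qed
qed simp

lemma ex_append:
  assumes "w \<in> D (T0 \<^bold>\<Rightarrow> T1)" "x \<in> D T1"
  obtains w' where "w' \<in> D (T0 \<^bold>\<Rightarrow> T1)" "\<And>i. w' \<bullet> code i = (if i < n then w \<bullet> code i else x)"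
proof -
  \<comment> \<open>Truncated \<open>n - i\<close> is nonzero exactly for \<open>i < n\<close>,
    where the old sequence is kept.\<close>
  let ?t = "cond_tm (V 3 \<^bold>- V 1) (V 4 \<cdot> V 1 \<cdot> V 0) (V 2 \<cdot> V 0)"
  let ?e = "case_nat x (case_nat (code n) (case_nat w (\<lambda>_. w)))"
  obtain f where f: "f \<in> D (T0 \<^bold>\<Rightarrow> T1)"
    "\<forall>i\<in>D T0. \<forall>k\<in>D T0. f \<bullet> i \<bullet> k = tval (case_nat k (case_nat i ?e)) ?t"
    using ex_fun2[of T0 T0 "[T1, T0, T0 \<^bold>\<Rightarrow> T1]" ?t T0 ?e] assms by auto
  have "f \<bullet> code i = (if i < n then w \<bullet> code i else x)" for i
    using f assms
    by (intro T1_ext) (auto simp: val_def eval_nat_numeral diff_eq_0_iff not_le)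
  with f(1) show thesis by (rule that)
qed

lemma sat_r_sum_less:
  assumes "tval e a \<in> D (T1 \<^bold>\<Rightarrow> T1)" "tval e w \<in> D (T0 \<^bold>\<Rightarrow> T1)" "tval e n \<in> D T0" "tval e s \<in> D T1"
    and "g \<in> D T1" "\<And>j k. val (tval e a \<bullet> (tval e w \<bullet> code j)) k = val g j"
  shows "sat e (r_lt (r_abs (r_sum a w n)) s) \<longleftrightarrow>
    (\<exists>k. qlt (qadd (qabs (qsum g (num (tval e n)))) (qpow' k)) (val (tval e s) k))"
  using r_sum_val[OF assms(1-3,5,6)] assms(4) r_abs_val by (simp add: Rlt_def)

end

section \<open>The weights of a countable set and their summability\<close>

locale countable_subset = arithmetic_model +
  fixes F Y
  assumes F: "F \<in> D T2" and Y: "Y \<in> D T2"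
    and Fun_F: "Fun F" and Fun_Y: "Fun Y"
    and F_01: "x \<in> D T1 \<Longrightarrow> Real x \<Longrightarrow> val2 F x = 0 \<or> val2 F x = 1"
    and Mem_Unit: "x \<in> D T1 \<Longrightarrow> Mem x F \<Longrightarrow> Unit x"
    and Y_inj: "x \<in> D T1 \<Longrightarrow> y \<in> D T1 \<Longrightarrow> Mem x F \<Longrightarrow> Mem y F \<Longrightarrow> val2 Y x = val2 Y y \<Longrightarrow> Req x y"
begin

text \<open>A rational code rather than a real: the real attached to \<open>x\<close> is the
  constant sequence at it, which keeps all sums exact.\<close>

definition weight :: "'a \<Rightarrow> 'b" where
  "weight x = (if val2 F x = 0 then qzero else qpow (val2 Y x))"

lemma ex_weight:
  obtains A where "A \<in> D (T1 \<^bold>\<Rightarrow> T1)" "\<And>x k. x \<in> D T1 \<Longrightarrow> val (A \<bullet> x) k = weight x"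
proof -
  let ?t = "cond_tm (V 3 \<cdot> V 1) (q_pow (V 2 \<cdot> V 1)) q_zero"
  let ?e = "case_nat Y (case_nat F (\<lambda>_. F))"
  obtain A where A: "A \<in> D (T1 \<^bold>\<Rightarrow> T1)"
    "\<forall>x\<in>D T1. \<forall>k\<in>D T0. A \<bullet> x \<bullet> k = tval (case_nat k (case_nat x ?e)) ?t"
    using ex_fun2[of T0 T1 "[T2, T2]" ?t T0 ?e] F Y by auto
  have "val (A \<bullet> x) k = weight x" if "x \<in> D T1" for x k
    using A that F Y by (simp add: val_def weight_def eval_nat_numeral app_code2)
  with A(1) show thesis by (rule that)
qed

text \<open>Full induction is needed because the enumeration quantifies over sequences of reals.\<close>

lemma finite_enumeration:
  "\<exists>n. \<exists>w\<in>D (T0 \<^bold>\<Rightarrow> T1). Fin n w \<and> (\<forall>i<n. Mem (w \<bullet> code i) F \<and> val2 Y (w \<bullet> code i) < c) \<and>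
     (\<forall>x\<in>D T1. Mem x F \<longrightarrow> val2 Y x < c \<longrightarrow> (\<exists>i<n. Req (w \<bullet> code i) x))"
  (is "\<exists>n. \<exists>w\<in>?W. ?Q c n w")
proof (rule code_induct[where P = "\<lambda>c. \<exists>n. \<exists>w\<in>?W. ?Q c n w"])
  let ?\<phi> = "Exists T0 (Exists (T0 \<^bold>\<Rightarrow> T1) (fin (V 1) (V 0) \<^bold>\<and>
    Forall T0 (V 0 \<^bold>< V 2 \<^bold>\<longrightarrow> mem (V 1 \<cdot> V 0) (V 5) \<^bold>\<and> V 4 \<cdot> (V 1 \<cdot> V 0) \<^bold>< V 3) \<^bold>\<and>
    Forall T1 (mem (V 0) (V 5) \<^bold>\<longrightarrow> V 4 \<cdot> V 0 \<^bold>< V 3 \<^bold>\<longrightarrow>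
      Exists T0 (V 0 \<^bold>< V 3 \<^bold>\<and> r_eq (V 2 \<cdot> V 0) (V 1)))))"
  let ?e = "case_nat Y (case_nat F (\<lambda>_. F))"
  show "wf_fm (T0 # [T2, T2]) ?\<phi>" by simp
  show "env ?e [T2, T2]" using F Y by simp
  show "sat (case_nat (code c) ?e) ?\<phi> \<longleftrightarrow> (\<exists>n. \<exists>w\<in>?W. ?Q c n w)" for c
    using F Y by (simp add: eval_nat_numeral app_code2)
  \<comment> \<open>For length 0 any sequence will do, and the combinator supplies a constant
    one.\<close>
  have "cn (KC T1 T0) \<bullet> F' \<in> ?W" if "F' \<in> D T1" for F'
    using that app_in con_in(5) by blast
  then have "?Q 0 0 (cn (KC T1 T0) \<bullet> rconst 0)" "cn (KC T1 T0) \<bullet> rconst 0 \<in> ?W"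
    by (auto simp: Fin_def)
  then show "\<exists>n. \<exists>w\<in>?W. ?Q 0 n w" by blast
  fix c assume "\<exists>n. \<exists>w\<in>?W. ?Q c n w"
  then obtain n w where w: "w \<in> ?W" and fin: "Fin n w"
    and small: "\<And>i. i < n \<Longrightarrow> Mem (w \<bullet> code i) F \<and> val2 Y (w \<bullet> code i) < c"
    and cover: "\<And>x. x \<in> D T1 \<Longrightarrow> Mem x F \<Longrightarrow> val2 Y x < c \<Longrightarrow> \<exists>i<n. Req (w \<bullet> code i) x"
    by blast
  show "\<exists>n. \<exists>w\<in>?W. ?Q (c + 1) n w"
  proof (cases "\<exists>x\<in>D T1. Mem x F \<and> val2 Y x = c")
    case False
    then have "?Q (c + 1) n w" using fin small cover by (auto simp: less_succ_iff)
    then show ?thesis using w by blast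
  next
    case True
    \<comment> \<open>One new entry suffices: by \<open>Y_inj\<close> all members with value
      \<open>c\<close> are equal as reals. It differs from the old entries, whose values are below
      \<open>c\<close>.\<close>
    then obtain x where x: "x \<in> D T1" "Mem x F" "val2 Y x = c" by blast
    obtain w' where w': "w' \<in> ?W" "\<And>i. w' \<bullet> code i = (if i < n then w \<bullet> code i else x)"
      using ex_append[OF w x(1)] by blast
    have "\<not> Req (w \<bullet> code i) x" if "i < n" for i
      using Fun_Y small[OF that] x w unfolding Fun_def Mem_def by fastforce
    then have "Fin (n + 1) w'"
      using fin x Mem_Unit unfolding Fin_def by (auto simp: w'(2) less_succ_iff)
    moreover have "Mem (w' \<bullet> code i) F \<and> val2 Y (w' \<bullet> code i) < c + 1" if "i < n + 1" for i
      using that small x by (auto simp: w'(2) less_succ_iff)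
    moreover have "\<exists>i<n + 1. Req (w' \<bullet> code i) x'"
      if x': "x' \<in> D T1" "Mem x' F" "val2 Y x' < c + 1" for x'
    proof (cases "val2 Y x' = c")
      case True
      then have "Req (w' \<bullet> code n) x'" using Y_inj x x' by (simp add: w'(2))
      then show ?thesis by (auto simp: less_succ_iff)
    next
      case False
      then obtain i where "i < n" "Req (w \<bullet> code i) x'"
        using cover x' by (auto simp: less_succ_iff)
      then have "i < n + 1" "Req (w' \<bullet> code i) x'" by (auto simp: w'(2) less_succ_iff)
      then show ?thesis by blast
    qed
    ultimately have "?Q (c + 1) (n + 1) w'" by blast
    then show ?thesis using w'(1) by blast
  qed
qed

text \<open>The rows of \<open>G\<close> cut the weights off at a given exponent. A cut-off above
  all values of \<open>Y\<close> along \<open>v\<close> removes nothing, so the bound for rows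
  applies to the whole sum; injectivity of \<open>Y\<close> makes the exponents distinct.\<close>

lemma tail_sum:
  assumes v: "v \<in> D (T0 \<^bold>\<Rightarrow> T1)" and fin: "Fin m v"
    and large: "\<And>j. j < m \<Longrightarrow> Mem (v \<bullet> code j) F \<Longrightarrow> c < val2 Y (v \<bullet> code j)"
    and g: "g \<in> D T1" "\<And>j. val g j = weight (v \<bullet> code j)"
  shows "ng (qsum g m) = 0" "ps (qsum g m) * pow c \<le> dn (qsum g m)"
proof -
  show "ng (qsum g m) = 0" using g by (intro ng_qsum) (auto simp: weight_def)
  let ?s = "\<lambda>j. val2 F (v \<bullet> code j) \<noteq> 0" and ?y = "\<lambda>j. val2 Y (v \<bullet> code j)"
  \<comment> \<open>The inner condition is nonzero exactly when the exponent is at most the row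
    index \<open>V 1\<close>.\<close>
  let ?t = "cond_tm (V 4 \<cdot> (V 2 \<cdot> V 0))
    (cond_tm (\<^bold>1 \<^bold>- (V 3 \<cdot> (V 2 \<cdot> V 0) \<^bold>- V 1)) (q_pow (V 3 \<cdot> (V 2 \<cdot> V 0))) q_zero) q_zero"
  let ?e = "case_nat v (case_nat Y (case_nat F (\<lambda>_. F)))"
  obtain G where G: "G \<in> D (T0 \<^bold>\<Rightarrow> T1)"
    "\<forall>b\<in>D T0. \<forall>j\<in>D T0. G \<bullet> b \<bullet> j = tval (case_nat j (case_nat b ?e)) ?t"
    using ex_fun2[of T0 T0 "[T0 \<^bold>\<Rightarrow> T1, T2, T2]" ?t T0 ?e] F Y v by auto
  have val: "val (G \<bullet> code b) j = (if ?s j \<and> ?y j \<le> b then qpow (?y j) else qzero)" for b j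
    using G(2) F Y v
    by (simp add: val_def eval_nat_numeral app_code2 one_le_iff diff_eq_0_iff)
  have unit: "Unit (v \<bullet> code j)" if "j < m" for j using fin that by (simp add: Fin_def)
  have mem: "Mem (v \<bullet> code j) F" if "?s j" "j < m" for j
    using unit[OF that(2)] F_01[of "v \<bullet> code j"] that v by (auto simp: Unit_def Mem_def)
  have distinct: "?y i \<noteq> ?y j" if "i < j" "j < m" "?s i" "?s j" for i j
    using Y_inj[of "v \<bullet> code i" "v \<bullet> code j"] mem that fin v by (auto simp: Fin_def)
  obtain b where b: "\<forall>j<m. ?y j \<le> b" using bounded_values[OF v Y] by blast
  have "?y j \<le> c + b" if "j < m" for j using b that by (simp add: add_increasing)
  then have "\<forall>j<m. val g j = val (G \<bullet> code (c + b)) j"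
    using g(2) by (simp add: val weight_def)
  then have "qsum g m = qsum (G \<bullet> code (c + b)) m"
    using qsum_cong[of g "G \<bullet> code (c + b)" m] g(1) G(1) by simp
  then show "ps (qsum g m) * pow c \<le> dn (qsum g m)"
    using qsum_distinct_powers[OF G(1) val distinct] large mem by simp
qed

lemma cauchy_weight:
  assumes A: "A \<in> D (T1 \<^bold>\<Rightarrow> T1)" "\<And>x k. x \<in> D T1 \<Longrightarrow> val (A \<bullet> x) k = weight x"
  shows "sat (case_nat A e) (cauchy (V 0))"
proof -
  \<comment> \<open>The claim has the shape to which simplification brings the semantics of
    \<open>cauchy\<close>, with disjointness turned into a disjunction.\<close>
  have "\<exists>n. \<exists>w\<in>D (T0 \<^bold>\<Rightarrow> T1). Fin n w \<and> (\<forall>m. \<forall>v\<in>D (T0 \<^bold>\<Rightarrow> T1).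
      Fin m v \<longrightarrow> (\<exists>i<m. \<exists>j<n. Req (v \<bullet> code i) (w \<bullet> code j)) \<or>
      sat (case_nat v (case_nat (code m) (case_nat w (case_nat (code n) (case_nat \<epsilon> (case_nat A e))))))
        (r_lt (r_abs (r_sum (V 5) (V 0) (V 1))) (V 4)))"
    if \<epsilon>: "\<epsilon> \<in> D T1" "Real \<epsilon>" "Rlt (rconst qzero) \<epsilon>" for \<epsilon>
  proof -
    obtain n0 where n0: "qlt (qadd qzero (qpow' n0)) (val \<epsilon> n0)"
      using \<epsilon>(3) by (auto simp: Rlt_def)
    \<comment> \<open>Listing all exponents below \<open>n0 + 2\<close> leaves those above
      \<open>n0 + 1\<close>, whose powers sum to at most 2^-(n0+1), as \<open>small_sum_less\<close>
      requires.\<close>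
    obtain n w where w: "w \<in> D (T0 \<^bold>\<Rightarrow> T1)" "Fin n w"
      and cover: "\<And>x. x \<in> D T1 \<Longrightarrow> Mem x F \<Longrightarrow> val2 Y x < n0 + 1 + 1 \<Longrightarrow> \<exists>i<n. Req (w \<bullet> code i) x"
      using finite_enumeration[of "n0 + 1 + 1"] by blast
    have "sat (case_nat v (case_nat (code m) (case_nat w (case_nat (code n) (case_nat \<epsilon> (case_nat A e))))))
        (r_lt (r_abs (r_sum (V 5) (V 0) (V 1))) (V 4))" (is "sat ?e _")
      if v: "v \<in> D (T0 \<^bold>\<Rightarrow> T1)" and fin: "Fin m v"
        and disj: "\<And>i j. i < m \<Longrightarrow> j < n \<Longrightarrow> \<not> Req (v \<bullet> code i) (w \<bullet> code j)" for m v
    proof -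
      let ?t = "cond_tm (V 3 \<cdot> (V 1 \<cdot> V 0)) (q_pow (V 2 \<cdot> (V 1 \<cdot> V 0))) q_zero"
      let ?e' = "case_nat v (case_nat Y (case_nat F (\<lambda>_. F)))"
      obtain g where g: "g \<in> D T1" "\<forall>j\<in>D T0. g \<bullet> j = tval (case_nat j ?e') ?t"
        using ex_fun[of T0 "[T0 \<^bold>\<Rightarrow> T1, T2, T2]" ?t T0 ?e'] F Y v by auto
      have val_g: "val g j = weight (v \<bullet> code j)" for j
        using g(2) F Y v by (simp add: val_def weight_def eval_nat_numeral app_code2)
      have large: "n0 + 1 < val2 Y (v \<bullet> code j)" if "j < m" "Mem (v \<bullet> code j) F" for j
        using cover[of "v \<bullet> code j"] disj that v Req_sym by (force simp: not_less simp flip: less_eq_iff_succ_less)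
      have sum: "ng (qsum g m) = 0" "ps (qsum g m) * (pow n0 + pow n0) \<le> dn (qsum g m)"
        using tail_sum[OF v fin large g(1) val_g] by simp_all
      have "qlt (qdist (val \<epsilon> n0) (val \<epsilon> (n0 + 1 + 1 + 1))) (qpow n0)"
        using \<epsilon>(2) unfolding Real_def by (simp only: add.assoc)
      from small_sum_less[OF sum n0 this]
      have "\<exists>k. qlt (qadd (qabs (qsum g m)) (qpow' k)) (val \<epsilon> k)" by (rule exI[where x = "n0 + 1 + 1 + 1"])
      then show ?thesis
        using A v g(1) \<epsilon>(1)
        by (subst sat_r_sum_less[of _ _ _ _ _ g]) (auto simp: eval_nat_numeral val_g)
    qed
    with w show ?thesis by blast
  qed
  then show ?thesis
    by (simp add: cauchy_def fin_disjoint_def eval_nat_numeral)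
qed

text \<open>Constant sequences are real numbers at once, and equal reals have the same weight since
  both \<open>F\<close> and \<open>Y\<close> respect equality of reals.\<close>

lemma weight_regular:
  assumes A: "A \<in> D (T1 \<^bold>\<Rightarrow> T1)" "\<And>x k. x \<in> D T1 \<Longrightarrow> val (A \<bullet> x) k = weight x"
  shows "sat (case_nat A e) (unit_fun (V 0))" "sat (case_nat A e) (nonneg (V 0))"
proof -
  have "Real (A \<bullet> x)" if "x \<in> D T1" for x
    using A that by (simp add: Real_def qlt_def weight_def)
  moreover have "Req (A \<bullet> x) (A \<bullet> y)" if "x \<in> D T1" "y \<in> D T1" "Unit x" "Unit y" "Req x y" for x y
  proof -
    have "weight x = weight y"
      using that Fun_F Fun_Y by (simp add: weight_def Fun_def Unit_def)
    then show ?thesis using A that by (simp add: Req_def qlt_def add.commute)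
  qed
  ultimately show "sat (case_nat A e) (unit_fun (V 0))"
    using A by (simp add: unit_fun_def)
  have "\<not> Rlt (A \<bullet> x) (rconst qzero)" if "x \<in> D T1" for x
    using A that by (simp add: Rlt_def qlt_def weight_def)
  then show "sat (case_nat A e) (nonneg (V 0))"
    using A by (simp add: nonneg_def)
qed

lemma weight_nonzero:
  assumes "A \<in> D (T1 \<^bold>\<Rightarrow> T1)" "\<And>x k. x \<in> D T1 \<Longrightarrow> val (A \<bullet> x) k = weight x"
    and "x \<in> D T1" "val2 F x \<noteq> 0"
  shows "\<not> Req (A \<bullet> x) (rconst qzero)"
proof -
  let ?p = "pow (val2 Y x)"
  have "?p + ?p < ?p + ?p + (?p + ?p)" "0 < ?p + ?p + (?p + ?p)" by (simp_all add: add_pos_pos)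
  \<comment> \<open>Equality of reals tolerates 2 * 2^-k at index k. Two steps beyond the exponent
    this is half of the weight; one step beyond, it would equal the weight and refute
    nothing.\<close>
  then have "qlt (qpow' (val2 Y x + 1 + 1)) (qdist (weight x) qzero)"
    using assms(4) by (simp add: qlt_def weight_def mult_2)
  then show ?thesis using assms(2,3) unfolding Req_def by (metis val_rconst)
qed

lemma ex_enumeration:
  assumes Sum: "sat e Sum_principle" and x0: "x0 \<in> D T1" "Mem x0 F"
  shows "\<exists>X\<in>D (T0 \<^bold>\<Rightarrow> T1). (\<forall>i. Mem (X \<bullet> code i) F) \<and>
    (\<forall>x\<in>D T1. Real x \<longrightarrow> (Mem x F \<longleftrightarrow> (\<exists>i. Req (X \<bullet> code i) x)))"
proof -
  obtain A where A: "A \<in> D (T1 \<^bold>\<Rightarrow> T1)" "\<And>x k. x \<in> D T1 \<Longrightarrow> val (A \<bullet> x) k = weight x"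
    using ex_weight by blast
  have "\<exists>w\<in>D (T0 \<^bold>\<Rightarrow> T1). (\<forall>i. Unit (w \<bullet> code i)) \<and>
    (\<forall>x\<in>D T1. Unit x \<longrightarrow> (\<exists>i. Req x (w \<bullet> code i)) \<or> Req (A \<bullet> x) (rconst qzero))"
    using Sum A(1) weight_regular[OF A] cauchy_weight[OF A]
    by (simp add: Sum_principle_def eval_nat_numeral)
  then obtain w where w: "w \<in> D (T0 \<^bold>\<Rightarrow> T1)" "\<And>i. Unit (w \<bullet> code i)"
    "\<And>x. x \<in> D T1 \<Longrightarrow> Unit x \<Longrightarrow> (\<exists>i. Req x (w \<bullet> code i)) \<or> Req (A \<bullet> x) (rconst qzero)"
    by blast
  let ?t = "cond_tm (V 4 \<cdot> (V 2 \<cdot> V 1)) (V 2 \<cdot> V 1 \<cdot> V 0) (V 3 \<cdot> V 0)"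
  let ?e = "case_nat w (case_nat x0 (case_nat F (\<lambda>_. F)))"
  obtain X where X: "X \<in> D (T0 \<^bold>\<Rightarrow> T1)"
    "\<forall>i\<in>D T0. \<forall>k\<in>D T0. X \<bullet> i \<bullet> k = tval (case_nat k (case_nat i ?e)) ?t"
    using ex_fun2[of T0 T0 "[T0 \<^bold>\<Rightarrow> T1, T1, T2]" ?t T0 ?e] F w(1) x0(1) by auto
  have X_app: "X \<bullet> code i = (if val2 F (w \<bullet> code i) = 0 then x0 else w \<bullet> code i)" for i
    using X F w(1) x0(1) by (intro T1_ext) (auto simp: val_def eval_nat_numeral app_code2)
  have mem: "Mem (X \<bullet> code i) F" for i
    using F_01[of "w \<bullet> code i"] w(1) w(2)[of i] x0(2) by (auto simp: X_app Mem_def Unit_def)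
  have "Mem x F \<longleftrightarrow> (\<exists>i. Req (X \<bullet> code i) x)" if x: "x \<in> D T1" "Real x" for x
  proof
    assume "Mem x F"
    then have "\<not> Req (A \<bullet> x) (rconst qzero)" using weight_nonzero[OF A x(1)] by (simp add: Mem_def)
    then obtain i where i: "Req x (w \<bullet> code i)" using w(3) Mem_Unit x(1) \<open>Mem x F\<close> by blast
    then have "val2 F x = val2 F (w \<bullet> code i)"
      using Fun_F x w(1) w(2)[of i] by (simp add: Fun_def Unit_def)
    then have "Req (X \<bullet> code i) x" using \<open>Mem x F\<close> Req_sym[OF i] by (simp add: X_app Mem_def)
    then show "\<exists>i. Req (X \<bullet> code i) x" by blast
  next
    assume "\<exists>i. Req (X \<bullet> code i) x"
    then obtain i where "Req (X \<bullet> code i) x" by blast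
    then have "val2 F (X \<bullet> code i) = val2 F x"
      using Fun_F x X(1) mem[of i] unfolding Fun_def Mem_def by (metis D_app(3) code_in)
    then show "Mem x F" using mem[of i] x(2) by (simp add: Mem_def)
  qed
  then show ?thesis using X(1) mem by blast
qed

end

context arithmetic_model
begin

theorem Sum_imp_cocode0: "sat e (Sum_principle \<^bold>\<longrightarrow> cocode0)"
proof -
  \<comment> \<open>Stated in the form in which simplification leaves the semantics of
    \<open>cocode0\<close>, so that the final step is plain matching.\<close>
  have enum: "\<exists>X\<in>D (T0 \<^bold>\<Rightarrow> T1). (\<forall>i. Mem (X \<bullet> code i) F) \<and> (\<forall>x\<in>D T1. Real x \<longrightarrow>
      (Mem x F \<longrightarrow> (\<exists>i. Req (X \<bullet> code i) x)) \<and> ((\<forall>i. \<not> Req (X \<bullet> code i) x) \<or> Mem x F))"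
    if "sat e Sum_principle" "F \<in> D T2" "Fun F"
      "\<forall>x\<in>D T1. Real x \<longrightarrow> val2 F x = 0 \<or> val2 F x = 1"
      "\<forall>x\<in>D T1. Mem x F \<longrightarrow> Unit x" "x0 \<in> D T1" "Mem x0 F" "Y \<in> D T2" "Fun Y"
      "\<forall>x\<in>D T1. Mem x F \<longrightarrow> (\<forall>y\<in>D T1. val2 Y x = val2 Y y \<longrightarrow> Mem y F \<longrightarrow> Req x y)"
    for F Y x0
  proof -
    interpret countable_subset D app cn lt code F Y
      using that by unfold_locales blast+
    show ?thesis using ex_enumeration[OF that(1,6,7)] by blast
  qed
  show ?thesis
    by (simp add: cocode0_def is_set_def countable_set_def eval_nat_numeral app_code2)
      (intro impI ballI; elim conjE bexE; rule enum; assumption)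
qed

end

section \<open>The numbers of a countermodel as a type\<close>

type_synonym num_structure =
  "tm set \<times> (tm \<Rightarrow> tm \<Rightarrow> tm) \<times> (tm \<Rightarrow> tm \<Rightarrow> tm) \<times> tm \<times> tm \<times> (tm \<Rightarrow> tm \<Rightarrow> bool)"

definition is_natural :: "num_structure \<Rightarrow> bool" where
  "is_natural S \<longleftrightarrow> (case S of (N, a, m, z, u, l) \<Rightarrow> natural_structure N a m z u l)"

definition number_part ::
  "(ty \<Rightarrow> tm set) \<Rightarrow> (tm \<Rightarrow> tm \<Rightarrow> tm) \<Rightarrow> (con \<Rightarrow> tm) \<Rightarrow> (tm \<Rightarrow> tm \<Rightarrow> bool) \<Rightarrow> num_structure" where
  "number_part D app cn lt =
     (D T0, \<lambda>x. app (app (cn Plus) x), \<lambda>x. app (app (cn Times) x), cn Zero, cn One, lt)"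

definition countermodel ::
  "(ty \<Rightarrow> tm set) \<Rightarrow> (tm \<Rightarrow> tm \<Rightarrow> tm) \<Rightarrow> (con \<Rightarrow> tm) \<Rightarrow> (tm \<Rightarrow> tm \<Rightarrow> bool) \<Rightarrow> bool" where
  "countermodel D app cn lt \<longleftrightarrow> base_model D app cn lt \<and>
     (\<forall>e. \<not> typed_structure.sat D app cn lt e (Sum_principle \<^bold>\<longrightarrow> cocode0))"

text \<open>The natural numbers carried by the variables, since the carrier has to consist of terms,
  as in a countermodel.\<close>

definition standard_numbers :: num_structure where
  "standard_numbers = (range V, \<lambda>x y. V (inv V x + inv V y), \<lambda>x y. V (inv V x * inv V y), V 0, V 1,
     \<lambda>x y. inv V x < inv V y)"

text \<open>A type definition cannot depend on the assumption that there is a countermodel; the standard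
  numbers serve as a default.\<close>

definition numbers :: num_structure where
  "numbers = (SOME S. is_natural S \<and> ((\<exists>D app cn lt. countermodel D app cn lt) \<longrightarrow>
     (\<exists>D app cn lt. countermodel D app cn lt \<and> S = number_part D app cn lt)))"

lemma is_naturalD: "is_natural S \<Longrightarrow> natural_structure (fst S) (fst (snd S)) (fst (snd (snd S)))
    (fst (snd (snd (snd S)))) (fst (snd (snd (snd (snd S))))) (snd (snd (snd (snd (snd S)))))"
  by (cases S) (simp add: is_natural_def)

lemma is_natural_number_part: "base_model D app cn lt \<Longrightarrow> is_natural (number_part D app cn lt)"
  using base_model.natural_structure by (simp add: is_natural_def number_part_def)

lemma is_natural_standard: "is_natural standard_numbers"
proof -
  have [simp]: "inv V (V n) = n" for n by (simp add: inv_f_f inj_def)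
  have "natural_structure (range V) (\<lambda>x y. V (inv V x + inv V y)) (\<lambda>x y. V (inv V x * inv V y)) (V 0) (V 1)
     (\<lambda>x y. inv V x < inv V y)"
  proof
    show "\<exists>w\<in>range V. V (inv V y + inv V w) = x"
      if "x \<in> range V" "y \<in> range V" "\<not> inv V x < inv V y" for x y
      using that by (intro bexI[of _ "V (inv V x - inv V y)"]) auto
    show "x = V 0 \<or> (\<exists>y\<in>range V. x = V (inv V y + inv V (V 1)))" if "x \<in> range V" for x
    proof -
      from that obtain i where "x = V i" by blast
      then show ?thesis by (cases i) auto
    qed
  qed (auto simp: algebra_simps)
  then show ?thesis by (simp add: is_natural_def standard_numbers_def)
qed

text \<open>The choice can be met in either case: by the number part of a countermodel if there is
  one, and by the standard numbers otherwise.\<close>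

lemma numbers_spec:
  "is_natural numbers \<and> ((\<exists>D app cn lt. countermodel D app cn lt) \<longrightarrow>
     (\<exists>D app cn lt. countermodel D app cn lt \<and> numbers = number_part D app cn lt))"
proof -
  have "\<exists>S. is_natural S \<and> ((\<exists>D app cn lt. countermodel D app cn lt) \<longrightarrow>
     (\<exists>D app cn lt. countermodel D app cn lt \<and> S = number_part D app cn lt))"
    using is_natural_number_part is_natural_standard unfolding countermodel_def by metis
  then show ?thesis unfolding numbers_def by (rule someI_ex)
qed

abbreviation N_set :: "tm set" where "N_set \<equiv> fst numbers"
abbreviation N_add :: "tm \<Rightarrow> tm \<Rightarrow> tm" where "N_add \<equiv> fst (snd numbers)"
abbreviation N_mul :: "tm \<Rightarrow> tm \<Rightarrow> tm" where "N_mul \<equiv> fst (snd (snd numbers))"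
abbreviation N_zero :: tm where "N_zero \<equiv> fst (snd (snd (snd numbers)))"
abbreviation N_one :: tm where "N_one \<equiv> fst (snd (snd (snd (snd numbers))))"
abbreviation N_less :: "tm \<Rightarrow> tm \<Rightarrow> bool" where "N_less \<equiv> snd (snd (snd (snd (snd numbers))))"

interpretation N: natural_structure N_set N_add N_mul N_zero N_one N_less
  using numbers_spec is_naturalD by blast

typedef number = N_set morphisms elem number
  using N.zero_in by blast

setup_lifting type_definition_number

section \<open>Ordered semiring structure on the type of numbers\<close>

instantiation number :: "{zero, one, plus, times, ord, minus}"
begin

lift_definition zero_number :: number is N_zero by (rule N.zero_in)
lift_definition one_number :: number is N_one by (rule N.one_in)
lift_definition plus_number :: "number \<Rightarrow> number \<Rightarrow> number" is N_add by (rule N.add_in)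
lift_definition times_number :: "number \<Rightarrow> number \<Rightarrow> number" is N_mul by (rule N.mul_in)
lift_definition less_number :: "number \<Rightarrow> number \<Rightarrow> bool" is N_less .
definition less_eq_number :: "number \<Rightarrow> number \<Rightarrow> bool" where "less_eq_number a b \<longleftrightarrow> a < b \<or> a = b"
definition minus_number :: "number \<Rightarrow> number \<Rightarrow> number" where
  "minus_number a b = (if b \<le> a then THE c. b + c = a else 0)"

instance ..

end

instance number :: linorder
proof
  fix a b c :: number
  have irrefl: "\<not> a < a" for a :: number by transfer (rule N.less_irrefl)
  have trans: "a < b \<Longrightarrow> b < c \<Longrightarrow> a < c" for a b c :: number by transfer (rule N.less_trans)
  have linear: "a < b \<or> a = b \<or> b < a" for a b :: number by transfer (rule N.less_linear)
  show "a < b \<longleftrightarrow> a \<le> b \<and> \<not> b \<le> a" "a \<le> a" "a \<le> b \<Longrightarrow> b \<le> c \<Longrightarrow> a \<le> c" "a \<le> b \<Longrightarrow> b \<le> a \<Longrightarrow> a = b"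
    "a \<le> b \<or> b \<le> a"
    unfolding less_eq_number_def using irrefl trans linear by metis+
qed

instance number :: comm_semiring_1
proof
  fix a b c :: number
  show "a + b + c = a + (b + c)" by transfer (rule N.add_assoc)
  show "a + b = b + a" by transfer (rule N.add_comm)
  show "0 + a = a" by transfer (metis N.add_comm N.add_zero N.zero_in)
  show "a * b * c = a * (b * c)" by transfer (rule N.mul_assoc)
  show "a * b = b * a" by transfer (rule N.mul_comm)
  show "1 * a = a" by transfer (metis N.mul_comm N.mul_one N.one_in)
  show "0 * a = 0" by transfer (metis N.mul_comm N.mul_zero N.zero_in)
  show "a * 0 = 0" by transfer (rule N.mul_zero)
  show "(a + b) * c = a * c + b * c" by transfer (metis N.mul_comm N.distrib N.add_in)
  show "(0::number) \<noteq> 1" by transfer (metis N.zero_less_one N.less_irrefl N.zero_in)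
qed

lemma number_add_less: "a < b \<Longrightarrow> a + c < b + (c::number)"
  by transfer (rule N.add_less)

lemma number_mult_less: "0 < c \<Longrightarrow> a < b \<Longrightarrow> a * c < b * (c::number)"
  by transfer (rule N.mul_less)

lemma number_zero_le: "0 \<le> (a::number)"
proof -
  have "\<not> a < 0" by transfer (rule N.nonneg)
  then show ?thesis by simp
qed

lemma number_add_cancel: "a + b = a + c \<longleftrightarrow> b = (c::number)"
  by (metis add.commute less_irrefl linorder_neqE number_add_less)

text \<open>Cancellation makes the missing summand unique, which gives the description operator in
  \<open>minus_number\<close> its meaning.\<close>

lemma number_add_diff: "a + b - a = (b::number)"
proof -
  have "a \<le> a + b"
    using number_zero_le[of b] number_add_less[of 0 b a] by (auto simp: less_eq_number_def add.commute)
  then show ?thesis by (simp add: minus_number_def number_add_cancel)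
qed

lemma number_le_iff_add: "a \<le> b \<longleftrightarrow> (\<exists>c. b = a + (c::number))"
proof
  assume "a \<le> b"
  then have "\<not> b < a" by simp
  then have "\<exists>c. a + c = b" by transfer (use N.subtract in auto)
  then show "\<exists>c. b = a + c" by blast
next
  assume "\<exists>c. b = a + c"
  then obtain c where c: "b = c + a" by (auto simp: add.commute)
  then show "a \<le> b"
    using number_zero_le[of c] number_add_less[of 0 c a] by (auto simp: less_eq_number_def)
qed

lemma number_diff_zero: "a \<le> b \<Longrightarrow> a - b = (0::number)"
  using number_add_diff[of a 0] by (auto simp: minus_number_def)

lemma number_less_iff_succ: "a < b \<longleftrightarrow> a + 1 \<le> (b::number)"
proof
  assume "a < b"
  then obtain c where c: "b = a + c" using number_le_iff_add[of a b] by auto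
  with \<open>a < b\<close> have "c \<noteq> 0" by auto
  have "c = 0 \<or> (\<exists>d. c = d + 1)" by transfer (use N.zero_or_succ in auto)
  then obtain d where "c = d + 1" using \<open>c \<noteq> 0\<close> by blast
  then have "b = a + 1 + d" using c by (simp add: ac_simps)
  then show "a + 1 \<le> b" using number_le_iff_add by blast
next
  have "(0::number) < 1" by transfer (rule N.zero_less_one)
  then have "a < a + 1" using number_add_less[of 0 1 a] by (simp add: add.commute)
  then show "a + 1 \<le> b \<Longrightarrow> a < b" by simp
qed

instance number :: "{discrete_linordered_semidom, ordered_cancel_comm_monoid_diff}"
proof
  fix a b c :: number
  show diff: "a + b - a = b" by (rule number_add_diff)
  show "a \<le> b \<longleftrightarrow> (\<exists>c. b = a + c)" by (rule number_le_iff_add)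
  show "0 - a = 0" by (rule number_diff_zero) (rule number_zero_le)
  show "a < b \<longleftrightarrow> a + 1 \<le> b" by (rule number_less_iff_succ)
  show "a \<le> b \<Longrightarrow> c + a \<le> c + b"
    using number_add_less[of a b c] by (auto simp: less_eq_number_def add.commute)
  show "c + a \<le> c + b \<Longrightarrow> a \<le> b"
    using number_add_less[of b a c] by (metis add.commute leD le_less_linear)
  show "b \<le> a \<Longrightarrow> a - b + b = a"
    unfolding number_le_iff_add using number_add_diff by (metis add.commute)
  show "a - b - c = a - (b + c)"
  proof (cases "b + c \<le> a")
    case True
    then obtain d where "a = b + c + d" by (auto simp: number_le_iff_add)
    then show ?thesis using number_add_diff[of b "c + d"] number_add_diff[of "b + c" d] number_add_diff[of c d]
      by (simp add: add.assoc)
  next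
    case False
    have "a - b \<le> c"
    proof (cases "b \<le> a")
      case True
      then obtain d where d: "a = b + d" by (auto simp: number_le_iff_add)
      then have "\<not> c \<le> d" using False by (auto simp: number_le_iff_add add.assoc)
      then show ?thesis using d number_add_diff by simp
    qed (simp add: number_diff_zero number_zero_le)
    then show ?thesis using False by (simp add: number_diff_zero)
  qed
  show "a < b \<Longrightarrow> 0 < c \<Longrightarrow> c * a < c * b"
    using number_mult_less[of c a b] by (simp add: mult.commute)
  show "a * (b - c) = a * b - a * c"
  proof (cases "c \<le> b")
    case True
    then obtain d where "b = c + d" by (auto simp: number_le_iff_add)
    then show ?thesis using number_add_diff by (simp add: distrib_left)
  next
    case False
    then obtain d where "c = b + d" using number_le_iff_add[of b c] by auto
    then show ?thesis
      using number_diff_zero number_le_iff_add by (metis distrib_left mult_zero_right)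
  qed
  show "(0::number) < 1" by transfer (rule N.zero_less_one)
  show "a \<noteq> 0 \<Longrightarrow> b \<noteq> 0 \<Longrightarrow> a * b \<noteq> 0"
    using number_mult_less[of b 0 a] number_zero_le by (metis less_irrefl mult_zero_left order_le_less)
qed

lemma ty_of_r_abs [simp]: "ty_of \<Gamma> x = Some T1 \<Longrightarrow> ty_of \<Gamma> (r_abs x) = Some T1"
  by (simp add: r_abs_def ty_of_lams[where \<tau> = T0] del: lams.simps)

lemma ty_of_r_sum [simp]:
  "ty_of \<Gamma> a = Some (T1 \<^bold>\<Rightarrow> T1) \<Longrightarrow> ty_of \<Gamma> w = Some (T0 \<^bold>\<Rightarrow> T1) \<Longrightarrow> ty_of \<Gamma> n = Some T0 \<Longrightarrow>
   ty_of \<Gamma> (r_sum a w n) = Some T1"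
  by (simp add: r_sum_def ty_of_lams[where \<tau> = T0] del: lams.simps)

theorem corollary3p11:
  shows "RCA0_omega \<^bold>\<union> IND \<^bold>\<turnstile> Sum_principle \<^bold>\<longrightarrow> cocode0"
proof (rule ccontr)
  assume not_prv: "\<not> (RCA0_omega \<^bold>\<union> IND \<^bold>\<turnstile> Sum_principle \<^bold>\<longrightarrow> cocode0)"
  have "wf_fm [] (Sum_principle \<^bold>\<longrightarrow> cocode0)"
    by (simp add: Sum_principle_def cocode0_def unit_fun_def cauchy_def nonneg_def is_set_def
        countable_set_def real_to_nat_def fin_disjoint_def)
  then have "\<exists>D app cn lt. countermodel D app cn lt"
    using not_prv base_theory_completeness unfolding countermodel_def by metis
  \<comment> \<open>The countermodel is taken from \<open>numbers_spec\<close> and may differ from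
    the one that completeness supplies: this one has the elements of type \<open>number\<close> as
    its numbers.\<close>
  then obtain D app cn lt where counter: "countermodel D app cn lt" and N: "numbers = number_part D app cn lt"
    using numbers_spec by blast
  interpret base_model D app cn lt using counter by (simp add: countermodel_def)
  have eqs: "N_set = D T0" "N_add x y = app (app (cn Plus) x) y" "N_mul x y = app (app (cn Times) x) y"
    "N_zero = cn Zero" "N_one = cn One" "N_less = lt" for x y
    by (simp_all add: N number_part_def)
  interpret arithmetic_model D app cn lt elem
    by unfold_locales (use type_definition.Rep_range[OF type_definition_number] in
      \<open>simp_all add: inj_def elem_inject zero_number.rep_eq one_number.rep_eq plus_number.rep_eq
        times_number.rep_eq less_number.rep_eq eqs\<close>)
  show False using Sum_imp_cocode0 counter by (simp add: countermodel_def)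
qed

end
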